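(* Let $(S,\mathfrak{m},k)$ and $(T,\mathfrak{n},k)$ be local rings with common residue field $k$, with $S\neq k\neq T$, and let $R=S\times_k T$ be their fiber product over $k$. Let $M$ be a finitely generated $R$-module and $Y$ a non-zero finitely generated $S$-module. Assume that $\operatorname{Tor}^R_m(Y,M)=0$ for some $m\geq 4$ and that at least one of the following two conditions holds: (1) $T$ is not a discrete valuation ring, or (2) $Y$ is not a free $S$-module. Then $\operatorname{pd}_R M\leq 1$. If, in addition, $S$ or $T$ has depth $0$, then $M$ is a free $R$-module.
   Context: A local ring is a commutative Noetherian ring with a unique maximal ideal. With $\pi_S:S\to k$ and $\pi_T:T\to k$ the natural surjections onto the common residue field, the fiber product is the subring $R=S\times_k T=\{(s,t)\in S\times T : \pi_S(s)=\pi_T(t)\}$ of $S\times T$; it is a local ring with maximal ideal $\mathfrak{m}\times\mathfrak{n}$. The projections $R\to S$, $(s,t)\mapsto s$, and $R\to T$, $(s,t)\mapsto t$, are surjective, and $S$-modules and $T$-modules are regarded as $R$-modules via these projections. $\operatorname{pd}_R$ denotes projective dimension over $R$. The zero module is considered free. *)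

theory Defs
  imports "HOL-Algebra.Algebra" "HOL-Library.Extended_Nat"
begin

section \<open>Rings\<close>

locale local_ring = cring R + noetherian_ring R for R (structure) +
  assumes unique_maximal: "\<exists>!I. maximalideal I R"

definition max_ideal :: "('r, 'a) ring_scheme \<Rightarrow> 'r set"
  where "max_ideal R = (THE I. maximalideal I R)"

locale discrete_valuation_ring = local_ring R + principal_domain R for R (structure) +
  assumes not_field: "\<not> field R"

definition fiber_product ::
  "('s, 'a) ring_scheme \<Rightarrow> ('t, 'b) ring_scheme \<Rightarrow> ('s \<Rightarrow> 'k) \<Rightarrow> ('t \<Rightarrow> 'k) \<Rightarrow> ('s \<times> 't) ring"
  where "fiber_product S T \<pi>\<^sub>S \<pi>\<^sub>T =
    (RDirProd S T)\<lparr>carrier := {(s, t). s \<in> carrier S \<and> t \<in> carrier T \<and> \<pi>\<^sub>S s = \<pi>\<^sub>T t}\<rparr>"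

text \<open>The condition at position \<open>i\<close> says that \<open>xs ! i\<close> is a non-zero-divisor on the quotient of
  \<open>R\<close> by the ideal generated by the preceding entries.\<close>

definition regular_sequence :: "('r, 'a) ring_scheme \<Rightarrow> 'r list \<Rightarrow> bool"
  where "regular_sequence R xs \<longleftrightarrow>
    set xs \<subseteq> carrier R \<and>
    (\<forall>i < length xs. \<forall>a \<in> carrier R.
       xs ! i \<otimes>\<^bsub>R\<^esub> a \<in> genideal R (set (take i xs)) \<longrightarrow> a \<in> genideal R (set (take i xs))) \<and>
    genideal R (set xs) \<noteq> carrier R"

definition depth :: "('r, 'a) ring_scheme \<Rightarrow> enat"
  where "depth R = (SUP xs \<in> {xs. regular_sequence R xs \<and> set xs \<subseteq> max_ideal R}. enat (length xs))"

section \<open>Modules\<close>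

text \<open>The record type of modules extends that of rings; the multiplicative fields are irrelevant
  and left undefined in the constructions below.\<close>

definition restrict_scalars :: "('r \<Rightarrow> 's) \<Rightarrow> ('s, 'm) module \<Rightarrow> ('r, 'm) module"
  where "restrict_scalars f M =
    \<lparr>carrier = carrier M, monoid.mult = monoid.mult M, monoid.one = monoid.one M,
     ring.zero = ring.zero M, ring.add = ring.add M,
     smult = (\<lambda>r x. f r \<odot>\<^bsub>M\<^esub> x)\<rparr>"

definition module_hom ::
  "('r, 'a) ring_scheme \<Rightarrow> ('r, 'm) module \<Rightarrow> ('r, 'n) module \<Rightarrow> ('m \<Rightarrow> 'n) set"
  where "module_hom R M N = {h \<in> carrier M \<rightarrow> carrier N.
    (\<forall>x \<in> carrier M. \<forall>y \<in> carrier M. h (x \<oplus>\<^bsub>M\<^esub> y) = h x \<oplus>\<^bsub>N\<^esub> h y) \<and>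
    (\<forall>r \<in> carrier R. \<forall>x \<in> carrier M. h (r \<odot>\<^bsub>M\<^esub> x) = r \<odot>\<^bsub>N\<^esub> h x)}"

definition module_span :: "('r, 'a) ring_scheme \<Rightarrow> ('r, 'm) module \<Rightarrow> 'm set \<Rightarrow> 'm set"
  where "module_span R M A = \<Inter>{H. submodule H R M \<and> A \<subseteq> H}"

definition finitely_generated :: "('r, 'a) ring_scheme \<Rightarrow> ('r, 'm) module \<Rightarrow> bool"
  where "finitely_generated R M \<longleftrightarrow>
    (\<exists>A. finite A \<and> A \<subseteq> carrier M \<and> module_span R M A = carrier M)"

definition quotient_module :: "('r, 'm) module \<Rightarrow> 'm set \<Rightarrow> ('r, 'm set) module"
  where "quotient_module M N =
    \<lparr>carrier = a_rcosets\<^bsub>M\<^esub> N, monoid.mult = undefined, monoid.one = undefined,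
     ring.zero = N, ring.add = set_add M, smult = (\<lambda>r C. \<Union>x\<in>C. N +>\<^bsub>M\<^esub> (r \<odot>\<^bsub>M\<^esub> x))\<rparr>"

text \<open>The direct sum of copies of \<open>R\<close> indexed by \<open>B\<close>, as functions of finite support.\<close>

definition free_module :: "('r, 'a) ring_scheme \<Rightarrow> 'x set \<Rightarrow> ('r, 'x \<Rightarrow> 'r) module"
  where "free_module R B =
    \<lparr>carrier = {u. range u \<subseteq> carrier R \<and> finite {x. u x \<noteq> \<zero>\<^bsub>R\<^esub>} \<and> {x. u x \<noteq> \<zero>\<^bsub>R\<^esub>} \<subseteq> B},
     monoid.mult = undefined, monoid.one = undefined, ring.zero = (\<lambda>_. \<zero>\<^bsub>R\<^esub>),
     ring.add = (\<lambda>u v x. u x \<oplus>\<^bsub>R\<^esub> v x),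
     smult = (\<lambda>r u x. r \<otimes>\<^bsub>R\<^esub> u x)\<rparr>"

definition free_gen :: "('r, 'a) ring_scheme \<Rightarrow> 'x \<Rightarrow> 'x \<Rightarrow> 'r"
  where "free_gen R x = (\<lambda>y. if y = x then \<one>\<^bsub>R\<^esub> else \<zero>\<^bsub>R\<^esub>)"

text \<open>A basis of \<open>M\<close> is a subset of \<open>M\<close>, so it is no restriction to index it by elements of \<open>M\<close>.\<close>

definition free :: "('r, 'a) ring_scheme \<Rightarrow> ('r, 'm) module \<Rightarrow> bool"
  where "free R M \<longleftrightarrow> module R M \<and>
    (\<exists>(B :: 'm set) h. h \<in> module_hom R (free_module R B) M \<and>
       bij_betw h (carrier (free_module R B)) (carrier M))"

text \<open>Projective modules are the direct summands of free modules. If \<open>P\<close> is a direct summand of some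
  free module, then it is one of the free module on the set \<open>P\<close>, whence the type of \<open>B\<close>.\<close>

definition projective :: "('r, 'a) ring_scheme \<Rightarrow> ('r, 'p) module \<Rightarrow> bool"
  where "projective R P \<longleftrightarrow> module R P \<and>
    (\<exists>(B :: 'p set) i p. i \<in> module_hom R P (free_module R B) \<and>
       p \<in> module_hom R (free_module R B) P \<and> (\<forall>x \<in> carrier P. p (i x) = x))"

definition projective_resolution ::
  "('r, 'a) ring_scheme \<Rightarrow> ('r, 'm) module \<Rightarrow> (nat \<Rightarrow> ('r, 'p) module) \<Rightarrow> (nat \<Rightarrow> 'p \<Rightarrow> 'p) \<Rightarrow>
    ('p \<Rightarrow> 'm) \<Rightarrow> bool"
  where "projective_resolution R M P d e \<longleftrightarrow>
    (\<forall>i. projective R (P i)) \<and>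
    (\<forall>i. d i \<in> module_hom R (P (Suc i)) (P i)) \<and>
    e \<in> module_hom R (P 0) M \<and>
    e ` carrier (P 0) = carrier M \<and>
    d 0 ` carrier (P (Suc 0)) = a_kernel (P 0) M e \<and>
    (\<forall>i. d (Suc i) ` carrier (P (Suc (Suc i))) = a_kernel (P (Suc i)) (P i) (d i))"

text \<open>The type of the elements of resolutions. An \<open>R\<close>-module \<open>M\<close> has a resolution by free modules whose
  bases have cardinality at most the maximum of \<open>\<aleph>\<^sub>0\<close>, the cardinality of \<open>R\<close> and that of \<open>M\<close>,
  and the type of lists over the sum of the two element types is large enough to index such
  bases. Hence every module has a projective resolution in this type. Also, if a module has a
  projective resolution of length \<open>n\<close> in any type, then it has one in this type.\<close>

type_synonym ('r, 'm) res_elem = "('r + 'm) list \<Rightarrow> 'r"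

text \<open>The zero module gets projective dimension \<open>0\<close> here, since \<open>enat\<close> has no negative values.\<close>

definition proj_dim :: "('r, 'a) ring_scheme \<Rightarrow> ('r, 'm) module \<Rightarrow> enat"
  where "proj_dim R M = Inf {enat n | n.
    \<exists>(P :: nat \<Rightarrow> ('r, ('r, 'm) res_elem) module) d e.
      projective_resolution R M P d e \<and> (\<forall>i > n. carrier (P i) = {\<zero>\<^bsub>P i\<^esub>})}"

section \<open>Tensor products and Tor\<close>

definition tensor_relations ::
  "('r, 'a) ring_scheme \<Rightarrow> ('r, 'm) module \<Rightarrow> ('r, 'n) module \<Rightarrow> ('m \<times> 'n \<Rightarrow> 'r) set"
  where "tensor_relations R M N = (let F = free_module R (carrier M \<times> carrier N); g = free_gen R in
    {g (x \<oplus>\<^bsub>M\<^esub> x', y) \<ominus>\<^bsub>F\<^esub> (g (x, y) \<oplus>\<^bsub>F\<^esub> g (x', y)) | x x' y.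
       x \<in> carrier M \<and> x' \<in> carrier M \<and> y \<in> carrier N} \<union>
    {g (x, y \<oplus>\<^bsub>N\<^esub> y') \<ominus>\<^bsub>F\<^esub> (g (x, y) \<oplus>\<^bsub>F\<^esub> g (x, y')) | x y y'.
       x \<in> carrier M \<and> y \<in> carrier N \<and> y' \<in> carrier N} \<union>
    {g (r \<odot>\<^bsub>M\<^esub> x, y) \<ominus>\<^bsub>F\<^esub> (r \<odot>\<^bsub>F\<^esub> g (x, y)) | r x y.
       r \<in> carrier R \<and> x \<in> carrier M \<and> y \<in> carrier N} \<union>
    {g (x, r \<odot>\<^bsub>N\<^esub> y) \<ominus>\<^bsub>F\<^esub> (r \<odot>\<^bsub>F\<^esub> g (x, y)) | r x y.
       r \<in> carrier R \<and> x \<in> carrier M \<and> y \<in> carrier N})"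

definition tensor_kernel ::
  "('r, 'a) ring_scheme \<Rightarrow> ('r, 'm) module \<Rightarrow> ('r, 'n) module \<Rightarrow> ('m \<times> 'n \<Rightarrow> 'r) set"
  where "tensor_kernel R M N =
    module_span R (free_module R (carrier M \<times> carrier N)) (tensor_relations R M N)"

definition tensor ::
  "('r, 'a) ring_scheme \<Rightarrow> ('r, 'm) module \<Rightarrow> ('r, 'n) module \<Rightarrow> ('r, ('m \<times> 'n \<Rightarrow> 'r) set) module"
  where "tensor R M N =
    quotient_module (free_module R (carrier M \<times> carrier N)) (tensor_kernel R M N)"

definition pure_tensor ::
  "('r, 'a) ring_scheme \<Rightarrow> ('r, 'm) module \<Rightarrow> ('r, 'n) module \<Rightarrow> 'm \<Rightarrow> 'n \<Rightarrow> ('m \<times> 'n \<Rightarrow> 'r) set"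
  where "pure_tensor R M N x y =
    tensor_kernel R M N +>\<^bsub>free_module R (carrier M \<times> carrier N)\<^esub> free_gen R (x, y)"

text \<open>The map induced on \<open>Y \<otimes> N \<rightarrow> Y \<otimes> N'\<close> by \<open>f : N \<rightarrow> N'\<close>: the unique linear map sending
  \<open>y \<otimes> x\<close> to \<open>y \<otimes> f x\<close>. Extensionality only makes it unique as a function on the whole type.\<close>

definition tensor_map ::
  "('r, 'a) ring_scheme \<Rightarrow> ('r, 'y) module \<Rightarrow> ('r, 'n) module \<Rightarrow> ('r, 'l) module \<Rightarrow> ('n \<Rightarrow> 'l) \<Rightarrow>
    ('y \<times> 'n \<Rightarrow> 'r) set \<Rightarrow> ('y \<times> 'l \<Rightarrow> 'r) set"
  where "tensor_map R Y N N' f = (THE h.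
    h \<in> module_hom R (tensor R Y N) (tensor R Y N') \<and>
    h \<in> extensional (carrier (tensor R Y N)) \<and>
    (\<forall>y \<in> carrier Y. \<forall>x \<in> carrier N. h (pure_tensor R Y N y x) = pure_tensor R Y N' y (f x)))"

text \<open>The homology in degree \<open>n\<close> of the complex \<open>Y \<otimes> P\<close>, where \<open>d i\<close> goes from degree \<open>Suc i\<close> to
  degree \<open>i\<close>; in degree \<open>0\<close> everything is a cycle.\<close>

definition tensor_homology ::
  "('r, 'a) ring_scheme \<Rightarrow> ('r, 'y) module \<Rightarrow> (nat \<Rightarrow> ('r, 'p) module) \<Rightarrow> (nat \<Rightarrow> 'p \<Rightarrow> 'p) \<Rightarrow> nat \<Rightarrow>
    ('r, ('y \<times> 'p \<Rightarrow> 'r) set set) module"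
  where "tensor_homology R Y P d n = (let
      C = (\<lambda>i. tensor R Y (P i));
      D = (\<lambda>i. tensor_map R Y (P (Suc i)) (P i) (d i));
      Z = (case n of 0 \<Rightarrow> carrier (C 0) | Suc i \<Rightarrow> a_kernel (C (Suc i)) (C i) (D i));
      B = D n ` carrier (C (Suc n))
    in quotient_module ((C n)\<lparr>carrier := Z\<rparr>) B)"

text \<open>As usual, Tor is computed from a chosen projective resolution of the second argument; up to
  isomorphism the result does not depend on the choice.\<close>

definition Tor ::
  "('r, 'a) ring_scheme \<Rightarrow> nat \<Rightarrow> ('r, 'y) module \<Rightarrow> ('r, 'm) module \<Rightarrow>
    ('r, ('y \<times> ('r, 'm) res_elem \<Rightarrow> 'r) set set) module"
  where "Tor R n Y M =
    (case (SOME (P, d, e). projective_resolution R M P d e) of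
      (P, d, e) \<Rightarrow> tensor_homology R Y P d n)"

end

(*
  Write I and J for the maximal ideals of S and T, viewed as ideals of R: then I and J intersect in 0
  and I + J is the maximal ideal of R. In a minimal free resolution (F, d) of M every syzygy from the
  second one on is the direct sum of its parts over I and over J, so that from d_1 on the columns of the
  differentials may be chosen with entries in I or with entries in J. A generator e of F_i whose column is
  over I satisfies J d(e) = 0, so J e lies in the next syzygy, and this forces a generator of F_{i+1}
  with column over J.

  Let Y be an S-module, that is J Y = 0. A generator of F_m with column over J gives cycles y e in Y (x) F,
  which are no boundaries by Nakayama. So if Tor_m(Y, M) = 0, all columns in degree m are over I,
  hence those in degree m - 1 are over J and those in degree m - 2 are over I. If F_{m-2} is not 0, then
  the columns in degree m - 1 are linearly independent over T and J is spanned by their entries at one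
  generator, which makes J principal, generated by an element that is regular on T: T is a discrete
  valuation ring. Moreover, for a minimal presentation of Y over S with relation module L,
  lifting the cycles l e with l in L shows L = I L, so L = 0 and Y is free over S. As this is excluded,
  F_{m-2} = 0, whence F_2 = 0. Finally, if S or T has depth 0, then the maximal ideal of R kills some
  s different from 0. For a generator e of F_1 the element s e then lies in the kernel of d_0, which is 0
  because F_2 = 0. So F_1 = 0.
*)

theory Submission
  imports Defs
begin

section \<open>Module homomorphisms\<close>

text \<open>The bound 4 comes from the first syzygy. It is the kernel of a map to \<open>M\<close>,
  and for arbitrary \<open>M\<close> nothing makes the two parts of a vector in it lie in it again;
  kernels of maps between free modules do split. So homogeneous columns are available from degree 2
  on, and the argument, which inspects the columns in degrees m, m - 1 and m - 2, asks for m - 2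
  \<ge> 2. A second obstacle is that \<open>Tor\<close> is the homology of a tensor product with
  some resolution picked by \<open>SOME\<close>, of which only exactness and projectivity are known.
  Its vanishing is carried to the minimal resolution by comparison maps in both directions and a
  homotopy, and is expressed there without tensor products: as exactness of a sequence of powers of
  \<open>Y\<close> under the matrices of the differentials. What remains is linear algebra over R,
  in which the fiber product is visible through the two ideals alone. The bases of the minimal
  resolution are indexed by the lists occurring in \<open>res_elem\<close>, which makes it one of
  the resolutions over which \<open>Tor\<close> and \<open>proj_dim\<close> range.\<close>

lemma module_homI:
  assumes "\<And>x. x \<in> carrier M \<Longrightarrow> h x \<in> carrier N"
    and "\<And>x y. x \<in> carrier M \<Longrightarrow> y \<in> carrier M \<Longrightarrow> h (x \<oplus>\<^bsub>M\<^esub> y) = h x \<oplus>\<^bsub>N\<^esub> h y"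
    and "\<And>r x. r \<in> carrier R \<Longrightarrow> x \<in> carrier M \<Longrightarrow> h (r \<odot>\<^bsub>M\<^esub> x) = r \<odot>\<^bsub>N\<^esub> h x"
  shows "h \<in> module_hom R M N"
  using assms by (auto simp: module_hom_def)

lemma module_hom_closed: "h \<in> module_hom R M N \<Longrightarrow> x \<in> carrier M \<Longrightarrow> h x \<in> carrier N"
  by (auto simp: module_hom_def)

lemma module_hom_add:
  "h \<in> module_hom R M N \<Longrightarrow> x \<in> carrier M \<Longrightarrow> y \<in> carrier M \<Longrightarrow> h (x \<oplus>\<^bsub>M\<^esub> y) = h x \<oplus>\<^bsub>N\<^esub> h y"
  by (auto simp: module_hom_def)

lemma module_hom_smult:
  "h \<in> module_hom R M N \<Longrightarrow> r \<in> carrier R \<Longrightarrow> x \<in> carrier M \<Longrightarrow> h (r \<odot>\<^bsub>M\<^esub> x) = r \<odot>\<^bsub>N\<^esub> h x"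
  by (auto simp: module_hom_def)

lemma module_hom_zero:
  assumes "module R M" "module R N" "h \<in> module_hom R M N"
  shows "h \<zero>\<^bsub>M\<^esub> = \<zero>\<^bsub>N\<^esub>"
proof -
  interpret M: module R M by fact
  interpret N: module R N by fact
  have "h \<zero>\<^bsub>M\<^esub> = h (\<zero>\<^bsub>R\<^esub> \<odot>\<^bsub>M\<^esub> \<zero>\<^bsub>M\<^esub>)" by simp
  also have "\<dots> = \<zero>\<^bsub>N\<^esub>"
    using module_hom_smult[OF assms(3), of "\<zero>\<^bsub>R\<^esub>" "\<zero>\<^bsub>M\<^esub>"] module_hom_closed[OF assms(3)] by simp
  finally show ?thesis .
qed

lemma module_hom_inv:
  assumes "module R M" "module R N" "h \<in> module_hom R M N" "x \<in> carrier M"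
  shows "h (\<ominus>\<^bsub>M\<^esub> x) = \<ominus>\<^bsub>N\<^esub> h x"
proof -
  interpret M: module R M by fact
  interpret N: module R N by fact
  have "h (\<ominus>\<^bsub>M\<^esub> x) = h ((\<ominus>\<^bsub>R\<^esub> \<one>\<^bsub>R\<^esub>) \<odot>\<^bsub>M\<^esub> x)" using assms(4) by (simp add: M.smult_l_minus)
  also have "\<dots> = \<ominus>\<^bsub>N\<^esub> h x"
    using module_hom_smult[OF assms(3), of "\<ominus>\<^bsub>R\<^esub> \<one>\<^bsub>R\<^esub>" x] assms(4) module_hom_closed[OF assms(3)]
    by (simp add: N.smult_l_minus)
  finally show ?thesis .
qed

lemma module_hom_minus:
  assumes "module R M" "module R N" "h \<in> module_hom R M N" "x \<in> carrier M" "y \<in> carrier M"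
  shows "h (x \<ominus>\<^bsub>M\<^esub> y) = h x \<ominus>\<^bsub>N\<^esub> h y"
proof -
  interpret M: module R M by fact
  interpret N: module R N by fact
  show ?thesis
    using assms(4,5) module_hom_add[OF assms(3)] module_hom_inv[OF assms(1-3)]
    by (simp add: a_minus_def)
qed

lemma module_hom_finsum:
  assumes "module R M" "module R N" "h \<in> module_hom R M N" "finite A" "f \<in> A \<rightarrow> carrier M"
  shows "h (finsum M f A) = finsum N (\<lambda>a. h (f a)) A"
  using assms(4,5)
proof induct
  interpret M: module R M by fact
  interpret N: module R N by fact
  case empty
  then show ?case using module_hom_zero[OF assms(1-3)] by simp
next
  interpret M: module R M by fact
  interpret N: module R N by fact
  case (insert a A)
  then have "(\<lambda>a. h (f a)) \<in> A \<rightarrow> carrier N" "h (f a) \<in> carrier N" "f \<in> A \<rightarrow> carrier M"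
    using module_hom_closed[OF assms(3)] by auto
  then show ?case
    using insert module_hom_add[OF assms(3), of "f a" "finsum M f A"] by simp
qed

lemma module_hom_comp:
  assumes "g \<in> module_hom R M N" "h \<in> module_hom R N K"
  shows "(\<lambda>x. h (g x)) \<in> module_hom R M K"
  using assms by (auto simp: module_hom_def Pi_iff)

lemma module_hom_diff:
  assumes "module R N" "g \<in> module_hom R M N" "h \<in> module_hom R M N"
  shows "(\<lambda>x. g x \<ominus>\<^bsub>N\<^esub> h x) \<in> module_hom R M N"
proof -
  interpret N: module R N by fact
  show ?thesis
  proof (rule module_homI)
    fix x assume x: "x \<in> carrier M"
    have [simp]: "g x \<in> carrier N" "h x \<in> carrier N"
      using x assms(2,3) by (auto dest: module_hom_closed)
    show "g x \<ominus>\<^bsub>N\<^esub> h x \<in> carrier N" by simp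
    fix y assume y: "y \<in> carrier M"
    have [simp]: "g y \<in> carrier N" "h y \<in> carrier N"
      using y assms(2,3) by (auto dest: module_hom_closed)
    show "g (x \<oplus>\<^bsub>M\<^esub> y) \<ominus>\<^bsub>N\<^esub> h (x \<oplus>\<^bsub>M\<^esub> y) = (g x \<ominus>\<^bsub>N\<^esub> h x) \<oplus>\<^bsub>N\<^esub> (g y \<ominus>\<^bsub>N\<^esub> h y)"
      using x y by (simp add: module_hom_add[OF assms(2)] module_hom_add[OF assms(3)] a_minus_def
          N.M.minus_add N.M.a_ac)
  next
    fix r x assume r: "r \<in> carrier R" and x: "x \<in> carrier M"
    have [simp]: "g x \<in> carrier N" "h x \<in> carrier N"
      using x assms(2,3) by (auto dest: module_hom_closed)
    show "g (r \<odot>\<^bsub>M\<^esub> x) \<ominus>\<^bsub>N\<^esub> h (r \<odot>\<^bsub>M\<^esub> x) = r \<odot>\<^bsub>N\<^esub> (g x \<ominus>\<^bsub>N\<^esub> h x)"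
      using r x by (simp add: module_hom_smult[OF assms(2)] module_hom_smult[OF assms(3)]
          a_minus_def N.smult_r_distr N.smult_r_minus)
  qed
qed

lemma module_hom_kernel_submodule:
  assumes "module R M" "module R N" "h \<in> module_hom R M N"
  shows "submodule {x \<in> carrier M. h x = \<zero>\<^bsub>N\<^esub>} R M"
proof -
  interpret M: module R M by fact
  interpret N: module R N by fact
  show ?thesis
    using module_hom_zero[OF assms] module_hom_inv[OF assms] module_hom_add[OF assms(3)]
      module_hom_smult[OF assms(3)]
    by (intro M.submoduleI) auto
qed

lemma module_hom_image_submodule:
  assumes "module R M" "module R N" "h \<in> module_hom R M N"
  shows "submodule (h ` carrier M) R N"
proof -
  interpret M: module R M by fact
  interpret N: module R N by fact
  show ?thesis
  proof (intro N.submoduleI)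
    show "\<zero>\<^bsub>N\<^esub> \<in> h ` carrier M" using module_hom_zero[OF assms] by force
  next
    fix a assume "a \<in> h ` carrier M"
    then show "\<ominus>\<^bsub>N\<^esub> a \<in> h ` carrier M"
      using module_hom_inv[OF assms, symmetric] by auto
  next
    fix a b assume "a \<in> h ` carrier M" "b \<in> h ` carrier M"
    then show "a \<oplus>\<^bsub>N\<^esub> b \<in> h ` carrier M"
      using module_hom_add[OF assms(3), symmetric] by auto
  next
    fix r x assume "r \<in> carrier R" "x \<in> h ` carrier M"
    then show "r \<odot>\<^bsub>N\<^esub> x \<in> h ` carrier M"
      using module_hom_smult[OF assms(3), symmetric] by auto
  qed (use module_hom_closed[OF assms(3)] in auto)
qed

lemma (in module) submoduleD:
  assumes "submodule H R M"
  shows "H \<subseteq> carrier M" "\<zero>\<^bsub>M\<^esub> \<in> H" "\<And>x. x \<in> H \<Longrightarrow> \<ominus>\<^bsub>M\<^esub> x \<in> H"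
    "\<And>x y. x \<in> H \<Longrightarrow> y \<in> H \<Longrightarrow> x \<oplus>\<^bsub>M\<^esub> y \<in> H"
    "\<And>x y. x \<in> H \<Longrightarrow> y \<in> H \<Longrightarrow> x \<ominus>\<^bsub>M\<^esub> y \<in> H"
    "\<And>r x. r \<in> carrier R \<Longrightarrow> x \<in> H \<Longrightarrow> r \<odot>\<^bsub>M\<^esub> x \<in> H"
proof -
  note * = submoduleE[OF assms]
  show "H \<subseteq> carrier M" "\<And>x. x \<in> H \<Longrightarrow> \<ominus>\<^bsub>M\<^esub> x \<in> H"
    "\<And>x y. x \<in> H \<Longrightarrow> y \<in> H \<Longrightarrow> x \<oplus>\<^bsub>M\<^esub> y \<in> H"
    "\<And>x y. x \<in> H \<Longrightarrow> y \<in> H \<Longrightarrow> x \<ominus>\<^bsub>M\<^esub> y \<in> H"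
    "\<And>r x. r \<in> carrier R \<Longrightarrow> x \<in> H \<Longrightarrow> r \<odot>\<^bsub>M\<^esub> x \<in> H"
    using * by (auto simp: a_minus_def)
  show "\<zero>\<^bsub>M\<^esub> \<in> H"
    using subgroup.one_closed[OF submodule.axioms(1)[OF assms]] by simp
qed

lemma (in module) finsum_mem_submodule:
  assumes "submodule H R M" "f \<in> A \<rightarrow> H"
  shows "finsum M f A \<in> H"
proof (cases "finite A")
  case True
  then show ?thesis using assms(2)
  proof induct
    case empty
    then show ?case using submoduleD[OF assms(1)] by simp
  next
    case (insert a A)
    then have "f \<in> A \<rightarrow> carrier M" "f a \<in> carrier M" using submoduleD(1)[OF assms(1)] by auto
    then show ?case using insert submoduleD[OF assms(1)] by simp
  qed
qed (use submoduleD[OF assms(1)] in \<open>simp add: M.finsum_infinite\<close>)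

lemma (in abelian_monoid) finsum_swap:
  assumes "finite A" "finite B" "\<And>a b. a \<in> A \<Longrightarrow> b \<in> B \<Longrightarrow> f a b \<in> carrier G"
  shows "(\<Oplus>a\<in>A. \<Oplus>b\<in>B. f a b) = (\<Oplus>b\<in>B. \<Oplus>a\<in>A. f a b)"
  using assms(1,3)
proof induct
  case empty
  then show ?case by (simp add: finsum_zero)
next
  case (insert x A)
  have "(\<Oplus>a\<in>insert x A. \<Oplus>b\<in>B. f a b) = (\<Oplus>b\<in>B. f x b) \<oplus> (\<Oplus>b\<in>B. \<Oplus>a\<in>A. f a b)"
    using insert by (simp add: Pi_iff)
  also have "\<dots> = (\<Oplus>b\<in>B. f x b \<oplus> (\<Oplus>a\<in>A. f a b))"
    using insert by (subst finsum_addf) (auto simp: Pi_iff)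
  also have "\<dots> = (\<Oplus>b\<in>B. \<Oplus>a\<in>insert x A. f a b)"
    using insert by (intro finsum_cong') (auto simp: Pi_iff)
  finally show ?case .
qed

section \<open>Free modules and linear combinations\<close>

lemma free_module_simps [simp]:
  "\<zero>\<^bsub>free_module R B\<^esub> = (\<lambda>_. \<zero>\<^bsub>R\<^esub>)"
  "u \<oplus>\<^bsub>free_module R B\<^esub> v = (\<lambda>x. u x \<oplus>\<^bsub>R\<^esub> v x)"
  "r \<odot>\<^bsub>free_module R B\<^esub> u = (\<lambda>x. r \<otimes>\<^bsub>R\<^esub> u x)"
  by (simp_all add: free_module_def)

lemma free_module_carrier:
  "u \<in> carrier (free_module R B) \<longleftrightarrow>
    (\<forall>x. u x \<in> carrier R) \<and> finite {x. u x \<noteq> \<zero>\<^bsub>R\<^esub>} \<and> (\<forall>x. x \<notin> B \<longrightarrow> u x = \<zero>\<^bsub>R\<^esub>)"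
  by (auto simp: free_module_def)

lemma free_module_carrier_finite:
  assumes "finite B"
  shows "u \<in> carrier (free_module R B) \<longleftrightarrow>
    (\<forall>x. u x \<in> carrier R) \<and> (\<forall>x. x \<notin> B \<longrightarrow> u x = \<zero>\<^bsub>R\<^esub>)"
proof -
  have "finite {x. u x \<noteq> \<zero>\<^bsub>R\<^esub>}" if "\<forall>x. x \<notin> B \<longrightarrow> u x = \<zero>\<^bsub>R\<^esub>"
    by (rule finite_subset[OF _ assms]) (use that in auto)
  then show ?thesis by (auto simp: free_module_carrier)
qed

lemma free_module_closed [simp]:
  "u \<in> carrier (free_module R B) \<Longrightarrow> u x \<in> carrier R"
  by (simp add: free_module_carrier)

lemma (in cring) module_free_module: "module R (free_module R B)"
proof (rule moduleI)
  show "abelian_group (free_module R B)"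
  proof (rule abelian_groupI)
    fix u v assume "u \<in> carrier (free_module R B)" "v \<in> carrier (free_module R B)"
    moreover have "{x. u x \<oplus> v x \<noteq> \<zero>} \<subseteq> {x. u x \<noteq> \<zero>} \<union> {x. v x \<noteq> \<zero>}" by auto
    ultimately show "u \<oplus>\<^bsub>free_module R B\<^esub> v \<in> carrier (free_module R B)"
      by (auto simp: free_module_carrier elim: finite_subset)
  next
    fix u assume u: "u \<in> carrier (free_module R B)"
    have "(\<lambda>x. \<ominus> u x) \<in> carrier (free_module R B)"
      using u by (auto simp: free_module_carrier)
    moreover have "(\<lambda>x. \<ominus> u x) \<oplus>\<^bsub>free_module R B\<^esub> u = \<zero>\<^bsub>free_module R B\<^esub>"
      using u by (auto simp: l_neg)
    ultimately show "\<exists>v\<in>carrier (free_module R B). v \<oplus>\<^bsub>free_module R B\<^esub> u = \<zero>\<^bsub>free_module R B\<^esub>"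
      by blast
  qed (auto simp: a_ac free_module_carrier)
  fix a u assume "a \<in> carrier R" and u: "u \<in> carrier (free_module R B)"
  moreover from this have "finite {x. a \<otimes> u x \<noteq> \<zero>}"
    by (intro finite_subset[of "{x. a \<otimes> u x \<noteq> \<zero>}" "{x. u x \<noteq> \<zero>}"]) (auto simp: free_module_carrier)
  ultimately show "a \<odot>\<^bsub>free_module R B\<^esub> u \<in> carrier (free_module R B)"
    by (auto simp: free_module_carrier)
qed (auto simp: l_distr r_distr m_assoc is_cring)

text \<open>The record \<open>free_module\<close> specifies no negation, so the inverse is known
  through the group laws alone. Multiplication by -1 yields its pointwise form.\<close>

lemma (in cring) free_module_minus:
  assumes "u \<in> carrier (free_module R B)" "v \<in> carrier (free_module R B)"
  shows "u \<ominus>\<^bsub>free_module R B\<^esub> v = (\<lambda>x. u x \<ominus> v x)"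
proof -
  interpret F: module R "free_module R B" by (rule module_free_module)
  have "\<ominus>\<^bsub>free_module R B\<^esub> v = (\<ominus> \<one>) \<odot>\<^bsub>free_module R B\<^esub> v"
    using assms by (simp add: F.smult_l_minus del: free_module_simps)
  then have "\<ominus>\<^bsub>free_module R B\<^esub> v = (\<lambda>x. \<ominus> v x)" using assms by (auto simp: l_minus)
  then show ?thesis by (simp add: a_minus_def)
qed

lemma (in cring) free_module_finsum:
  assumes "finite A" "f \<in> A \<rightarrow> carrier (free_module R B)"
  shows "finsum (free_module R B) f A x = (\<Oplus>a\<in>A. f a x)"
  using assms
proof induct
  interpret F: module R "free_module R B" by (rule module_free_module)
  case empty
  then show ?case by simp
next
  interpret F: module R "free_module R B" by (rule module_free_module)
  case (insert a A)
  then have "f b x \<in> carrier R" if "b \<in> insert a A" for b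
    using that by (intro free_module_closed[of _ R B]) auto
  then have "(\<lambda>a. f a x) \<in> A \<rightarrow> carrier R" "f a x \<in> carrier R" by auto
  with insert show ?case by (simp add: Pi_iff)
qed

lemma (in cring) free_gen_closed [simp]:
  "x \<in> B \<Longrightarrow> free_gen R x \<in> carrier (free_module R B)"
  by (auto simp: free_module_carrier free_gen_def)

lemma (in cring) free_module_decompose:
  assumes "u \<in> carrier (free_module R B)" "x \<in> B"
  shows "u(x := \<zero>) \<in> carrier (free_module R B)"
    and "u = u(x := \<zero>) \<oplus>\<^bsub>free_module R B\<^esub> (u x \<odot>\<^bsub>free_module R B\<^esub> free_gen R x)"
proof -
  have "{y. (u(x := \<zero>)) y \<noteq> \<zero>} \<subseteq> {y. u y \<noteq> \<zero>}" by auto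
  then have "finite {y. (u(x := \<zero>)) y \<noteq> \<zero>}"
    using assms(1) by (auto simp: free_module_carrier intro: finite_subset)
  then show "u(x := \<zero>) \<in> carrier (free_module R B)"
    using assms by (simp add: free_module_carrier)
  show "u = u(x := \<zero>) \<oplus>\<^bsub>free_module R B\<^esub> (u x \<odot>\<^bsub>free_module R B\<^esub> free_gen R x)"
    using assms by (auto simp: fun_eq_iff free_gen_def free_module_carrier)
qed

text \<open>Finite support carries the induction: deleting one nonzero coordinate shrinks it. The
  index set itself may be infinite, as it can be for the free modules that define tensor
  products.\<close>

lemma (in cring) free_module_induct [consumes 1, case_names zero add]:
  assumes u: "u \<in> carrier (free_module R B)"
    and zero: "P (\<lambda>_. \<zero>)"
    and add: "\<And>u r x. u \<in> carrier (free_module R B) \<Longrightarrow> r \<in> carrier R \<Longrightarrow> x \<in> B \<Longrightarrow> P u \<Longrightarrow>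
      P (u \<oplus>\<^bsub>free_module R B\<^esub> (r \<odot>\<^bsub>free_module R B\<^esub> free_gen R x))"
  shows "P u"
proof -
  have "finite {x. u x \<noteq> \<zero>}" using u by (simp add: free_module_carrier)
  then show ?thesis using u
  proof (induct "{x. u x \<noteq> \<zero>}" arbitrary: u rule: finite_psubset_induct)
    case (psubset u)
    show ?case
    proof (cases "\<exists>x. u x \<noteq> \<zero>")
      case False
      then have "u = (\<lambda>_. \<zero>)" by auto
      then show ?thesis using zero by simp
    next
      case True
      then obtain x where x: "u x \<noteq> \<zero>" by blast
      then have xB: "x \<in> B" using psubset(3) by (auto simp: free_module_carrier)
      have "{y. (u(x := \<zero>)) y \<noteq> \<zero>} \<subset> {y. u y \<noteq> \<zero>}" using x by auto
      then have "P (u(x := \<zero>))"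
        using psubset(2) free_module_decompose(1)[OF psubset(3) xB] by blast
      then have "P (u(x := \<zero>) \<oplus>\<^bsub>free_module R B\<^esub> (u x \<odot>\<^bsub>free_module R B\<^esub> free_gen R x))"
        by (rule add[rotated 3]) (use psubset(3) xB free_module_decompose(1) in auto)
      then show ?thesis
        using free_module_decompose(2)[OF psubset(3) xB] by metis
    qed
  qed
qed

lemma (in cring) module_hom_free_eqI:
  assumes "module R N" "g \<in> module_hom R (free_module R B) N" "h \<in> module_hom R (free_module R B) N"
    and "\<And>x. x \<in> B \<Longrightarrow> g (free_gen R x) = h (free_gen R x)"
    and "u \<in> carrier (free_module R B)"
  shows "g u = h u"
  using assms(5)
proof (induct rule: free_module_induct)
  interpret F: module R "free_module R B" by (rule module_free_module)
  case zero
  then show ?case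
    using module_hom_zero[OF F.module_axioms assms(1,2)] module_hom_zero[OF F.module_axioms assms(1,3)]
    by simp
next
  interpret F: module R "free_module R B" by (rule module_free_module)
  case (add u r x)
  then have "r \<odot>\<^bsub>free_module R B\<^esub> free_gen R x \<in> carrier (free_module R B)"
    by (intro F.smult_closed) auto
  with add show ?case
    using module_hom_add[OF assms(2)] module_hom_add[OF assms(3)]
      module_hom_smult[OF assms(2)] module_hom_smult[OF assms(3)] assms(4)
    by (simp del: free_module_simps)
qed

text \<open>The linear extension of \<open>c\<close> to free modules. Summing over the support of
  \<open>u\<close> avoids a basis argument and covers infinite bases; over a finite basis
  \<open>lincomb_finite\<close> turns it into an ordinary sum.\<close>

definition lincomb :: "('r, 'a) ring_scheme \<Rightarrow> ('r, 'm) module \<Rightarrow> ('x \<Rightarrow> 'm) \<Rightarrow> ('x \<Rightarrow> 'r) \<Rightarrow> 'm"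
  where "lincomb R N c u = (\<Oplus>\<^bsub>N\<^esub>x\<in>{x. u x \<noteq> \<zero>\<^bsub>R\<^esub>}. u x \<odot>\<^bsub>N\<^esub> c x)"

lemma lincomb_finite:
  assumes "module R N" "finite A" "\<And>x. x \<notin> A \<Longrightarrow> u x = \<zero>\<^bsub>R\<^esub>"
    "\<And>x. x \<in> A \<Longrightarrow> u x \<in> carrier R" "c \<in> A \<rightarrow> carrier N"
  shows "lincomb R N c u = (\<Oplus>\<^bsub>N\<^esub>x\<in>A. u x \<odot>\<^bsub>N\<^esub> c x)"
proof -
  interpret N: module R N by fact
  show ?thesis
    unfolding lincomb_def
    by (rule N.add.finprod_mono_neutral_cong_left) (use assms in \<open>auto simp: Pi_iff\<close>)
qed

lemma (in cring) lincomb_hom: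
  assumes "module R N" "c \<in> B \<rightarrow> carrier N"
  shows "lincomb R N c \<in> module_hom R (free_module R B) N"
proof (rule module_homI)
  interpret N: module R N by fact
  fix u assume u: "u \<in> carrier (free_module R B)"
  let ?U = "{x. u x \<noteq> \<zero>}"
  have U: "finite ?U" "?U \<subseteq> B" using u by (auto simp: free_module_carrier)
  then have cU: "c \<in> ?U \<rightarrow> carrier N" using assms(2) by auto
  show "lincomb R N c u \<in> carrier N"
    unfolding lincomb_def using u cU by (intro N.M.finsum_closed) auto
  {
    fix v assume v: "v \<in> carrier (free_module R B)"
    let ?V = "{x. v x \<noteq> \<zero>}"
    have V: "finite ?V" "?V \<subseteq> B" using v by (auto simp: free_module_carrier)
    \<comment> \<open>The supports of \<open>u\<close>, \<open>v\<close> and their sum all lie in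
      this one finite set, over which the three linear combinations are compared.\<close>
    have c: "c \<in> ?U \<union> ?V \<rightarrow> carrier N" using U V assms(2) by auto
    have "lincomb R N c (u \<oplus>\<^bsub>free_module R B\<^esub> v) = (\<Oplus>\<^bsub>N\<^esub>x\<in>?U \<union> ?V. (u x \<oplus> v x) \<odot>\<^bsub>N\<^esub> c x)"
      using U V u v c assms(1) by (subst lincomb_finite[where A = "?U \<union> ?V"]) auto
    also have "\<dots> = (\<Oplus>\<^bsub>N\<^esub>x\<in>?U \<union> ?V. u x \<odot>\<^bsub>N\<^esub> c x \<oplus>\<^bsub>N\<^esub> v x \<odot>\<^bsub>N\<^esub> c x)"
      by (rule N.M.finsum_cong') (use u v c in \<open>auto simp: N.smult_l_distr Pi_iff\<close>)
    also have "\<dots> = (\<Oplus>\<^bsub>N\<^esub>x\<in>?U \<union> ?V. u x \<odot>\<^bsub>N\<^esub> c x) \<oplus>\<^bsub>N\<^esub> (\<Oplus>\<^bsub>N\<^esub>x\<in>?U \<union> ?V. v x \<odot>\<^bsub>N\<^esub> c x)"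
      by (rule N.M.finsum_addf) (use u v c in \<open>auto simp: Pi_iff\<close>)
    also have "(\<Oplus>\<^bsub>N\<^esub>x\<in>?U \<union> ?V. u x \<odot>\<^bsub>N\<^esub> c x) = lincomb R N c u"
      by (rule lincomb_finite[symmetric]) (use assms(1) U V u c in auto)
    also have "(\<Oplus>\<^bsub>N\<^esub>x\<in>?U \<union> ?V. v x \<odot>\<^bsub>N\<^esub> c x) = lincomb R N c v"
      by (rule lincomb_finite[symmetric]) (use assms(1) U V v c in auto)
    finally show "lincomb R N c (u \<oplus>\<^bsub>free_module R B\<^esub> v) = lincomb R N c u \<oplus>\<^bsub>N\<^esub> lincomb R N c v" .
  }
  fix r assume r: "r \<in> carrier R"
  have c: "c \<in> ?U \<rightarrow> carrier N" using U assms(2) by auto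
  have "lincomb R N c (r \<odot>\<^bsub>free_module R B\<^esub> u) = (\<Oplus>\<^bsub>N\<^esub>x\<in>?U. (r \<otimes> u x) \<odot>\<^bsub>N\<^esub> c x)"
    using U u r c assms(1) by (subst lincomb_finite[where A = ?U]) auto
  also have "\<dots> = (\<Oplus>\<^bsub>N\<^esub>x\<in>?U. r \<odot>\<^bsub>N\<^esub> (u x \<odot>\<^bsub>N\<^esub> c x))"
    by (rule N.M.finsum_cong') (use u r c in \<open>auto simp: N.smult_assoc1 Pi_iff\<close>)
  also have "\<dots> = r \<odot>\<^bsub>N\<^esub> lincomb R N c u"
    unfolding lincomb_def
    by (rule N.finsum_smult_ldistr[symmetric]) (use U r u c in \<open>auto simp: Pi_iff\<close>)
  finally show "lincomb R N c (r \<odot>\<^bsub>free_module R B\<^esub> u) = r \<odot>\<^bsub>N\<^esub> lincomb R N c u" .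
qed

lemma (in cring) lincomb_free_gen:
  assumes "module R N" "c x \<in> carrier N"
  shows "lincomb R N c (free_gen R x) = c x"
proof -
  interpret N: module R N by fact
  have "lincomb R N c (free_gen R x) = (\<Oplus>\<^bsub>N\<^esub>y\<in>{x}. free_gen R x y \<odot>\<^bsub>N\<^esub> c y)"
    by (rule lincomb_finite) (use assms in \<open>auto simp: free_gen_def\<close>)
  then show ?thesis using assms by (simp add: free_gen_def)
qed

lemma (in cring) module_hom_free_lincomb:
  assumes "module R N" "h \<in> module_hom R (free_module R B) N" "u \<in> carrier (free_module R B)"
  shows "h u = lincomb R N (\<lambda>x. h (free_gen R x)) u"
proof (rule module_hom_free_eqI[OF assms(1,2) _ _ assms(3)])
  have c: "(\<lambda>x. h (free_gen R x)) \<in> B \<rightarrow> carrier N"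
    using module_hom_closed[OF assms(2)] by auto
  then show "lincomb R N (\<lambda>x. h (free_gen R x)) \<in> module_hom R (free_module R B) N"
    by (rule lincomb_hom[OF assms(1)])
  show "h (free_gen R x) = lincomb R N (\<lambda>x. h (free_gen R x)) (free_gen R x)" if "x \<in> B" for x
    using lincomb_free_gen[OF assms(1), of "\<lambda>x. h (free_gen R x)" x] c that
    by (simp add: Pi_iff)
qed

lemma (in cring) module_hom_free_finsum:
  assumes "module R N" "h \<in> module_hom R (free_module R B) N" "u \<in> carrier (free_module R B)" "finite B"
  shows "h u = (\<Oplus>\<^bsub>N\<^esub>x\<in>B. u x \<odot>\<^bsub>N\<^esub> h (free_gen R x))"
proof (subst module_hom_free_lincomb[OF assms(1-3)], rule lincomb_finite)
  show "(\<lambda>x. h (free_gen R x)) \<in> B \<rightarrow> carrier N"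
    using module_hom_closed[OF assms(2)] by auto
qed (use assms in \<open>auto simp: free_module_carrier\<close>)

section \<open>Spans, lifting along linear maps, and projectivity of free modules\<close>

lemma span_submodule:
  assumes "module R M" "A \<subseteq> carrier M"
  shows "submodule (module_span R M A) R M"
proof -
  interpret M: module R M by fact
  \<comment> \<open>The family has to be inhabited, because the intersection of the empty family is
    the whole type.\<close>
  have "carrier M \<in> {H. submodule H R M \<and> A \<subseteq> H}"
    using assms M.carrier_is_submodule by auto
  then show ?thesis
    unfolding module_span_def
    by (intro M.submoduleI) (auto intro: M.submoduleD(2,3,4,6) dest: M.submoduleD(1))
qed

lemma span_superset: "A \<subseteq> module_span R M A"
  by (auto simp: module_span_def)

lemma span_minimal: "submodule H R M \<Longrightarrow> A \<subseteq> H \<Longrightarrow> module_span R M A \<subseteq> H"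
  by (auto simp: module_span_def)

lemma (in cring) lincomb_mem_submodule:
  assumes "module R N" "submodule H R N" "c \<in> B \<rightarrow> H" "u \<in> carrier (free_module R B)"
  shows "lincomb R N c u \<in> H"
proof -
  interpret N: module R N by fact
  have "u x \<odot>\<^bsub>N\<^esub> c x \<in> H" if "u x \<noteq> \<zero>" for x
  proof -
    have "x \<in> B" using that assms(4) by (auto simp: free_module_carrier)
    then show ?thesis using N.submoduleD(6)[OF assms(2)] assms(3,4) by (simp add: Pi_iff)
  qed
  then show ?thesis
    unfolding lincomb_def by (intro N.finsum_mem_submodule[OF assms(2)]) auto
qed

lemma (in cring) lincomb_image_span:
  assumes "module R N" "c \<in> B \<rightarrow> carrier N"
  shows "lincomb R N c ` carrier (free_module R B) = module_span R N (c ` B)"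
proof
  interpret N: module R N by fact
  have cB: "c ` B \<subseteq> carrier N" using assms(2) by auto
  show "lincomb R N c ` carrier (free_module R B) \<subseteq> module_span R N (c ` B)"
    using lincomb_mem_submodule[OF assms(1) span_submodule[OF assms(1) cB], of c B] span_superset[of "c ` B"]
    by blast
  show "module_span R N (c ` B) \<subseteq> lincomb R N c ` carrier (free_module R B)"
  proof (rule span_minimal)
    show "submodule (lincomb R N c ` carrier (free_module R B)) R N"
      by (rule module_hom_image_submodule[OF module_free_module assms(1) lincomb_hom[OF assms]])
    show "c ` B \<subseteq> lincomb R N c ` carrier (free_module R B)"
    proof
      fix y assume "y \<in> c ` B"
      then obtain x where x: "x \<in> B" "y = c x" by blast
      then have "y = lincomb R N c (free_gen R x)"
        using lincomb_free_gen[OF assms(1), of c x] assms(2) by (simp add: Pi_iff)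
      then show "y \<in> lincomb R N c ` carrier (free_module R B)" using x by auto
    qed
  qed
qed

text \<open>Choose preimages for the images of the generators and extend linearly. Containment of
  images takes the place of surjectivity of \<open>\<beta>\<close>, so that \<open>\<beta>\<close>
  may be a differential, which reaches just the cycles.\<close>

lemma (in cring) free_hom_lift:
  assumes N: "module R N" "module R N'" and b: "\<beta> \<in> module_hom R N N'"
    and a: "\<alpha> \<in> module_hom R (free_module R B) N'"
    and img: "\<alpha> ` carrier (free_module R B) \<subseteq> \<beta> ` carrier N"
  shows "\<exists>\<gamma> \<in> module_hom R (free_module R B) N. \<forall>u \<in> carrier (free_module R B). \<beta> (\<gamma> u) = \<alpha> u"
proof -
  have "\<forall>x\<in>B. \<exists>y\<in>carrier N. \<beta> y = \<alpha> (free_gen R x)"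
    using img free_gen_closed by (metis (no_types, lifting) imageE image_subset_iff)
  then obtain c where c: "\<And>x. x \<in> B \<Longrightarrow> c x \<in> carrier N \<and> \<beta> (c x) = \<alpha> (free_gen R x)"
    by metis
  have hom: "lincomb R N c \<in> module_hom R (free_module R B) N"
    by (rule lincomb_hom[OF N(1)]) (use c in auto)
  have "\<beta> (lincomb R N c u) = \<alpha> u" if "u \<in> carrier (free_module R B)" for u
    by (rule module_hom_free_eqI[OF N(2) module_hom_comp[OF hom b] a _ that])
      (use c lincomb_free_gen[OF N(1), of c] in auto)
  then show ?thesis using hom by blast
qed

text \<open>\<open>P\<close> is a retract of a free module: lift the composite of
  \<open>\<alpha>\<close> with the retraction \<open>p\<close>, then restrict the lift along the
  section \<open>i\<close>.\<close>

lemma (in cring) projective_lift: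
  fixes P :: "('a, 'p) module"
  assumes N: "module R N" "module R N'" and b: "\<beta> \<in> module_hom R N N'"
    and P: "projective R P" and a: "\<alpha> \<in> module_hom R P N'"
    and img: "\<alpha> ` carrier P \<subseteq> \<beta> ` carrier N"
  shows "\<exists>\<gamma> \<in> module_hom R P N. \<forall>x \<in> carrier P. \<beta> (\<gamma> x) = \<alpha> x"
proof -
  obtain B :: "'p set" and i p where i: "i \<in> module_hom R P (free_module R B)"
    and p: "p \<in> module_hom R (free_module R B) P" and pi: "\<And>x. x \<in> carrier P \<Longrightarrow> p (i x) = x"
    using P unfolding projective_def by blast
  have "(\<lambda>u. \<alpha> (p u)) ` carrier (free_module R B) \<subseteq> \<beta> ` carrier N"
    using img module_hom_closed[OF p] by auto
  then obtain \<gamma> where g: "\<gamma> \<in> module_hom R (free_module R B) N"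
    and eq: "\<And>u. u \<in> carrier (free_module R B) \<Longrightarrow> \<beta> (\<gamma> u) = \<alpha> (p u)"
    using free_hom_lift[OF N b module_hom_comp[OF p a]] by blast
  show ?thesis
    using module_hom_comp[OF i g] eq pi module_hom_closed[OF i] by (intro bexI[of _ "\<lambda>x. \<gamma> (i x)"]) auto
qed

text \<open>The predicate \<open>free\<close> asks for a basis indexed by elements of the module.
  This moves coefficients from such an index set back to an arbitrary one.\<close>

lemma (in cring) lincomb_reindex:
  assumes "module R N" "inj_on f B" "c \<in> f ` B \<rightarrow> carrier N" "u \<in> carrier (free_module R (f ` B))"
  shows "lincomb R N c u = lincomb R N (\<lambda>x. c (f x)) (\<lambda>x. if x \<in> B then u (f x) else \<zero>)"
    and "(\<lambda>x. if x \<in> B then u (f x) else \<zero>) \<in> carrier (free_module R B)"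
proof -
  interpret N: module R N by fact
  let ?U = "{y. u y \<noteq> \<zero>}" and ?v = "\<lambda>x. if x \<in> B then u (f x) else \<zero>"
  let ?V = "{x. ?v x \<noteq> \<zero>}"
  have im: "f ` ?V = ?U" and inj: "inj_on f ?V" 
    using assms(2,4) by (auto simp: free_module_carrier inj_on_def split: if_splits) 
  have fin: "finite ?V" by (rule finite_imageD[OF _ inj]) (use im assms(4) in \<open>simp add: free_module_carrier\<close>)
  show "?v \<in> carrier (free_module R B)" using fin assms(4) by (auto simp: free_module_carrier)
  have "lincomb R N c u = (\<Oplus>\<^bsub>N\<^esub>y\<in>f ` ?V. u y \<odot>\<^bsub>N\<^esub> c y)" by (simp only: im lincomb_def)
  also have "\<dots> = (\<Oplus>\<^bsub>N\<^esub>x\<in>?V. u (f x) \<odot>\<^bsub>N\<^esub> c (f x))"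
    by (rule N.M.finsum_reindex[OF _ inj]) (use assms(3,4) in \<open>auto simp: Pi_iff\<close>)
  also have "\<dots> = lincomb R N (\<lambda>x. c (f x)) ?v"
    unfolding lincomb_def
    by (rule N.M.finsum_cong') (use assms(3,4) in \<open>auto simp: Pi_iff split: if_splits\<close>)
  finally show "lincomb R N c u = lincomb R N (\<lambda>x. c (f x)) ?v" .
qed

text \<open>The predicate \<open>projective\<close> wants a free module indexed by elements of the
  module at hand, so the basis \<open>B\<close> is replaced by the set of its generators
  \<open>free_gen\<close>.\<close>

lemma (in cring) projective_free_module:
  fixes B :: "'c set"
  shows "projective R (free_module R B)"
proof (cases "\<one> = \<zero>")
  case True
  then have R: "carrier R = {\<zero>}" using one_zeroD by blast
  show ?thesis
    unfolding projective_def
    by (intro conjI module_free_module exI[of _ "{}"] exI[of _ "\<lambda>_ _. \<zero>"])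
      (auto simp: module_hom_def free_module_carrier R)
next
  case False
  let ?f = "free_gen R :: 'c \<Rightarrow> 'c \<Rightarrow> 'a" and ?F = "free_module R B"
  have inj: "inj_on ?f B" using False by (auto simp: inj_on_def free_gen_def fun_eq_iff)
  let ?F' = "free_module R (?f ` B)"
  interpret F': module R ?F' by (rule module_free_module)
  let ?i = "lincomb R ?F' (\<lambda>x. free_gen R (?f x))" and ?p = "lincomb R ?F (\<lambda>y. y)"
  have i: "?i \<in> module_hom R ?F ?F'" by (rule lincomb_hom[OF module_free_module]) auto
  have p: "?p \<in> module_hom R ?F' ?F" by (rule lincomb_hom[OF module_free_module]) auto
  have id: "(\<lambda>u. u) \<in> module_hom R ?F ?F" by (auto simp: module_hom_def)
  have "?p (?i u) = u" if "u \<in> carrier ?F" for u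
  proof (rule module_hom_free_eqI[OF module_free_module module_hom_comp[OF i p] id _ that])
    fix x assume x: "x \<in> B"
    then have "?i (?f x) = free_gen R (?f x)"
      using lincomb_free_gen[OF module_free_module, of "\<lambda>x. free_gen R (?f x)" x "?f ` B"] by simp
    then show "?p (?i (?f x)) = ?f x"
      using lincomb_free_gen[OF module_free_module, of "\<lambda>y. y" "?f x" B] x by simp
  qed
  then show ?thesis
    unfolding projective_def using module_free_module i p by blast
qed

section \<open>Quotients and tensor products\<close>

lemma quotient_module_simps:
  "carrier (quotient_module M H) = a_rcosets\<^bsub>M\<^esub> H"
  "\<zero>\<^bsub>quotient_module M H\<^esub> = H"
  "C \<oplus>\<^bsub>quotient_module M H\<^esub> D = C <+>\<^bsub>M\<^esub> D"
  "r \<odot>\<^bsub>quotient_module M H\<^esub> C = (\<Union>x\<in>C. H +>\<^bsub>M\<^esub> (r \<odot>\<^bsub>M\<^esub> x))"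
  by (simp_all add: quotient_module_def)

lemma (in abelian_group) minus_eq_zero_iff:
  assumes "x \<in> carrier G" "y \<in> carrier G"
  shows "x \<ominus> y = \<zero> \<longleftrightarrow> x = y"
proof
  assume "x \<ominus> y = \<zero>"
  then have "(x \<oplus> \<ominus> y) \<oplus> y = y" using assms by (simp add: a_minus_def)
  then show "x = y" using assms by (simp add: a_assoc l_neg)
qed (use assms in \<open>simp add: a_minus_def r_neg\<close>)

lemma submodule_abelian_subgroup:
  assumes "module R M" "submodule H R M"
  shows "abelian_subgroup H M"
proof -
  interpret M: module R M by fact
  show ?thesis
    by (rule abelian_subgroupI3[OF _ M.abelian_group_axioms])
      (use submodule.axioms(1)[OF assms(2)] in \<open>simp add: additive_subgroup_def\<close>)
qed

context
  fixes R :: "('r, 'a) ring_scheme" and M :: "('r, 'm) module" and H :: "'m set"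
  assumes M: "module R M" and H: "submodule H R M"
begin

interpretation M: module R M by (rule M)
interpretation H: abelian_subgroup H M by (rule submodule_abelian_subgroup[OF M H])

lemma quotient_carrier: "carrier (quotient_module M H) = (\<lambda>x. H +>\<^bsub>M\<^esub> x) ` carrier M"
  by (auto simp: quotient_module_simps A_RCOSETS_def')

lemma quotient_coset_closed: "x \<in> carrier M \<Longrightarrow> H +>\<^bsub>M\<^esub> x \<in> carrier (quotient_module M H)"
  by (simp add: quotient_carrier)

lemma quotient_coset_add:
  "x \<in> carrier M \<Longrightarrow> y \<in> carrier M \<Longrightarrow>
    (H +>\<^bsub>M\<^esub> x) \<oplus>\<^bsub>quotient_module M H\<^esub> (H +>\<^bsub>M\<^esub> y) = H +>\<^bsub>M\<^esub> (x \<oplus>\<^bsub>M\<^esub> y)"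
  by (simp add: quotient_module_simps H.a_rcos_sum)

lemma quotient_coset_eq:
  assumes "x \<in> carrier M" "y \<in> carrier M"
  shows "H +>\<^bsub>M\<^esub> x = H +>\<^bsub>M\<^esub> y \<longleftrightarrow> x \<ominus>\<^bsub>M\<^esub> y \<in> H"
proof
  assume "H +>\<^bsub>M\<^esub> x = H +>\<^bsub>M\<^esub> y"
  then have "x \<in> H +>\<^bsub>M\<^esub> y" using H.a_rcos_self[OF assms(1)] by simp
  then show "x \<ominus>\<^bsub>M\<^esub> y \<in> H" using H.a_rcos_module[of y x] assms by (simp add: a_minus_def)
next
  assume "x \<ominus>\<^bsub>M\<^esub> y \<in> H"
  then have "x \<in> H +>\<^bsub>M\<^esub> y" using H.a_rcos_module[of y x] assms by (simp add: a_minus_def)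
  then show "H +>\<^bsub>M\<^esub> x = H +>\<^bsub>M\<^esub> y" using H.a_repr_independence'[OF _ assms(2)] by simp
qed

text \<open>The scalar action on the quotient is a union over all representatives. Its members are
  one and the same coset, since multiples of a difference of representatives stay in
  \<open>H\<close>.\<close>

lemma quotient_coset_smult:
  assumes "r \<in> carrier R" "x \<in> carrier M"
  shows "r \<odot>\<^bsub>quotient_module M H\<^esub> (H +>\<^bsub>M\<^esub> x) = H +>\<^bsub>M\<^esub> (r \<odot>\<^bsub>M\<^esub> x)"
proof -
  have "H +>\<^bsub>M\<^esub> (r \<odot>\<^bsub>M\<^esub> y) = H +>\<^bsub>M\<^esub> (r \<odot>\<^bsub>M\<^esub> x)" if y: "y \<in> H +>\<^bsub>M\<^esub> x" for y
  proof -
    have yM: "y \<in> carrier M" using y H.a_elemrcos_carrier[OF assms(2)] by blast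
    then have "y \<ominus>\<^bsub>M\<^esub> x \<in> H" using y H.a_rcos_module[OF assms(2)] by (simp add: a_minus_def)
    then have "r \<odot>\<^bsub>M\<^esub> (y \<ominus>\<^bsub>M\<^esub> x) \<in> H" using M.submoduleD(6)[OF H assms(1)] by blast
    then have "r \<odot>\<^bsub>M\<^esub> y \<ominus>\<^bsub>M\<^esub> r \<odot>\<^bsub>M\<^esub> x \<in> H"
      using assms yM by (simp add: a_minus_def M.smult_r_distr M.smult_r_minus)
    then show ?thesis using quotient_coset_eq assms yM by simp
  qed
  moreover have "x \<in> H +>\<^bsub>M\<^esub> x" using H.a_rcos_self[OF assms(2)] .
  ultimately show ?thesis unfolding quotient_module_simps by blast
qed

lemma quotient_zero_coset: "H +>\<^bsub>M\<^esub> \<zero>\<^bsub>M\<^esub> = \<zero>\<^bsub>quotient_module M H\<^esub>"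
  using H.a_subset by (simp add: quotient_module_simps)

lemma module_quotient: "module R (quotient_module M H)"
proof (rule moduleI)
  let ?Q = "quotient_module M H"
  show "abelian_group ?Q"
  proof (rule abelian_groupI)
    show "\<zero>\<^bsub>?Q\<^esub> \<in> carrier ?Q"
      using quotient_coset_closed[of "\<zero>\<^bsub>M\<^esub>"] quotient_zero_coset by simp
    fix C assume "C \<in> carrier ?Q"
    then obtain x where x: "x \<in> carrier M" "C = H +>\<^bsub>M\<^esub> x" by (auto simp: quotient_carrier)
    show "\<zero>\<^bsub>?Q\<^esub> \<oplus>\<^bsub>?Q\<^esub> C = C"
      unfolding quotient_zero_coset[symmetric] using x by (simp add: quotient_coset_add)
    have "(H +>\<^bsub>M\<^esub> (\<ominus>\<^bsub>M\<^esub> x)) \<oplus>\<^bsub>?Q\<^esub> C = \<zero>\<^bsub>?Q\<^esub>"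
      unfolding quotient_zero_coset[symmetric] using x by (simp add: quotient_coset_add M.M.l_neg)
    then show "\<exists>D\<in>carrier ?Q. D \<oplus>\<^bsub>?Q\<^esub> C = \<zero>\<^bsub>?Q\<^esub>"
      using quotient_coset_closed[of "\<ominus>\<^bsub>M\<^esub> x"] x by blast
  qed (auto simp: quotient_carrier quotient_coset_add M.M.a_ac)
qed (auto simp: quotient_carrier quotient_coset_add quotient_coset_smult M.R.is_cring
    M.smult_l_distr M.smult_r_distr M.smult_assoc1)

lemma quotient_hom: "(\<lambda>x. H +>\<^bsub>M\<^esub> x) \<in> module_hom R M (quotient_module M H)"
  by (rule module_homI) (auto simp: quotient_coset_closed quotient_coset_add quotient_coset_smult)

text \<open>The value on a coset is that of \<open>h\<close> at a representative picked by
  \<open>SOME\<close>; two representatives differ by an element of \<open>H\<close>, on which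
  \<open>h\<close> vanishes.\<close>

lemma quotient_lift:
  assumes N: "module R N" and h: "h \<in> module_hom R M N" and ker: "\<And>x. x \<in> H \<Longrightarrow> h x = \<zero>\<^bsub>N\<^esub>"
  shows "\<exists>g \<in> module_hom R (quotient_module M H) N. \<forall>x \<in> carrier M. g (H +>\<^bsub>M\<^esub> x) = h x"
proof -
  interpret N: module R N by (rule N)
  define g where "g C = h (SOME x. x \<in> carrier M \<and> C = H +>\<^bsub>M\<^esub> x)" for C
  have g: "g (H +>\<^bsub>M\<^esub> x) = h x" if x: "x \<in> carrier M" for x
  proof -
    define y where "y = (SOME y. y \<in> carrier M \<and> H +>\<^bsub>M\<^esub> x = H +>\<^bsub>M\<^esub> y)"
    have y: "y \<in> carrier M \<and> H +>\<^bsub>M\<^esub> x = H +>\<^bsub>M\<^esub> y"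
      unfolding y_def by (rule someI[of _ x]) (use x in simp)
    then have "h (x \<ominus>\<^bsub>M\<^esub> y) = \<zero>\<^bsub>N\<^esub>" using x quotient_coset_eq ker by blast
    then have "h x \<ominus>\<^bsub>N\<^esub> h y = \<zero>\<^bsub>N\<^esub>" using module_hom_minus[OF M N h] x y by simp
    then have "h x = h y" using module_hom_closed[OF h] x y by (simp add: N.M.minus_eq_zero_iff)
    then show ?thesis by (simp add: g_def y_def)
  qed
  then have "g \<in> module_hom R (quotient_module M H) N"
    using h by (intro module_homI)
      (auto simp: quotient_carrier quotient_coset_add quotient_coset_smult module_hom_closed
        module_hom_add module_hom_smult)
  then show ?thesis using g by blast
qed

end

text \<open>The assumptions are kept this weak because in \<open>tensor_homology\<close> the ambient
  record is a tensor product whose carrier has been cut down to the cycles, and this record is never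
  shown to be a module.\<close>

lemma carrier_quotient_trivial:
  assumes "carrier (quotient_module M H) = {\<zero>\<^bsub>quotient_module M H\<^esub>}" "\<zero>\<^bsub>M\<^esub> \<in> H"
    "\<And>x. x \<in> carrier M \<Longrightarrow> \<zero>\<^bsub>M\<^esub> \<oplus>\<^bsub>M\<^esub> x = x" "x \<in> carrier M"
  shows "x \<in> H"
proof -
  have "H +>\<^bsub>M\<^esub> x = H"
    using assms(1,4) by (auto simp: quotient_module_simps A_RCOSETS_def')
  moreover have "\<zero>\<^bsub>M\<^esub> \<oplus>\<^bsub>M\<^esub> x \<in> H +>\<^bsub>M\<^esub> x" using assms(2) by (auto simp: a_r_coset_def')
  ultimately show ?thesis using assms(3,4) by simp
qed

section \<open>Bilinear maps and the universal property of the tensor product\<close>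

definition bilinear ::
  "('r, 'a) ring_scheme \<Rightarrow> ('r, 'm) module \<Rightarrow> ('r, 'n) module \<Rightarrow> ('r, 'l) module \<Rightarrow> ('m \<Rightarrow> 'n \<Rightarrow> 'l) \<Rightarrow> bool"
  where "bilinear R M N L b \<longleftrightarrow>
    (\<forall>x \<in> carrier M. b x \<in> module_hom R N L) \<and> (\<forall>y \<in> carrier N. (\<lambda>x. b x y) \<in> module_hom R M L)"

context
  fixes R :: "('r, 'a) ring_scheme" and M :: "('r, 'm) module" and N :: "('r, 'n) module"
  assumes M: "module R M" and N: "module R N"
begin

interpretation M: module R M by (rule M)
interpretation N: module R N by (rule N)

private abbreviation "F \<equiv> free_module R (carrier M \<times> carrier N)"

interpretation F: module R F by (rule M.R.module_free_module)

lemma tensor_relations_closed: "tensor_relations R M N \<subseteq> carrier F"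
  unfolding tensor_relations_def Let_def
  by (auto intro!: F.M.minus_closed F.M.add.m_closed F.smult_closed M.R.free_gen_closed
      simp del: free_module_simps)

lemma submodule_tensor_kernel: "submodule (tensor_kernel R M N) R F"
  unfolding tensor_kernel_def by (rule span_submodule[OF F.module_axioms tensor_relations_closed])

lemma module_tensor: "module R (tensor R M N)"
  unfolding tensor_def by (rule module_quotient[OF F.module_axioms submodule_tensor_kernel])

lemma tensor_coset_hom:
  "(\<lambda>u. tensor_kernel R M N +>\<^bsub>F\<^esub> u) \<in> module_hom R F (tensor R M N)"
  unfolding tensor_def by (rule quotient_hom[OF F.module_axioms submodule_tensor_kernel])

lemma tensor_carrier: "carrier (tensor R M N) = (\<lambda>u. tensor_kernel R M N +>\<^bsub>F\<^esub> u) ` carrier F"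
  unfolding tensor_def by (rule quotient_carrier[OF F.module_axioms submodule_tensor_kernel])

lemma pure_tensor_closed:
  "x \<in> carrier M \<Longrightarrow> y \<in> carrier N \<Longrightarrow> pure_tensor R M N x y \<in> carrier (tensor R M N)"
  unfolding pure_tensor_def tensor_carrier by auto

lemma tensor_relation_coset:
  assumes "u \<ominus>\<^bsub>F\<^esub> v \<in> tensor_relations R M N" "u \<in> carrier F" "v \<in> carrier F"
  shows "tensor_kernel R M N +>\<^bsub>F\<^esub> u = tensor_kernel R M N +>\<^bsub>F\<^esub> v"
  using quotient_coset_eq[OF F.module_axioms submodule_tensor_kernel assms(2,3)] assms(1)
    span_superset[of "tensor_relations R M N" R F] by (auto simp: tensor_kernel_def)

lemma bilinear_pure_tensor: "bilinear R M N (tensor R M N) (pure_tensor R M N)"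
proof -
  let ?K = "tensor_kernel R M N" and ?g = "free_gen R" and ?T = "tensor R M N"
  note add = module_hom_add[OF tensor_coset_hom] and smult = module_hom_smult[OF tensor_coset_hom]
  have 1: "pure_tensor R M N x (y \<oplus>\<^bsub>N\<^esub> y') = pure_tensor R M N x y \<oplus>\<^bsub>?T\<^esub> pure_tensor R M N x y'"
    if "x \<in> carrier M" "y \<in> carrier N" "y' \<in> carrier N" for x y y'
  proof -
    have "?K +>\<^bsub>F\<^esub> ?g (x, y \<oplus>\<^bsub>N\<^esub> y') = ?K +>\<^bsub>F\<^esub> (?g (x, y) \<oplus>\<^bsub>F\<^esub> ?g (x, y'))"
      by (rule tensor_relation_coset)
        (use that in \<open>auto simp: tensor_relations_def Let_def simp del: free_module_simps
          intro!: F.M.add.m_closed M.R.free_gen_closed\<close>)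
    then show ?thesis
      unfolding pure_tensor_def using that by (simp add: add del: free_module_simps)
  qed
  have 2: "pure_tensor R M N (x \<oplus>\<^bsub>M\<^esub> x') y = pure_tensor R M N x y \<oplus>\<^bsub>?T\<^esub> pure_tensor R M N x' y"
    if "x \<in> carrier M" "x' \<in> carrier M" "y \<in> carrier N" for x x' y
  proof -
    have "?K +>\<^bsub>F\<^esub> ?g (x \<oplus>\<^bsub>M\<^esub> x', y) = ?K +>\<^bsub>F\<^esub> (?g (x, y) \<oplus>\<^bsub>F\<^esub> ?g (x', y))"
      by (rule tensor_relation_coset)
        (use that in \<open>auto simp: tensor_relations_def Let_def simp del: free_module_simps
          intro!: F.M.add.m_closed M.R.free_gen_closed\<close>)
    then show ?thesis
      unfolding pure_tensor_def using that by (simp add: add del: free_module_simps)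
  qed
  have 3: "pure_tensor R M N (r \<odot>\<^bsub>M\<^esub> x) y = r \<odot>\<^bsub>?T\<^esub> pure_tensor R M N x y"
    if "x \<in> carrier M" "r \<in> carrier R" "y \<in> carrier N" for x r y
  proof -
    have "?K +>\<^bsub>F\<^esub> ?g (r \<odot>\<^bsub>M\<^esub> x, y) = ?K +>\<^bsub>F\<^esub> (r \<odot>\<^bsub>F\<^esub> ?g (x, y))"
      by (rule tensor_relation_coset)
        (use that in \<open>auto simp: tensor_relations_def Let_def simp del: free_module_simps
          intro!: F.smult_closed M.R.free_gen_closed\<close>)
    then show ?thesis
      unfolding pure_tensor_def using that by (simp add: smult del: free_module_simps)
  qed
  have 4: "pure_tensor R M N x (r \<odot>\<^bsub>N\<^esub> y) = r \<odot>\<^bsub>?T\<^esub> pure_tensor R M N x y"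
    if "x \<in> carrier M" "r \<in> carrier R" "y \<in> carrier N" for x r y
  proof -
    have "?K +>\<^bsub>F\<^esub> ?g (x, r \<odot>\<^bsub>N\<^esub> y) = ?K +>\<^bsub>F\<^esub> (r \<odot>\<^bsub>F\<^esub> ?g (x, y))"
      by (rule tensor_relation_coset)
        (use that in \<open>auto simp: tensor_relations_def Let_def simp del: free_module_simps
          intro!: F.smult_closed M.R.free_gen_closed\<close>)
    then show ?thesis
      unfolding pure_tensor_def using that by (simp add: smult del: free_module_simps)
  qed
  show ?thesis
    unfolding bilinear_def using 1 2 3 4 pure_tensor_closed by (auto intro!: module_homI)
qed

text \<open>The uniqueness half of the universal property: pure tensors are the cosets of the free
  generators, on which a linear map out of a free module is determined.\<close>

lemma tensor_hom_eqI:
  assumes L: "module R L" and g: "g \<in> module_hom R (tensor R M N) L" and h: "h \<in> module_hom R (tensor R M N) L"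
    and eq: "\<And>x y. x \<in> carrier M \<Longrightarrow> y \<in> carrier N \<Longrightarrow> g (pure_tensor R M N x y) = h (pure_tensor R M N x y)"
    and w: "w \<in> carrier (tensor R M N)"
  shows "g w = h w"
proof -
  obtain u where u: "u \<in> carrier F" "w = tensor_kernel R M N +>\<^bsub>F\<^esub> u"
    using w by (auto simp: tensor_carrier)
  show ?thesis
    unfolding u(2)
    by (rule M.R.module_hom_free_eqI[OF L module_hom_comp[OF tensor_coset_hom g]
          module_hom_comp[OF tensor_coset_hom h] _ u(1)])
      (use eq in \<open>auto simp: pure_tensor_def\<close>)
qed

text \<open>The existence half: the linear extension of \<open>b\<close> to the free module kills
  each of the four kinds of relations, two by additivity and two by homogeneity of \<open>b\<close>
  in its arguments.\<close>

lemma tensor_lift: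
  assumes L: "module R L" and b: "bilinear R M N L b"
  shows "\<exists>h \<in> module_hom R (tensor R M N) L.
    \<forall>x \<in> carrier M. \<forall>y \<in> carrier N. h (pure_tensor R M N x y) = b x y"
proof -
  interpret L: module R L by (rule L)
  have b1: "b x \<in> module_hom R N L" if "x \<in> carrier M" for x using b that by (simp add: bilinear_def)
  have b2: "(\<lambda>x. b x y) \<in> module_hom R M L" if "y \<in> carrier N" for y using b that by (simp add: bilinear_def)
  have bc: "b x y \<in> carrier L" if "x \<in> carrier M" "y \<in> carrier N" for x y
    using module_hom_closed[OF b1] that by blast
  let ?f = "lincomb R L (\<lambda>(x, y). b x y)"
  have f: "?f \<in> module_hom R F L" by (rule M.R.lincomb_hom[OF L]) (use bc in auto)
  have fg: "?f (free_gen R (x, y)) = b x y" if "x \<in> carrier M" "y \<in> carrier N" for x y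
    using M.R.lincomb_free_gen[OF L, of "\<lambda>(x, y). b x y" "(x, y)"] bc that by simp
  note hom = module_hom_minus[OF F.module_axioms L f] module_hom_add[OF f] module_hom_smult[OF f]
  have "tensor_relations R M N \<subseteq> {u \<in> carrier F. ?f u = \<zero>\<^bsub>L\<^esub>}"
  proof
    fix u assume u: "u \<in> tensor_relations R M N"
    then have "?f u = \<zero>\<^bsub>L\<^esub>"
      unfolding tensor_relations_def Let_def
      using module_hom_add[OF b1] module_hom_add[OF b2] module_hom_smult[OF b1] module_hom_smult[OF b2]
      by (auto simp del: free_module_simps
          simp: hom fg bc F.smult_closed F.M.add.m_closed L.M.minus_eq_zero_iff)
    then show "u \<in> {u \<in> carrier F. ?f u = \<zero>\<^bsub>L\<^esub>}" using u tensor_relations_closed by blast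
  qed
  then have "tensor_kernel R M N \<subseteq> {u \<in> carrier F. ?f u = \<zero>\<^bsub>L\<^esub>}"
    unfolding tensor_kernel_def
    by (rule span_minimal[OF module_hom_kernel_submodule[OF F.module_axioms L f]])
  then obtain h where h: "h \<in> module_hom R (tensor R M N) L"
    "\<And>u. u \<in> carrier F \<Longrightarrow> h (tensor_kernel R M N +>\<^bsub>F\<^esub> u) = ?f u"
    using quotient_lift[OF F.module_axioms submodule_tensor_kernel L f] unfolding tensor_def by blast
  then show ?thesis using fg by (intro bexI[of _ h]) (auto simp: pure_tensor_def)
qed

end

text \<open>Since \<open>tensor_map\<close> is a definite description, it has no usable properties
  until existence and uniqueness of the described map are established; both come from the universal
  property.\<close>

lemma tensor_map_hom:
  assumes Y: "module R Y" and N: "module R N" and N': "module R N'" and f: "f \<in> module_hom R N N'"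
  shows "tensor_map R Y N N' f \<in> module_hom R (tensor R Y N) (tensor R Y N')"
    and "\<And>y x. y \<in> carrier Y \<Longrightarrow> x \<in> carrier N \<Longrightarrow>
      tensor_map R Y N N' f (pure_tensor R Y N y x) = pure_tensor R Y N' y (f x)"
proof -
  let ?T = "tensor R Y N" and ?T' = "tensor R Y N'"
  let ?P = "\<lambda>h. h \<in> module_hom R ?T ?T' \<and> h \<in> extensional (carrier ?T) \<and>
    (\<forall>y \<in> carrier Y. \<forall>x \<in> carrier N. h (pure_tensor R Y N y x) = pure_tensor R Y N' y (f x))"
  have b: "bilinear R Y N ?T' (\<lambda>y x. pure_tensor R Y N' y (f x))"
    using bilinear_pure_tensor[OF Y N'] module_hom_comp[OF f, of _ ?T'] module_hom_closed[OF f]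
    unfolding bilinear_def by blast
  obtain h where h: "h \<in> module_hom R ?T ?T'"
    "\<And>y x. y \<in> carrier Y \<Longrightarrow> x \<in> carrier N \<Longrightarrow> h (pure_tensor R Y N y x) = pure_tensor R Y N' y (f x)"
    using tensor_lift[OF Y N module_tensor[OF Y N'] b] by blast
  interpret T: module R ?T by (rule module_tensor[OF Y N])
  have "\<exists>!h. ?P h"
  proof (rule ex_ex1I)
    \<comment> \<open>Outside the carrier the map from the universal property is arbitrary; its
      restriction is the extensional representative that the description asks for.\<close>
    have "restrict h (carrier ?T) \<in> module_hom R ?T ?T'"
      using h(1) by (auto simp: module_hom_def)
    then have "?P (restrict h (carrier ?T))"
      using h(2) pure_tensor_closed[OF Y N] by simp
    then show "\<exists>h. ?P h" by blast
  next
    fix g h assume g: "?P g" and h: "?P h"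
    have "g w = h w" if "w \<in> carrier ?T" for w
      by (rule tensor_hom_eqI[OF Y N module_tensor[OF Y N']]) (use g h that in auto)
    then show "g = h" using g h by (intro extensionalityI[of g "carrier ?T"]) auto
  qed
  from theI'[OF this] show "tensor_map R Y N N' f \<in> module_hom R ?T ?T'"
    "\<And>y x. y \<in> carrier Y \<Longrightarrow> x \<in> carrier N \<Longrightarrow>
      tensor_map R Y N N' f (pure_tensor R Y N y x) = pure_tensor R Y N' y (f x)"
    unfolding tensor_map_def by blast+
qed

section \<open>Comparison of resolutions\<close>

text \<open>\<open>Z i\<close> are the cycles in degree \<open>i\<close>; those in degree \<open>0\<close> are the kernel of the augmentation, which
  is not mentioned since its codomain has another type.\<close>

definition exact_complex ::
  "('r, 'a) ring_scheme \<Rightarrow> (nat \<Rightarrow> ('r, 'p) module) \<Rightarrow> (nat \<Rightarrow> 'p \<Rightarrow> 'p) \<Rightarrow> (nat \<Rightarrow> 'p set) \<Rightarrow> bool"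
  where "exact_complex R F d Z \<longleftrightarrow>
    (\<forall>i. module R (F i)) \<and> (\<forall>i. d i \<in> module_hom R (F (Suc i)) (F i)) \<and>
    (\<forall>i. d i ` carrier (F (Suc i)) = Z i) \<and>
    (\<forall>i. Z (Suc i) = {x \<in> carrier (F (Suc i)). d i x = \<zero>\<^bsub>F i\<^esub>})"

lemma exact_complexD:
  assumes "exact_complex R F d Z"
  shows "module R (F i)" "d i \<in> module_hom R (F (Suc i)) (F i)" "d i ` carrier (F (Suc i)) = Z i"
    "Z (Suc i) = {x \<in> carrier (F (Suc i)). d i x = \<zero>\<^bsub>F i\<^esub>}"
    "x \<in> Z i \<Longrightarrow> x \<in> carrier (F i)" "x \<in> carrier (F (Suc i)) \<Longrightarrow> d i x \<in> Z i"
    "x \<in> Z (Suc i) \<Longrightarrow> d i x = \<zero>\<^bsub>F i\<^esub>"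
proof -
  show *: "d i \<in> module_hom R (F (Suc i)) (F i)" "d i ` carrier (F (Suc i)) = Z i"
    using assms by (auto simp: exact_complex_def)
  show "x \<in> carrier (F i)" if "x \<in> Z i"
    using * that module_hom_closed by (metis (no_types, lifting) imageE)
  show "d i x \<in> Z i" if "x \<in> carrier (F (Suc i))"
    using *(2) that by blast
qed (use assms in \<open>auto simp: exact_complex_def\<close>)

text \<open>The recursion carries along that cycles go to cycles. This places the composite of the
  current map with \<open>d\<close> inside the image of \<open>\<delta>\<close>, where projectivity
  provides the next map.\<close>

lemma (in cring) chain_map_exists:
  assumes F: "exact_complex R F d Z" and proj: "\<And>i. projective R (F i)"
    and G: "exact_complex R G \<delta> W"
    and f0: "f0 \<in> module_hom R (F 0) (G 0)" "f0 ` Z 0 \<subseteq> W 0"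
  shows "\<exists>f. f 0 = f0 \<and> (\<forall>i. f i \<in> module_hom R (F i) (G i)) \<and>
    (\<forall>i. \<forall>x \<in> carrier (F (Suc i)). \<delta> i (f (Suc i) x) = f i (d i x))"
proof -
  let ?P = "\<lambda>n x. x \<in> module_hom R (F n) (G n) \<and> x ` Z n \<subseteq> W n \<and> (n = 0 \<longrightarrow> x = f0)"
  let ?Q = "\<lambda>n x y. \<forall>z \<in> carrier (F (Suc n)). \<delta> n (y z) = x (d n z)"
  have "\<exists>f. \<forall>n. ?P n (f n) \<and> ?Q n (f n) (f (Suc n))"
  proof (rule dependent_nat_choice)
    show "\<exists>x. ?P 0 x" using f0 by blast
    fix x n assume x: "?P n x"
    have xd: "(\<lambda>z. x (d n z)) \<in> module_hom R (F (Suc n)) (G n)"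
      by (rule module_hom_comp[OF exact_complexD(2)[OF F]]) (use x in blast)
    have "(\<lambda>z. x (d n z)) ` carrier (F (Suc n)) \<subseteq> \<delta> n ` carrier (G (Suc n))"
      using x exact_complexD(3)[OF F, of n] exact_complexD(3)[OF G, of n] by blast
    then obtain y where y: "y \<in> module_hom R (F (Suc n)) (G (Suc n))"
      "\<And>z. z \<in> carrier (F (Suc n)) \<Longrightarrow> \<delta> n (y z) = x (d n z)"
      using projective_lift[OF exact_complexD(1)[OF G] exact_complexD(1)[OF G] exact_complexD(2)[OF G]
        proj xd] by blast
    have "y ` Z (Suc n) \<subseteq> W (Suc n)"
    proof
      fix w assume "w \<in> y ` Z (Suc n)"
      then obtain z where z: "z \<in> Z (Suc n)" "w = y z" by blast
      have zc: "z \<in> carrier (F (Suc n))" using exact_complexD(5)[OF F] z by blast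
      have "\<delta> n w = \<zero>\<^bsub>G n\<^esub>"
        using y(2)[OF zc] exact_complexD(7)[OF F z(1)] z
          module_hom_zero[OF exact_complexD(1)[OF F] exact_complexD(1)[OF G]] x by metis
      then show "w \<in> W (Suc n)"
        using module_hom_closed[OF y(1) zc] z exact_complexD(4)[OF G] by auto
    qed
    then show "\<exists>y. ?P (Suc n) y \<and> ?Q n x y" using y by blast
  qed
  then show ?thesis by blast
qed

text \<open>A null homotopy of the difference of \<open>f\<close> and the identity. To continue the
  recursion it suffices to know the homotopy identity on cycles, where the term with
  \<open>d\<close> is zero: applied to \<open>d n x\<close> it shows that the error
  \<open>?a x\<close> is again a cycle, hence a boundary, and can be lifted.\<close>

lemma (in cring) homotopy_exists:
  assumes F: "exact_complex R F d Z" and proj: "\<And>i. projective R (F i)"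
    and f: "\<And>i. f i \<in> module_hom R (F i) (F i)"
    and comm: "\<And>i x. x \<in> carrier (F (Suc i)) \<Longrightarrow> d i (f (Suc i) x) = f i (d i x)"
    and f0: "\<And>x. x \<in> carrier (F 0) \<Longrightarrow> f 0 x \<ominus>\<^bsub>F 0\<^esub> x \<in> Z 0"
  shows "\<exists>h. (\<forall>i. h i \<in> module_hom R (F i) (F (Suc i))) \<and>
    (\<forall>i. \<forall>x \<in> carrier (F (Suc i)). d (Suc i) (h (Suc i) x) = (f (Suc i) x \<ominus>\<^bsub>F (Suc i)\<^esub> x) \<ominus>\<^bsub>F (Suc i)\<^esub> h i (d i x))"
proof -
  note mod = exact_complexD(1)[OF F] and dhom = exact_complexD(2)[OF F]
  let ?D = "\<lambda>n x. f n x \<ominus>\<^bsub>F n\<^esub> x"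
  have D: "?D n \<in> module_hom R (F n) (F n)" for n
    by (rule module_hom_diff[OF mod f]) (auto simp: module_hom_def)
  let ?P = "\<lambda>n h. h \<in> module_hom R (F n) (F (Suc n)) \<and> (\<forall>z \<in> Z n. d n (h z) = ?D n z)"
  let ?Q = "\<lambda>n h h'. \<forall>x \<in> carrier (F (Suc n)). d (Suc n) (h' x) = ?D (Suc n) x \<ominus>\<^bsub>F (Suc n)\<^esub> h (d n x)"
  have "\<exists>h. \<forall>n. ?P n (h n) \<and> ?Q n (h n) (h (Suc n))"
  proof (rule dependent_nat_choice)
    have "?D 0 ` carrier (F 0) \<subseteq> d 0 ` carrier (F (Suc 0))"
      using f0 exact_complexD(3)[OF F] by blast
    then obtain h where "h \<in> module_hom R (F 0) (F (Suc 0))"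
      "\<And>x. x \<in> carrier (F 0) \<Longrightarrow> d 0 (h x) = ?D 0 x"
      using projective_lift[OF mod mod dhom proj D] by blast
    then show "\<exists>h. ?P 0 h" using exact_complexD(5)[OF F] by blast
  next
    fix h n assume h: "?P n h"
    interpret N: module R "F n" by (rule mod)
    interpret S: module R "F (Suc n)" by (rule mod)
    let ?a = "\<lambda>x. ?D (Suc n) x \<ominus>\<^bsub>F (Suc n)\<^esub> h (d n x)"
    have a: "?a \<in> module_hom R (F (Suc n)) (F (Suc n))"
      by (rule module_hom_diff[OF mod D module_hom_comp[OF dhom]]) (use h in blast)
    have "?a ` carrier (F (Suc n)) \<subseteq> d (Suc n) ` carrier (F (Suc (Suc n)))"
    proof
      fix y assume "y \<in> ?a ` carrier (F (Suc n))"
      then obtain x where x: "x \<in> carrier (F (Suc n))" "y = ?a x" by blast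
      have c: "?D (Suc n) x \<in> carrier (F (Suc n))" "f (Suc n) x \<in> carrier (F (Suc n))"
        "h (d n x) \<in> carrier (F (Suc n))" "d n x \<in> carrier (F n)" "f n (d n x) \<in> carrier (F n)"
        using x h module_hom_closed[OF D] module_hom_closed[OF f] module_hom_closed[OF dhom]
          module_hom_closed by (blast, blast, metis, blast, blast)
      have "d n y = (d n (f (Suc n) x) \<ominus>\<^bsub>F n\<^esub> d n x) \<ominus>\<^bsub>F n\<^esub> d n (h (d n x))"
        using x c by (simp add: module_hom_minus[OF mod mod dhom])
      also have "d n (h (d n x)) = f n (d n x) \<ominus>\<^bsub>F n\<^esub> d n x"
        using h exact_complexD(6)[OF F x(1)] by blast
      also have "d n (f (Suc n) x) = f n (d n x)" using comm x(1) by blast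
      finally have "d n y = \<zero>\<^bsub>F n\<^esub>" using c by (simp add: N.M.minus_eq_zero_iff)
      then have "y \<in> Z (Suc n)"
        using exact_complexD(4)[OF F] module_hom_closed[OF a x(1)] x(2) by simp
      then show "y \<in> d (Suc n) ` carrier (F (Suc (Suc n)))" using exact_complexD(3)[OF F] by blast
    qed
    then obtain h' where h': "h' \<in> module_hom R (F (Suc n)) (F (Suc (Suc n)))"
      "\<And>x. x \<in> carrier (F (Suc n)) \<Longrightarrow> d (Suc n) (h' x) = ?a x"
      using projective_lift[OF mod mod dhom proj a] by blast
    have "d (Suc n) (h' z) = ?D (Suc n) z" if z: "z \<in> Z (Suc n)" for z
    proof -
      have zc: "z \<in> carrier (F (Suc n))" using exact_complexD(5)[OF F z] .
      have "h (d n z) = \<zero>\<^bsub>F (Suc n)\<^esub>"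
        using exact_complexD(7)[OF F z] module_hom_zero[OF mod mod] h by metis
      then show ?thesis using h'(2)[OF zc] module_hom_closed[OF D zc] by (simp add: a_minus_def)
    qed
    then show "\<exists>h'. ?P (Suc n) h' \<and> ?Q n h h'" using h' by blast
  qed
  then show ?thesis by blast
qed

lemma (in module) finsum_smult_rdistr:
  assumes "finite A" "r \<in> A \<rightarrow> carrier R" "x \<in> carrier M"
  shows "(\<Oplus>a\<in>A. r a) \<odot>\<^bsub>M\<^esub> x = (\<Oplus>\<^bsub>M\<^esub>a\<in>A. r a \<odot>\<^bsub>M\<^esub> x)"
  using assms(1,2)
proof induct
  case empty
  then show ?case using assms(3) by simp
next
  case (insert a A)
  then show ?case using assms(3) by (simp add: smult_l_distr Pi_iff)
qed

section \<open>Matrices acting on tuples of module elements\<close>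

text \<open>The map \<open>Y\<^sup>A \<rightarrow> Y\<^sup>C\<close> given by the matrix of \<open>\<phi> : R\<^sup>A \<rightarrow> R\<^sup>C\<close>, that is \<open>Y \<otimes> \<phi>\<close>. It spares
  us from taking tensor products with free modules of finite rank.\<close>

definition mat_act ::
  "('r, 'a) ring_scheme \<Rightarrow> ('r, 'y) module \<Rightarrow> 'b set \<Rightarrow> (('b \<Rightarrow> 'r) \<Rightarrow> 'c \<Rightarrow> 'r) \<Rightarrow> ('b \<Rightarrow> 'y) \<Rightarrow> 'c \<Rightarrow> 'y"
  where "mat_act R Y A \<phi> u b = (\<Oplus>\<^bsub>Y\<^esub>a\<in>A. \<phi> (free_gen R a) b \<odot>\<^bsub>Y\<^esub> u a)"

text \<open>Exactness of \<open>Y\<^sup>A \<rightarrow> Y\<^sup>B \<rightarrow> Y\<^sup>C\<close> at \<open>Y\<^sup>B\<close>.\<close>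

definition mat_exact ::
  "('r, 'a) ring_scheme \<Rightarrow> ('r, 'y) module \<Rightarrow> 'b set \<Rightarrow> (('b \<Rightarrow> 'r) \<Rightarrow> 'c \<Rightarrow> 'r) \<Rightarrow> 'c set \<Rightarrow>
    (('c \<Rightarrow> 'r) \<Rightarrow> 'd \<Rightarrow> 'r) \<Rightarrow> 'd set \<Rightarrow> bool"
  where "mat_exact R Y A \<phi> B \<psi> C \<longleftrightarrow> (\<forall>u \<in> B \<rightarrow> carrier Y.
    (\<forall>c \<in> C. mat_act R Y B \<psi> u c = \<zero>\<^bsub>Y\<^esub>) \<longrightarrow>
    (\<exists>v \<in> A \<rightarrow> carrier Y. \<forall>b \<in> B. u b = mat_act R Y A \<phi> v b))"

lemma (in cring) free_gen_hom_closed: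
  assumes "\<phi> \<in> module_hom R (free_module R A) (free_module R B)" "a \<in> A"
  shows "\<phi> (free_gen R a) \<in> carrier (free_module R B)" "\<phi> (free_gen R a) b \<in> carrier R"
  using module_hom_closed[OF assms(1), of "free_gen R a"] assms(2)
    free_module_closed[of "\<phi> (free_gen R a)" R B] by simp_all

lemma (in cring) mat_act_closed:
  assumes "module R Y" "\<phi> \<in> module_hom R (free_module R A) (free_module R B)" "u \<in> A \<rightarrow> carrier Y"
  shows "mat_act R Y A \<phi> u b \<in> carrier Y"
proof -
  interpret Y: module R Y by fact
  show ?thesis
    unfolding mat_act_def
    by (rule Y.M.finsum_closed) (use free_gen_hom_closed[OF assms(2)] assms(3) in auto)
qed

lemma (in cring) mat_act_cong:
  assumes "module R Y" "\<phi> \<in> module_hom R (free_module R A) (free_module R B)" "v \<in> A \<rightarrow> carrier Y"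
    "\<And>a. a \<in> A \<Longrightarrow> \<phi> (free_gen R a) b = \<psi> (free_gen R a) b'" "\<And>a. a \<in> A \<Longrightarrow> u a = v a"
  shows "mat_act R Y A \<psi> u b' = mat_act R Y A \<phi> v b"
proof -
  interpret Y: module R Y by fact
  show ?thesis
    unfolding mat_act_def
    by (rule Y.M.finsum_cong') (use free_gen_hom_closed(2)[OF assms(2), of _ b] assms(3-5) in \<open>auto simp: Pi_iff\<close>)
qed

lemma (in cring) free_hom_coord:
  assumes "finite A" "\<phi> \<in> module_hom R (free_module R A) (free_module R B)"
    "u \<in> carrier (free_module R A)"
  shows "\<phi> u b = (\<Oplus>a\<in>A. u a \<otimes> \<phi> (free_gen R a) b)"
proof -
  interpret F: module R "free_module R B" by (rule module_free_module)
  have c: "u a \<odot>\<^bsub>free_module R B\<^esub> \<phi> (free_gen R a) \<in> carrier (free_module R B)" if "a \<in> A" for a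
    using free_gen_hom_closed[OF assms(2) that] assms(3) by (intro F.smult_closed) auto
  show ?thesis
    unfolding module_hom_free_finsum[OF module_free_module assms(2,3,1)]
    by (subst free_module_finsum[OF assms(1)]) (use c in auto)
qed

lemma (in cring) mat_act_comp:
  assumes Y: "module R Y" and fin: "finite A" "finite B"
    and f: "\<phi> \<in> module_hom R (free_module R A) (free_module R B)"
    and g: "\<psi> \<in> module_hom R (free_module R B) (free_module R C)" and u: "u \<in> A \<rightarrow> carrier Y"
  shows "mat_act R Y A (\<lambda>x. \<psi> (\<phi> x)) u c = mat_act R Y B \<psi> (mat_act R Y A \<phi> u) c"
proof -
  interpret Y: module R Y by (rule Y)
  let ?e = "free_gen R"
  note fc = free_gen_hom_closed[OF f] and gc = free_gen_hom_closed[OF g]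
  have "mat_act R Y A (\<lambda>x. \<psi> (\<phi> x)) u c = (\<Oplus>\<^bsub>Y\<^esub>a\<in>A. \<Oplus>\<^bsub>Y\<^esub>b\<in>B. \<psi> (?e b) c \<odot>\<^bsub>Y\<^esub> (\<phi> (?e a) b \<odot>\<^bsub>Y\<^esub> u a))"
    unfolding mat_act_def
  proof (rule Y.M.finsum_cong')
    fix a assume a: "a \<in> A"
    then have ua: "u a \<in> carrier Y" using u by auto
    have "(\<Oplus>b\<in>B. \<phi> (?e a) b \<otimes> \<psi> (?e b) c) \<odot>\<^bsub>Y\<^esub> u a =
      (\<Oplus>\<^bsub>Y\<^esub>b\<in>B. (\<phi> (?e a) b \<otimes> \<psi> (?e b) c) \<odot>\<^bsub>Y\<^esub> u a)"
      by (rule Y.finsum_smult_rdistr[OF fin(2) _ ua]) (use fc(2)[OF a] gc(2) in auto)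
    also have "\<dots> = (\<Oplus>\<^bsub>Y\<^esub>b\<in>B. \<psi> (?e b) c \<odot>\<^bsub>Y\<^esub> (\<phi> (?e a) b \<odot>\<^bsub>Y\<^esub> u a))"
      by (rule Y.M.finsum_cong')
        (use ua fc(2)[OF a] gc(2) in \<open>auto simp: Y.smult_assoc1[symmetric] m_comm\<close>)
    finally show "\<psi> (\<phi> (?e a)) c \<odot>\<^bsub>Y\<^esub> u a = (\<Oplus>\<^bsub>Y\<^esub>b\<in>B. \<psi> (?e b) c \<odot>\<^bsub>Y\<^esub> (\<phi> (?e a) b \<odot>\<^bsub>Y\<^esub> u a))"
      using free_hom_coord[OF fin(2) g fc(1)[OF a]] by simp
  qed (use fc gc u in \<open>auto intro!: Y.M.finsum_closed simp: Pi_iff\<close>)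
  also have "\<dots> = (\<Oplus>\<^bsub>Y\<^esub>b\<in>B. \<Oplus>\<^bsub>Y\<^esub>a\<in>A. \<psi> (?e b) c \<odot>\<^bsub>Y\<^esub> (\<phi> (?e a) b \<odot>\<^bsub>Y\<^esub> u a))"
    by (rule Y.M.finsum_swap) (use fin fc gc u in \<open>auto simp: Pi_iff\<close>)
  also have "\<dots> = mat_act R Y B \<psi> (mat_act R Y A \<phi> u) c"
    unfolding mat_act_def
    by (rule Y.M.finsum_cong')
      (use fin fc gc u in \<open>auto intro!: Y.M.finsum_closed simp: Pi_iff Y.finsum_smult_ldistr\<close>)
  finally show ?thesis .
qed

lemma (in cring) mat_act_add:
  assumes Y: "module R Y"
    and f: "\<phi> \<in> module_hom R (free_module R A) (free_module R B)"
    and g: "\<psi> \<in> module_hom R (free_module R A) (free_module R B)" and u: "u \<in> A \<rightarrow> carrier Y"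
  shows "mat_act R Y A (\<lambda>x. \<phi> x \<oplus>\<^bsub>free_module R B\<^esub> \<psi> x) u b =
    mat_act R Y A \<phi> u b \<oplus>\<^bsub>Y\<^esub> mat_act R Y A \<psi> u b"
proof -
  interpret Y: module R Y by (rule Y)
  note fc = free_gen_hom_closed[OF f] and gc = free_gen_hom_closed[OF g]
  have "mat_act R Y A (\<lambda>x. \<phi> x \<oplus>\<^bsub>free_module R B\<^esub> \<psi> x) u b =
    (\<Oplus>\<^bsub>Y\<^esub>a\<in>A. \<phi> (free_gen R a) b \<odot>\<^bsub>Y\<^esub> u a \<oplus>\<^bsub>Y\<^esub> \<psi> (free_gen R a) b \<odot>\<^bsub>Y\<^esub> u a)"
    unfolding mat_act_def
    by (rule Y.M.finsum_cong') (use fc gc u in \<open>auto simp: Y.smult_l_distr Pi_iff\<close>)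
  also have "\<dots> = mat_act R Y A \<phi> u b \<oplus>\<^bsub>Y\<^esub> mat_act R Y A \<psi> u b"
    unfolding mat_act_def by (rule Y.M.finsum_addf) (use fc gc u in auto)
  finally show ?thesis .
qed

lemma (in cring) mat_act_diff:
  assumes Y: "module R Y" and fin: "finite A"
    and f: "\<phi> \<in> module_hom R (free_module R A) (free_module R B)"
    and u: "u \<in> A \<rightarrow> carrier Y" and v: "v \<in> A \<rightarrow> carrier Y"
  shows "mat_act R Y A \<phi> (\<lambda>a. u a \<ominus>\<^bsub>Y\<^esub> v a) b = mat_act R Y A \<phi> u b \<ominus>\<^bsub>Y\<^esub> mat_act R Y A \<phi> v b"
proof -
  interpret Y: module R Y by (rule Y)
  note fc = free_gen_hom_closed[OF f]
  have "mat_act R Y A \<phi> (\<lambda>a. u a \<ominus>\<^bsub>Y\<^esub> v a) b \<oplus>\<^bsub>Y\<^esub> mat_act R Y A \<phi> v b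
     = (\<Oplus>\<^bsub>Y\<^esub>a\<in>A. \<phi> (free_gen R a) b \<odot>\<^bsub>Y\<^esub> (u a \<ominus>\<^bsub>Y\<^esub> v a) \<oplus>\<^bsub>Y\<^esub> \<phi> (free_gen R a) b \<odot>\<^bsub>Y\<^esub> v a)"
    unfolding mat_act_def by (rule Y.M.finsum_addf[symmetric]) (use fc u v in \<open>auto simp: Pi_iff\<close>)
  also have "\<dots> = mat_act R Y A \<phi> u b"
    unfolding mat_act_def
  proof (rule Y.M.finsum_cong')
    fix a assume a: "a \<in> A"
    then have c: "u a \<in> carrier Y" "v a \<in> carrier Y" using u v by auto
    then have "(u a \<ominus>\<^bsub>Y\<^esub> v a) \<oplus>\<^bsub>Y\<^esub> v a = u a" by (simp add: a_minus_def Y.M.a_assoc Y.M.l_neg)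
    then show "\<phi> (free_gen R a) b \<odot>\<^bsub>Y\<^esub> (u a \<ominus>\<^bsub>Y\<^esub> v a) \<oplus>\<^bsub>Y\<^esub> \<phi> (free_gen R a) b \<odot>\<^bsub>Y\<^esub> v a =
      \<phi> (free_gen R a) b \<odot>\<^bsub>Y\<^esub> u a"
      using c fc(2)[OF a] by (simp add: Y.smult_r_distr[symmetric])
  qed (use fc u in auto)
  finally show ?thesis
    using mat_act_closed[OF Y f, of _ b] u v
    by (smt (verit) Y.M.a_assoc Y.M.a_inv_closed Y.M.minus_closed Y.M.r_neg Y.M.r_zero Y.M.minus_eq Pi_iff)
qed

lemma (in cring) mat_act_hom:
  assumes Y: "module R Y" "module R Y'" and h: "h \<in> module_hom R Y Y'" and fin: "finite A"
    and f: "\<phi> \<in> module_hom R (free_module R A) (free_module R B)" and u: "u \<in> A \<rightarrow> carrier Y"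
  shows "h (mat_act R Y A \<phi> u b) = mat_act R Y' A \<phi> (\<lambda>a. h (u a)) b"
proof -
  interpret Y: module R Y by (rule Y)
  interpret Y': module R Y' by (rule Y)
  note fc = free_gen_hom_closed[OF f]
  have "h (mat_act R Y A \<phi> u b) = (\<Oplus>\<^bsub>Y'\<^esub>a\<in>A. h (\<phi> (free_gen R a) b \<odot>\<^bsub>Y\<^esub> u a))"
    unfolding mat_act_def by (rule module_hom_finsum[OF Y h fin]) (use fc u in auto)
  also have "\<dots> = mat_act R Y' A \<phi> (\<lambda>a. h (u a)) b"
    unfolding mat_act_def
    by (rule Y'.M.finsum_cong') (use fc u h in \<open>auto simp: Pi_iff module_hom_smult module_hom_closed\<close>)
  finally show ?thesis .
qed

lemma (in cring) mat_act_zero: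
  assumes Y: "module R Y"
    and f: "\<phi> \<in> module_hom R (free_module R A) (free_module R B)" and u: "\<And>a. a \<in> A \<Longrightarrow> u a = \<zero>\<^bsub>Y\<^esub>"
  shows "mat_act R Y A \<phi> u b = \<zero>\<^bsub>Y\<^esub>"
proof -
  interpret Y: module R Y by (rule Y)
  have "mat_act R Y A \<phi> u b = (\<Oplus>\<^bsub>Y\<^esub>a\<in>A. \<zero>\<^bsub>Y\<^esub>)"
    unfolding mat_act_def
    by (rule Y.M.finsum_cong') (use free_gen_hom_closed(2)[OF f] u in auto)
  then show ?thesis by simp
qed

lemma (in cring) mat_act_id:
  assumes Y: "module R Y" and fin: "finite A" and u: "u \<in> A \<rightarrow> carrier Y" and b: "b \<in> A"
  shows "mat_act R Y A (\<lambda>x. x) u b = u b"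
proof -
  interpret Y: module R Y by (rule Y)
  have "(\<Oplus>\<^bsub>Y\<^esub>a\<in>A. free_gen R a b \<odot>\<^bsub>Y\<^esub> u a) = (\<Oplus>\<^bsub>Y\<^esub>a\<in>{b}. u a)"
    by (rule Y.M.add.finprod_mono_neutral_cong_right)
      (use fin u b in \<open>auto simp: free_gen_def Pi_iff\<close>)
  then show ?thesis unfolding mat_act_def using u b by (simp add: Pi_iff)
qed

section \<open>From vanishing Tor to an exact sequence of powers of \<open>Y\<close>\<close>

lemma projective_resolution_exact:
  assumes "projective_resolution R M P d e"
  shows "exact_complex R P d (case_nat (a_kernel (P 0) M e) (\<lambda>i. a_kernel (P (Suc i)) (P i) (d i)))"
  unfolding exact_complex_def
proof (intro conjI allI)
  fix i
  show "d i ` carrier (P (Suc i)) =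
    (case i of 0 \<Rightarrow> a_kernel (P 0) M e | Suc i \<Rightarrow> a_kernel (P (Suc i)) (P i) (d i))"
    using assms by (cases i) (auto simp: projective_resolution_def)
qed (use assms in \<open>auto simp: projective_resolution_def projective_def a_kernel_def'\<close>)

lemma module_hom_sum:
  assumes "module R N" "g \<in> module_hom R M N" "h \<in> module_hom R M N"
  shows "(\<lambda>x. g x \<oplus>\<^bsub>N\<^esub> h x) \<in> module_hom R M N"
proof -
  interpret N: module R N by fact
  show ?thesis
    using assms(2,3)
    by (intro module_homI)
      (simp_all add: module_hom_closed module_hom_add module_hom_smult N.smult_r_distr N.M.a_ac)
qed

text \<open>For \<open>x\<close> a generator, \<open>y\<close> its image under the two comparison
  maps and \<open>z\<close> its image under \<open>h\<close> after \<open>d\<close>, this solves the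
  homotopy identity for \<open>y\<close>.\<close>

lemma (in abelian_group) regroup_difference:
  assumes "x \<in> carrier G" "y \<in> carrier G" "z \<in> carrier G"
  shows "(x \<oplus> z) \<oplus> ((y \<ominus> x) \<ominus> z) = y"
proof -
  have "(x \<oplus> z) \<oplus> ((y \<ominus> x) \<ominus> z) = y \<oplus> ((x \<oplus> \<ominus> x) \<oplus> (z \<oplus> \<ominus> z))"
    using assms by (simp add: a_minus_def a_ac del: r_neg)
  then show ?thesis using assms by (simp add: r_neg)
qed

text \<open>Linearity in the common argument \<open>w\<close> is what allows an identity between
  such expressions on a tensor product to be checked on pure tensors.\<close>

lemma (in cring) mat_act_of_homs:
  assumes Q: "module R Q" and Y: "module R Y" and fin: "finite A"
    and f: "\<phi> \<in> module_hom R (free_module R A) (free_module R B)"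
    and h: "\<And>a. a \<in> A \<Longrightarrow> h a \<in> module_hom R Q Y"
  shows "(\<lambda>w. mat_act R Y A \<phi> (\<lambda>a. h a w) b) \<in> module_hom R Q Y"
proof (rule module_homI)
  interpret Q: module R Q by (rule Q)
  interpret Y: module R Y by (rule Y)
  note fc = free_gen_hom_closed(2)[OF f]
  fix w assume w: "w \<in> carrier Q"
  have hw: "h a w \<in> carrier Y" if "a \<in> A" for a using module_hom_closed[OF h[OF that] w] .
  then show "mat_act R Y A \<phi> (\<lambda>a. h a w) b \<in> carrier Y"
    by (intro mat_act_closed[OF Y f]) auto
  {
    fix w' assume w': "w' \<in> carrier Q"
    have hw': "h a w' \<in> carrier Y" if "a \<in> A" for a using module_hom_closed[OF h[OF that] w'] .
    have "mat_act R Y A \<phi> (\<lambda>a. h a (w \<oplus>\<^bsub>Q\<^esub> w')) b =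
      (\<Oplus>\<^bsub>Y\<^esub>a\<in>A. \<phi> (free_gen R a) b \<odot>\<^bsub>Y\<^esub> h a w \<oplus>\<^bsub>Y\<^esub> \<phi> (free_gen R a) b \<odot>\<^bsub>Y\<^esub> h a w')"
      unfolding mat_act_def
      by (rule Y.M.finsum_cong')
        (use fc hw hw' w w' module_hom_add[OF h] in \<open>auto simp: Y.smult_r_distr Pi_iff\<close>)
    also have "\<dots> = mat_act R Y A \<phi> (\<lambda>a. h a w) b \<oplus>\<^bsub>Y\<^esub> mat_act R Y A \<phi> (\<lambda>a. h a w') b"
      unfolding mat_act_def by (rule Y.M.finsum_addf) (use fc hw hw' in auto)
    finally show "mat_act R Y A \<phi> (\<lambda>a. h a (w \<oplus>\<^bsub>Q\<^esub> w')) b =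
      mat_act R Y A \<phi> (\<lambda>a. h a w) b \<oplus>\<^bsub>Y\<^esub> mat_act R Y A \<phi> (\<lambda>a. h a w') b" .
  }
  fix r assume r: "r \<in> carrier R"
  have "mat_act R Y A \<phi> (\<lambda>a. h a (r \<odot>\<^bsub>Q\<^esub> w)) b = (\<Oplus>\<^bsub>Y\<^esub>a\<in>A. r \<odot>\<^bsub>Y\<^esub> (\<phi> (free_gen R a) b \<odot>\<^bsub>Y\<^esub> h a w))"
    unfolding mat_act_def
    by (rule Y.M.finsum_cong')
      (use fc hw w r module_hom_smult[OF h] in \<open>auto simp: Y.smult_assoc1[symmetric] m_comm Pi_iff\<close>)
  also have "\<dots> = r \<odot>\<^bsub>Y\<^esub> mat_act R Y A \<phi> (\<lambda>a. h a w) b"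
    unfolding mat_act_def by (rule Y.finsum_smult_ldistr[symmetric]) (use fin fc hw r in auto)
  finally show "mat_act R Y A \<phi> (\<lambda>a. h a (r \<odot>\<^bsub>Q\<^esub> w)) b = r \<odot>\<^bsub>Y\<^esub> mat_act R Y A \<phi> (\<lambda>a. h a w) b" .
qed

text \<open>The identity of \<open>M\<close> is lifted. Compatibility of the degree 0 map with the
  augmentations sends the kernel of one into the kernel of the other, which starts the recursion of
  \<open>chain_map_exists\<close>.\<close>

lemma (in cring) resolution_lifts:
  assumes M: "module R M" and F: "exact_complex R F d Z" and G: "exact_complex R G \<delta> W"
    and proj: "\<And>i. projective R (F i)"
    and e: "e \<in> module_hom R (F 0) M" "Z 0 = {x \<in> carrier (F 0). e x = \<zero>\<^bsub>M\<^esub>}"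
    and \<epsilon>: "\<epsilon> \<in> module_hom R (G 0) M" "\<epsilon> ` carrier (G 0) = carrier M"
      "W 0 = {x \<in> carrier (G 0). \<epsilon> x = \<zero>\<^bsub>M\<^esub>}"
  shows "\<exists>f. (\<forall>i. f i \<in> module_hom R (F i) (G i)) \<and>
    (\<forall>i. \<forall>x \<in> carrier (F (Suc i)). \<delta> i (f (Suc i) x) = f i (d i x)) \<and>
    (\<forall>x \<in> carrier (F 0). \<epsilon> (f 0 x) = e x)"
proof -
  have "e ` carrier (F 0) \<subseteq> \<epsilon> ` carrier (G 0)"
    using \<epsilon>(2) module_hom_closed[OF e(1)] by auto
  then obtain f0 where f0: "f0 \<in> module_hom R (F 0) (G 0)"
    "\<And>x. x \<in> carrier (F 0) \<Longrightarrow> \<epsilon> (f0 x) = e x"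
    using projective_lift[OF exact_complexD(1)[OF G] M \<epsilon>(1) proj e(1)] by blast
  have "f0 ` Z 0 \<subseteq> W 0"
    unfolding e(2) \<epsilon>(3) using f0 module_hom_closed[OF f0(1)] by auto
  from chain_map_exists[OF F proj G f0(1) this] obtain f where
    "f 0 = f0" "\<forall>i. f i \<in> module_hom R (F i) (G i)"
    "\<forall>i. \<forall>x \<in> carrier (F (Suc i)). \<delta> i (f (Suc i) x) = f i (d i x)" by blast
  then show ?thesis using f0 by auto
qed

text \<open>Independence of Tor from the resolution, reduced to the part that is used. A cycle
  \<open>u\<close> is pushed along \<open>f\<close> into the tensor complex of \<open>P\<close>,
  bounded there, and the bounding chain is brought back along \<open>g\<close>. The composite of
  \<open>f\<close> and \<open>g\<close> is homotopic to the identity, so \<open>u\<close> differs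
  from the result by a boundary.\<close>

theorem (in cring) tensor_homology_trivial_imp_mat_exact:
  fixes P :: "nat \<Rightarrow> ('a, 'p) module" and B :: "nat \<Rightarrow> 'x set"
  assumes M: "module R M" and Y: "module R Y" and res: "projective_resolution R M P \<delta> e"
    and F: "exact_complex R (\<lambda>i. free_module R (B i)) d Z" and fin: "\<And>i. finite (B i)"
    and \<epsilon>: "\<epsilon> \<in> module_hom R (free_module R (B 0)) M" "\<epsilon> ` carrier (free_module R (B 0)) = carrier M"
      "Z 0 = {x \<in> carrier (free_module R (B 0)). \<epsilon> x = \<zero>\<^bsub>M\<^esub>}"
    and triv: "carrier (tensor_homology R Y P \<delta> (Suc n)) = {\<zero>\<^bsub>tensor_homology R Y P \<delta> (Suc n)\<^esub>}"
  shows "mat_exact R Y (B (Suc (Suc n))) (d (Suc n)) (B (Suc n)) (d n) (B n)"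
proof -
  interpret Y: module R Y by (rule Y)
  interpret M: module R M by (rule M)
  let ?F = "\<lambda>i. free_module R (B i)"
  let ?W = "case_nat (a_kernel (P 0) M e) (\<lambda>i. a_kernel (P (Suc i)) (P i) (\<delta> i))"
  have P: "exact_complex R P \<delta> ?W" by (rule projective_resolution_exact[OF res])
  have projP: "projective R (P i)" for i using res by (simp add: projective_resolution_def)
  have e: "e \<in> module_hom R (P 0) M" "e ` carrier (P 0) = carrier M"
    "?W 0 = {x \<in> carrier (P 0). e x = \<zero>\<^bsub>M\<^esub>}"
    using res by (auto simp: projective_resolution_def a_kernel_def')
  note modP = exact_complexD(1)[OF P] and dP = exact_complexD(2)[OF P]
  note d_hom = exact_complexD(2)[OF F]
  obtain f where f: "\<And>i. f i \<in> module_hom R (?F i) (P i)"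
    "\<And>i x. x \<in> carrier (?F (Suc i)) \<Longrightarrow> \<delta> i (f (Suc i) x) = f i (d i x)"
    "\<And>x. x \<in> carrier (?F 0) \<Longrightarrow> e (f 0 x) = \<epsilon> x"
    using resolution_lifts[OF M F P projective_free_module \<epsilon>(1,3) e] by blast
  obtain g where g: "\<And>i. g i \<in> module_hom R (P i) (?F i)"
    "\<And>i x. x \<in> carrier (P (Suc i)) \<Longrightarrow> d i (g (Suc i) x) = g i (\<delta> i x)"
    "\<And>x. x \<in> carrier (P 0) \<Longrightarrow> \<epsilon> (g 0 x) = e x"
    using resolution_lifts[OF M P F projP e(1,3) \<epsilon>] by blast
  have gf: "(\<lambda>x. g i (f i x)) \<in> module_hom R (?F i) (?F i)" for i
    by (rule module_hom_comp[OF f(1) g(1)])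
  have gf0: "g 0 (f 0 x) \<ominus>\<^bsub>?F 0\<^esub> x \<in> Z 0" if x: "x \<in> carrier (?F 0)" for x
  proof -
    interpret F0: module R "?F 0" by (rule module_free_module)
    have c: "f 0 x \<in> carrier (P 0)" "g 0 (f 0 x) \<in> carrier (?F 0)"
      using module_hom_closed[OF f(1) x] module_hom_closed[OF g(1)] by blast+
    then have "\<epsilon> (g 0 (f 0 x) \<ominus>\<^bsub>?F 0\<^esub> x) = \<zero>\<^bsub>M\<^esub>"
      using x f(3)[OF x] g(3)[OF c(1)] module_hom_closed[OF \<epsilon>(1)]
      by (simp add: module_hom_minus[OF module_free_module M \<epsilon>(1)] M.M.minus_eq_zero_iff)
    then show ?thesis unfolding \<epsilon>(3) using c x by (simp del: free_module_simps)
  qed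
  have gf_comm: "d i (g (Suc i) (f (Suc i) x)) = g i (f i (d i x))" if "x \<in> carrier (?F (Suc i))" for i x
    using f(2)[OF that] g(2) module_hom_closed[OF f(1) that] by simp
  obtain h where h: "\<And>i. h i \<in> module_hom R (?F i) (?F (Suc i))"
    "\<And>i x. x \<in> carrier (?F (Suc i)) \<Longrightarrow> d (Suc i) (h (Suc i) x) =
      (g (Suc i) (f (Suc i) x) \<ominus>\<^bsub>?F (Suc i)\<^esub> x) \<ominus>\<^bsub>?F (Suc i)\<^esub> h i (d i x)"
    using homotopy_exists[OF F projective_free_module gf gf_comm gf0] by blast
  let ?T = "\<lambda>i. tensor R Y (P i)"
  let ?D = "\<lambda>i. tensor_map R Y (P (Suc i)) (P i) (\<delta> i)"
  let ?t = "\<lambda>i. pure_tensor R Y (P i)"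
  have T: "module R (?T i)" for i by (rule module_tensor[OF Y modP])
  have bil: "bilinear R Y (P i) (?T i) (?t i)" for i by (rule bilinear_pure_tensor[OF Y modP])
  have tl: "(\<lambda>y. ?t i y p) \<in> module_hom R Y (?T i)" if "p \<in> carrier (P i)" for i p
    using bil that by (simp add: bilinear_def)
  have tr: "?t i y \<in> module_hom R (P i) (?T i)" if "y \<in> carrier Y" for i y
    using bil that by (simp add: bilinear_def)
  have tc: "?t i y p \<in> carrier (?T i)" if "y \<in> carrier Y" "p \<in> carrier (P i)" for i y p
    by (rule pure_tensor_closed[OF Y modP that])
  note Dhom = tensor_map_hom(1)[OF Y modP modP dP] and Dt = tensor_map_hom(2)[OF Y modP modP dP]
  have cycle_boundary: "z \<in> ?D (Suc n) ` carrier (?T (Suc (Suc n)))"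
    if z: "z \<in> carrier (?T (Suc n))" "?D n z = \<zero>\<^bsub>?T n\<^esub>" for z
  proof -
    interpret T: module R "?T (Suc n)" by (rule T)
    let ?B = "?D (Suc n) ` carrier (?T (Suc (Suc n)))"
    let ?C = "(?T (Suc n))\<lparr>carrier := a_kernel (?T (Suc n)) (?T n) (?D n)\<rparr>"
    have "tensor_homology R Y P \<delta> (Suc n) = quotient_module ?C ?B"
      by (simp add: tensor_homology_def Let_def)
    then have "carrier (quotient_module ?C ?B) = {\<zero>\<^bsub>quotient_module ?C ?B\<^esub>}" using triv by metis
    moreover have "\<zero>\<^bsub>?T (Suc n)\<^esub> \<in> ?B"
      using T.submoduleD(2)[OF module_hom_image_submodule[OF T T Dhom]] .
    moreover have "z \<in> carrier ?C" "\<And>x. x \<in> carrier ?C \<Longrightarrow> \<zero>\<^bsub>?C\<^esub> \<oplus>\<^bsub>?C\<^esub> x = x" "\<zero>\<^bsub>?C\<^esub> = \<zero>\<^bsub>?T (Suc n)\<^esub>"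
      using z by (auto simp: a_kernel_def')
    ultimately show ?thesis
      using carrier_quotient_trivial[of ?C ?B z] by metis
  qed
  have "\<exists>v \<in> B (Suc (Suc n)) \<rightarrow> carrier Y. \<forall>b \<in> B (Suc n). u b = mat_act R Y (B (Suc (Suc n))) (d (Suc n)) v b"
    if u: "u \<in> B (Suc n) \<rightarrow> carrier Y" and cyc: "\<And>c. c \<in> B n \<Longrightarrow> mat_act R Y (B (Suc n)) (d n) u c = \<zero>\<^bsub>Y\<^esub>" for u
  proof -
    let ?m = "Suc n"
    interpret T: module R "?T ?m" by (rule T)
    interpret Tn: module R "?T n" by (rule T)
    let ?e = "free_gen R :: 'x \<Rightarrow> 'x \<Rightarrow> 'a"
    have fe: "f i (?e b) \<in> carrier (P i)" if "b \<in> B i" for i b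
      using module_hom_closed[OF f(1)] that by auto
    have uc: "u b \<in> carrier Y" if "b \<in> B ?m" for b using u that by auto
    \<comment> \<open>The image of the sum of the elements \<open>u b \<otimes> ?e b\<close> under
      the map induced by \<open>f\<close>.\<close>
    define z where "z = (\<Oplus>\<^bsub>?T ?m\<^esub>b\<in>B ?m. ?t ?m (u b) (f ?m (?e b)))"
    have zc: "z \<in> carrier (?T ?m)"
      unfolding z_def using tc uc fe by (intro T.M.finsum_closed) auto
    have dc: "d n (?e b) \<in> carrier (?F n)" "d n (?e b) c \<in> carrier R" if "b \<in> B ?m" for b c
      using free_gen_hom_closed[OF d_hom that] by auto
    \<comment> \<open>The entries of \<open>d n\<close> are moved across the tensor sign. After the
      two sums are exchanged, the first factor paired with \<open>f n (?e c)\<close> is the matrix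
      of \<open>d n\<close> acting on \<open>u\<close> at \<open>c\<close>, which is zero.\<close>
    have "?D n z = (\<Oplus>\<^bsub>?T n\<^esub>b\<in>B ?m. ?D n (?t ?m (u b) (f ?m (?e b))))"
      unfolding z_def by (rule module_hom_finsum[OF T T Dhom fin]) (use tc uc fe in auto)
    also have "\<dots> = (\<Oplus>\<^bsub>?T n\<^esub>b\<in>B ?m. \<Oplus>\<^bsub>?T n\<^esub>c\<in>B n. ?t n (d n (?e b) c \<odot>\<^bsub>Y\<^esub> u b) (f n (?e c)))"
    proof (rule Tn.M.finsum_cong')
      show "(\<lambda>b. \<Oplus>\<^bsub>?T n\<^esub>c\<in>B n. ?t n (d n (?e b) c \<odot>\<^bsub>Y\<^esub> u b) (f n (?e c))) \<in> B ?m \<rightarrow> carrier (?T n)"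
        using tc fe uc dc by (auto intro!: Tn.M.finsum_closed)
      fix b assume b: "b \<in> B ?m"
      interpret Pn: module R "P n" by (rule modP)
      have pc: "d n (?e b) c \<odot>\<^bsub>P n\<^esub> f n (?e c) \<in> carrier (P n)" if "c \<in> B n" for c
        using fe[OF that] dc[OF b] by simp
      have "?D n (?t ?m (u b) (f ?m (?e b))) = ?t n (u b) (f n (d n (?e b)))"
        using Dt[OF uc[OF b] fe[OF b]] f(2)[of "?e b" n] b by simp
      also have "f n (d n (?e b)) = (\<Oplus>\<^bsub>P n\<^esub>c\<in>B n. d n (?e b) c \<odot>\<^bsub>P n\<^esub> f n (?e c))"
        by (rule module_hom_free_finsum[OF modP f(1) dc(1)[OF b] fin])
      also have "?t n (u b) \<dots> = (\<Oplus>\<^bsub>?T n\<^esub>c\<in>B n. ?t n (u b) (d n (?e b) c \<odot>\<^bsub>P n\<^esub> f n (?e c)))"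
        by (rule module_hom_finsum[OF modP T tr[OF uc[OF b]] fin]) (use pc in auto)
      also have "\<dots> = (\<Oplus>\<^bsub>?T n\<^esub>c\<in>B n. ?t n (d n (?e b) c \<odot>\<^bsub>Y\<^esub> u b) (f n (?e c)))"
        by (rule Tn.M.finsum_cong')
          (use module_hom_smult[OF tr] module_hom_smult[OF tl] fe uc[OF b] dc[OF b] tc in auto)
      finally show "?D n (?t ?m (u b) (f ?m (?e b))) =
        (\<Oplus>\<^bsub>?T n\<^esub>c\<in>B n. ?t n (d n (?e b) c \<odot>\<^bsub>Y\<^esub> u b) (f n (?e c)))" .
    qed simp
    also have "\<dots> = (\<Oplus>\<^bsub>?T n\<^esub>c\<in>B n. \<Oplus>\<^bsub>?T n\<^esub>b\<in>B ?m. ?t n (d n (?e b) c \<odot>\<^bsub>Y\<^esub> u b) (f n (?e c)))"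
      by (rule Tn.M.finsum_swap) (use fin tc fe uc dc in auto)
    also have "\<dots> = (\<Oplus>\<^bsub>?T n\<^esub>c\<in>B n. \<zero>\<^bsub>?T n\<^esub>)"
    proof (rule Tn.M.finsum_cong')
      fix c assume c: "c \<in> B n"
      have "(\<Oplus>\<^bsub>?T n\<^esub>b\<in>B ?m. ?t n (d n (?e b) c \<odot>\<^bsub>Y\<^esub> u b) (f n (?e c))) =
        ?t n (mat_act R Y (B ?m) (d n) u c) (f n (?e c))"
        unfolding mat_act_def
        by (rule module_hom_finsum[OF Y T tl[OF fe[OF c]] fin, symmetric]) (use uc dc in auto)
      also have "\<dots> = \<zero>\<^bsub>?T n\<^esub>"
        using cyc[OF c] module_hom_zero[OF Y T tl[OF fe[OF c]]] by simp
      finally show "(\<Oplus>\<^bsub>?T n\<^esub>b\<in>B ?m. ?t n (d n (?e b) c \<odot>\<^bsub>Y\<^esub> u b) (f n (?e c))) = \<zero>\<^bsub>?T n\<^esub>" .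
    qed auto
    finally have "?D n z = \<zero>\<^bsub>?T n\<^esub>" by simp
    then obtain w where w: "w \<in> carrier (?T (Suc ?m))" "z = ?D ?m w"
      using cycle_boundary[OF zc] by blast
    have gc: "g i p \<in> carrier (?F i)" "g i p b \<in> carrier R" if "p \<in> carrier (P i)" for i p b
      using module_hom_closed[OF g(1) that] free_module_closed[of "g i p" R "B i"] by blast+
    \<comment> \<open>Contracting with coordinate \<open>b\<close> of \<open>g\<close> gives the
      \<open>b\<close>-th component of the map from \<open>Y \<otimes> P\<close> to the power of
      \<open>Y\<close>.\<close>
    have psi_bil: "bilinear R Y (P i) Y (\<lambda>y p. g i p b \<odot>\<^bsub>Y\<^esub> y)" for i b
      unfolding bilinear_def
      using gc module_hom_add[OF g(1)] module_hom_smult[OF g(1)]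
      by (auto intro!: module_homI simp: Y.smult_l_distr Y.smult_r_distr Y.smult_assoc1[symmetric] m_comm)
    have "\<forall>i b. \<exists>h. h \<in> module_hom R (?T i) Y \<and>
      (\<forall>y \<in> carrier Y. \<forall>p \<in> carrier (P i). h (?t i y p) = g i p b \<odot>\<^bsub>Y\<^esub> y)"
      using tensor_lift[OF Y modP Y psi_bil] by blast
    then obtain \<psi> where "\<forall>i b. \<psi> i b \<in> module_hom R (?T i) Y \<and>
      (\<forall>y \<in> carrier Y. \<forall>p \<in> carrier (P i). \<psi> i b (?t i y p) = g i p b \<odot>\<^bsub>Y\<^esub> y)"
      by metis
    then have \<psi>: "\<psi> i b \<in> module_hom R (?T i) Y"
      "\<And>y p. y \<in> carrier Y \<Longrightarrow> p \<in> carrier (P i) \<Longrightarrow> \<psi> i b (?t i y p) = g i p b \<odot>\<^bsub>Y\<^esub> y" for i b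
      by blast+
    \<comment> \<open>\<open>?v1\<close> is the bounding chain brought back along \<open>g\<close>;
      \<open>?v2\<close> applies the homotopy to \<open>u\<close> and corrects for the composite of
      \<open>f\<close> and \<open>g\<close> not being the identity.\<close>
    let ?v1 = "\<lambda>a. \<psi> (Suc ?m) a w"
    let ?v2 = "mat_act R Y (B ?m) (h ?m) u"
    have v1: "?v1 \<in> B (Suc ?m) \<rightarrow> carrier Y" using module_hom_closed[OF \<psi>(1) w(1)] by auto
    have v2: "?v2 \<in> B (Suc ?m) \<rightarrow> carrier Y" using mat_act_closed[OF Y h(1) u] by auto
    have idh: "(\<lambda>x. x) \<in> module_hom R (?F ?m) (?F ?m)" by (simp add: module_hom_def)
    have hd: "(\<lambda>x. h n (d n x)) \<in> module_hom R (?F ?m) (?F ?m)" by (rule module_hom_comp[OF d_hom h(1)])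
    have dh: "(\<lambda>x. d ?m (h ?m x)) \<in> module_hom R (?F ?m) (?F ?m)" by (rule module_hom_comp[OF h(1) d_hom])
    note sum2 = module_hom_sum[OF module_free_module idh hd]
    note sum3 = module_hom_sum[OF module_free_module sum2 dh]
    have "u b = mat_act R Y (B (Suc ?m)) (d ?m) (\<lambda>a. ?v1 a \<ominus>\<^bsub>Y\<^esub> ?v2 a) b" if b: "b \<in> B ?m" for b
    proof -
      let ?A = "mat_act R Y (B (Suc ?m)) (d ?m)" and ?U = "mat_act R Y (B ?m)"
      \<comment> \<open>The maps \<open>\<psi>\<close> commute with the differentials. Both sides
        are linear in \<open>w\<close>, so pure tensors suffice.\<close>
      have "\<psi> ?m b (?D ?m w) = ?A ?v1 b"
      proof (rule tensor_hom_eqI[OF Y modP Y module_hom_comp[OF Dhom \<psi>(1)] _ _ w(1)])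
        show "(\<lambda>w. ?A (\<lambda>a. \<psi> (Suc ?m) a w) b) \<in> module_hom R (?T (Suc ?m)) Y"
          by (rule mat_act_of_homs[OF T Y fin d_hom \<psi>(1)])
        fix y p assume y: "y \<in> carrier Y" and p: "p \<in> carrier (P (Suc ?m))"
        have "\<psi> ?m b (?D ?m (?t (Suc ?m) y p)) = d ?m (g (Suc ?m) p) b \<odot>\<^bsub>Y\<^esub> y"
          using Dt[OF y p] \<psi>(2)[OF y] module_hom_closed[OF dP p] g(2)[OF p] by simp
        also have "\<dots> = (\<Oplus>a\<in>B (Suc ?m). g (Suc ?m) p a \<otimes> d ?m (?e a) b) \<odot>\<^bsub>Y\<^esub> y"
          using free_hom_coord[OF fin d_hom gc(1)[OF p]] by simp
        also have "\<dots> = (\<Oplus>\<^bsub>Y\<^esub>a\<in>B (Suc ?m). (g (Suc ?m) p a \<otimes> d ?m (?e a) b) \<odot>\<^bsub>Y\<^esub> y)"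
          by (rule Y.finsum_smult_rdistr[OF fin _ y])
            (use gc(2)[OF p] free_gen_hom_closed(2)[OF d_hom[of ?m]] in auto)
        also have "\<dots> = ?A (\<lambda>a. \<psi> (Suc ?m) a (?t (Suc ?m) y p)) b"
          unfolding mat_act_def
          by (rule Y.M.finsum_cong')
            (use \<psi>(2)[OF y p] y gc(2)[OF p] free_gen_hom_closed(2)[OF d_hom[of ?m]]
              in \<open>auto simp: Y.smult_assoc1[symmetric] m_comm\<close>)
        finally show "\<psi> ?m b (?D ?m (?t (Suc ?m) y p)) = ?A (\<lambda>a. \<psi> (Suc ?m) a (?t (Suc ?m) y p)) b" .
      qed
      then have "?A ?v1 b = \<psi> ?m b z" using w(2) by simp
      also have "\<dots> = (\<Oplus>\<^bsub>Y\<^esub>a\<in>B ?m. \<psi> ?m b (?t ?m (u a) (f ?m (?e a))))"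
        unfolding z_def by (rule module_hom_finsum[OF T Y \<psi>(1) fin]) (use tc uc fe in auto)
      also have "\<dots> = ?U (\<lambda>x. g ?m (f ?m x)) u b"
        unfolding mat_act_def
        by (rule Y.M.finsum_cong') (use \<psi>(2) uc fe gc(2) in auto)
      \<comment> \<open>The composite is rewritten by the homotopy as a sum of three linear maps:
        the identity reproduces \<open>u\<close>, the part through \<open>d n\<close> dies because
        \<open>u\<close> is a cycle, and the part through \<open>d ?m\<close> is a boundary.\<close>
      also have "\<dots> = ?U (\<lambda>x. (x \<oplus>\<^bsub>?F ?m\<^esub> h n (d n x)) \<oplus>\<^bsub>?F ?m\<^esub> d ?m (h ?m x)) u b"
      proof (rule mat_act_cong[OF Y sum3 u])
        fix a assume a: "a \<in> B ?m"
        interpret Fm: module R "?F ?m" by (rule module_free_module)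
        have c: "?e a \<in> carrier (?F ?m)" "g ?m (f ?m (?e a)) \<in> carrier (?F ?m)"
          "h n (d n (?e a)) \<in> carrier (?F ?m)"
          using a gc fe module_hom_closed[OF h(1)] dc by auto
        have "(?e a \<oplus>\<^bsub>?F ?m\<^esub> h n (d n (?e a))) \<oplus>\<^bsub>?F ?m\<^esub> d ?m (h ?m (?e a)) = g ?m (f ?m (?e a))"
          unfolding h(2)[OF c(1)] using c by (rule Fm.M.regroup_difference)
        then show "((?e a \<oplus>\<^bsub>?F ?m\<^esub> h n (d n (?e a))) \<oplus>\<^bsub>?F ?m\<^esub> d ?m (h ?m (?e a))) b = g ?m (f ?m (?e a)) b"
          by metis
      qed simp
      also have "\<dots> = (?U (\<lambda>x. x) u b \<oplus>\<^bsub>Y\<^esub> ?U (\<lambda>x. h n (d n x)) u b) \<oplus>\<^bsub>Y\<^esub> ?U (\<lambda>x. d ?m (h ?m x)) u b"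
        using mat_act_add[OF Y sum2 dh u] mat_act_add[OF Y idh hd u] by simp
      also have "?U (\<lambda>x. x) u b = u b" by (rule mat_act_id[OF Y fin u b])
      also have "?U (\<lambda>x. h n (d n x)) u b = mat_act R Y (B n) (h n) (?U (d n) u) b"
        by (rule mat_act_comp[OF Y fin fin d_hom h(1) u])
      also have "\<dots> = \<zero>\<^bsub>Y\<^esub>" by (rule mat_act_zero[OF Y h(1) cyc])
      also have "?U (\<lambda>x. d ?m (h ?m x)) u b = ?A ?v2 b"
        by (rule mat_act_comp[OF Y fin fin h(1) d_hom u])
      finally have "?A ?v1 b = u b \<oplus>\<^bsub>Y\<^esub> ?A ?v2 b" using uc[OF b] by simp
      moreover have "?A ?v2 b \<in> carrier Y" by (rule mat_act_closed[OF Y d_hom v2])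
      ultimately have "u b = ?A ?v1 b \<ominus>\<^bsub>Y\<^esub> ?A ?v2 b"
        using uc[OF b] by (simp add: a_minus_def Y.M.a_assoc Y.M.r_neg)
      then show ?thesis using mat_act_diff[OF Y fin d_hom v1 v2] by simp
    qed
    then show ?thesis using v1 v2
      by (intro bexI[of _ "\<lambda>a. ?v1 a \<ominus>\<^bsub>Y\<^esub> ?v2 a"]) auto
  qed
  then show ?thesis unfolding mat_exact_def by blast
qed

section \<open>Minimal resolutions\<close>

lemma (in cring) ideal_closedI:
  assumes "I \<subseteq> carrier R" "\<zero> \<in> I" "\<And>x y. x \<in> I \<Longrightarrow> y \<in> I \<Longrightarrow> x \<oplus> y \<in> I"
    "\<And>r x. r \<in> carrier R \<Longrightarrow> x \<in> I \<Longrightarrow> r \<otimes> x \<in> I"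
  shows "ideal I R"
proof (rule idealI)
  show "subgroup I (add_monoid R)"
  proof (rule group.subgroupI)
    show "group (add_monoid R)" by (rule a_group)
    fix x assume x: "x \<in> I"
    then have "(\<ominus> \<one>) \<otimes> x \<in> I" using assms by simp
    then show "inv\<^bsub>add_monoid R\<^esub> x \<in> I"
      using x assms(1) by (auto simp: a_inv_def[symmetric] l_minus)
  qed (use assms in auto)
  show "x \<otimes> r \<in> I" if "x \<in> I" "r \<in> carrier R" for x r
    using that assms(1) assms(4)[of r x] by (simp add: m_comm subset_iff)
qed (use assms in \<open>auto intro: ring_axioms\<close>)

lemma (in cring) submodule_coord_ideal:
  assumes "submodule K R (free_module R B)"
  shows "ideal ((\<lambda>u. u b) ` K) R"
proof -
  interpret F: module R "free_module R B" by (rule module_free_module)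
  note K = F.submoduleD[OF assms]
  show ?thesis
  proof (rule ideal_closedI)
    show "(\<lambda>u. u b) ` K \<subseteq> carrier R" using K(1) free_module_closed[of _ R B b] by blast
    show "\<zero> \<in> (\<lambda>u. u b) ` K" using K(2) by force
    show "x \<oplus> y \<in> (\<lambda>u. u b) ` K" if xy: "x \<in> (\<lambda>u. u b) ` K" "y \<in> (\<lambda>u. u b) ` K" for x y
    proof -
      from xy obtain u v where "u \<in> K" "v \<in> K" "x = u b" "y = v b" by blast
      then show ?thesis using K(4)[of u v] by force
    qed
    show "r \<otimes> x \<in> (\<lambda>u. u b) ` K" if "r \<in> carrier R" "x \<in> (\<lambda>u. u b) ` K" for r x
    proof -
      from that obtain u where "u \<in> K" "x = u b" by blast
      then show ?thesis
        using K(6)[of r u] that(1) by (intro image_eqI[of _ _ "r \<odot>\<^bsub>free_module R B\<^esub> u"]) auto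
    qed
  qed
qed

text \<open>Induction on a set \<open>C\<close> of coordinates outside which \<open>K\<close>
  vanishes. The values of \<open>K\<close> at one coordinate form an ideal, finitely generated
  because R is Noetherian, and the elements vanishing there have one coordinate fewer.\<close>

lemma submodule_free_module_finitely_generated:
  assumes "cring R" "noetherian_ring R" "finite B" "submodule K R (free_module R B)"
  shows "\<exists>A \<subseteq> K. finite A \<and> module_span R (free_module R B) A = K"
proof -
  interpret cring R by fact
  interpret noetherian_ring R by fact
  let ?F = "free_module R B"
  interpret F: module R ?F by (rule module_free_module)
  have "\<exists>A \<subseteq> K. finite A \<and> module_span R ?F A = K"
    if "C \<subseteq> B" "submodule K R ?F" "\<And>u x. u \<in> K \<Longrightarrow> x \<notin> C \<Longrightarrow> u x = \<zero>\<^bsub>R\<^esub>" for C K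
    using finite_subset[OF that(1) assms(3)] that
  proof (induct C arbitrary: K)
    case empty
    then have "K = {\<zero>\<^bsub>?F\<^esub>}" using F.submoduleD[OF empty(2)] by (auto simp: fun_eq_iff)
    moreover have "module_span R ?F {} \<subseteq> K" by (rule span_minimal[OF empty(2)]) simp
    moreover have "\<zero>\<^bsub>?F\<^esub> \<in> module_span R ?F {}"
      using F.submoduleD(2)[OF span_submodule[OF F.module_axioms]] by blast
    ultimately show ?case by (intro exI[of _ "{}"]) auto
  next
    case (insert b C)
    note K = F.submoduleD[OF insert(5)]
    let ?ev = "\<lambda>u. u b"
    obtain A0 where A0: "A0 \<subseteq> carrier R" "finite A0" "?ev ` K = Idl\<^bsub>R\<^esub> A0"
      using finetely_gen[OF submodule_coord_ideal[OF insert(5), of b]] by metis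
    then have "A0 \<subseteq> ?ev ` K" using genideal_self by blast
    then obtain A1 where A1: "A1 \<subseteq> K" "finite A1" "?ev ` A1 = A0"
      using A0(2) by (metis finite_subset_image)
    \<comment> \<open>The kernel of evaluation at \<open>b\<close>; it vanishes outside the smaller
      set \<open>C\<close>, so the induction hypothesis covers it.\<close>
    let ?K' = "{u \<in> K. u b = \<zero>\<^bsub>R\<^esub>}"
    have K': "submodule ?K' R ?F"
    proof (rule F.submoduleI)
      fix u assume u: "u \<in> ?K'"
      then have "u \<in> carrier ?F" using K(1) by blast
      then have "\<ominus>\<^bsub>?F\<^esub> u = (\<ominus>\<^bsub>R\<^esub> \<one>\<^bsub>R\<^esub>) \<odot>\<^bsub>?F\<^esub> u"
        by (subst F.smult_l_minus) (auto simp del: free_module_simps)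
      then have "(\<ominus>\<^bsub>?F\<^esub> u) b = \<ominus>\<^bsub>R\<^esub> \<one>\<^bsub>R\<^esub> \<otimes>\<^bsub>R\<^esub> u b" by simp
      then show "\<ominus>\<^bsub>?F\<^esub> u \<in> ?K'" using u K(3) by simp
    qed (use K in auto)
    obtain A2 where A2: "A2 \<subseteq> ?K'" "finite A2" "module_span R ?F A2 = ?K'"
    proof -
      have "C \<subseteq> B" using insert(4) by blast
      moreover have "u x = \<zero>\<^bsub>R\<^esub>" if "u \<in> ?K'" "x \<notin> C" for u x
        using that insert(6)[of u x] by (cases "x = b") auto
      ultimately have "\<exists>A\<subseteq>?K'. finite A \<and> module_span R ?F A = ?K'"
        by (rule insert(3)[OF _ K'])
      then show ?thesis using that by (elim exE conjE)
    qed
    have A: "A1 \<union> A2 \<subseteq> K" using A1 A2 by blast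
    have S: "submodule (module_span R ?F (A1 \<union> A2)) R ?F"
      by (rule span_submodule[OF F.module_axioms]) (use A K(1) in blast)
    have A1S: "submodule (module_span R ?F A1) R ?F"
      by (rule span_submodule[OF F.module_axioms]) (use A1 K(1) in blast)
    have sup: "A1 \<union> A2 \<subseteq> module_span R ?F (A1 \<union> A2)" by (rule span_superset)
    have "K \<subseteq> module_span R ?F (A1 \<union> A2)"
    proof
      fix u assume u: "u \<in> K"
      have "A0 \<subseteq> ?ev ` module_span R ?F A1" 
        using image_mono[OF span_superset[of A1 R ?F], of ?ev] A1(3) by simp
      \<comment> \<open>The lifts \<open>A1\<close> of the generators of the coordinate ideal span
        an element \<open>w\<close> that agrees with \<open>u\<close> at \<open>b\<close>; the
        difference then lies in \<open>?K'\<close>.\<close>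
      then have "Idl\<^bsub>R\<^esub> A0 \<subseteq> ?ev ` module_span R ?F A1"
        by (rule genideal_minimal[OF submodule_coord_ideal[OF A1S]])
      then obtain w where w: "w \<in> module_span R ?F A1" "u b = w b" using A0(3) u by blast
      have wK: "w \<in> K" using w(1) span_minimal[OF insert(5) A1(1)] by blast
      have uw: "u \<in> carrier ?F" "w \<in> carrier ?F" using u wK K(1) by blast+
      then have "(u \<ominus>\<^bsub>?F\<^esub> w) b = u b \<ominus>\<^bsub>R\<^esub> w b" by (simp only: free_module_minus)
      also have "\<dots> = \<zero>\<^bsub>R\<^esub>"
        using w(2) r_right_minus_eq[of "w b" "w b"] free_module_closed[OF uw(2), of b] by simp
      finally have "(u \<ominus>\<^bsub>?F\<^esub> w) b = \<zero>\<^bsub>R\<^esub>" .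
      then have "u \<ominus>\<^bsub>?F\<^esub> w \<in> ?K'" using K(5)[OF u wK] by simp
      then have "u \<ominus>\<^bsub>?F\<^esub> w \<in> module_span R ?F (A1 \<union> A2)"
        using A2(3) span_minimal[OF S, of A2] sup by blast
      moreover have "w \<in> module_span R ?F (A1 \<union> A2)"
        using w(1) span_minimal[OF S, of A1] sup by blast
      ultimately have "(u \<ominus>\<^bsub>?F\<^esub> w) \<oplus>\<^bsub>?F\<^esub> w \<in> module_span R ?F (A1 \<union> A2)"
        using F.submoduleD(4)[OF S] by blast
      moreover have "(u \<ominus>\<^bsub>?F\<^esub> w) \<oplus>\<^bsub>?F\<^esub> w = u"
        using uw by (simp add: a_minus_def F.M.a_assoc F.M.l_neg del: free_module_simps)
      ultimately show "u \<in> module_span R ?F (A1 \<union> A2)" by simp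
    qed
    then show ?case
      using A A1(2) A2(2) span_minimal[OF insert(5) A] by (intro exI[of _ "A1 \<union> A2"]) auto
  qed
  from this[of B K] show ?thesis
    using assms(4) F.submoduleD(1)[OF assms(4)] by (auto simp: free_module_carrier subset_iff)
qed

text \<open>A relation with a unit coefficient at \<open>b\<close> can be solved for
  \<open>c b\<close>.\<close>

lemma (in cring) span_remove_generator:
  assumes N: "module R N" and c: "c \<in> B \<rightarrow> carrier N"
    and u: "u \<in> carrier (free_module R B)" "lincomb R N c u = \<zero>\<^bsub>N\<^esub>" "u b \<in> Units R" "b \<in> B"
  shows "module_span R N (c ` (B - {b})) = module_span R N (c ` B)"
proof
  interpret N: module R N by (rule N)
  let ?F = "free_module R B" and ?S = "module_span R N (c ` (B - {b}))"
  have hom: "lincomb R N c \<in> module_hom R ?F N" by (rule lincomb_hom[OF N c])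
  have S: "submodule ?S R N" by (rule span_submodule[OF N]) (use c in auto)
  show "?S \<subseteq> module_span R N (c ` B)"
    by (rule span_minimal[OF span_submodule[OF N]]) (use c span_superset[of "c ` B"] in blast)+
  have ub: "u b \<in> carrier R" "inv (u b) \<in> carrier R" "inv (u b) \<otimes> u b = \<one>"
    using u(3) by auto
  have cb: "c b \<in> carrier N" using c u(4) by auto
  let ?u' = "u(b := \<zero>)"
  have u': "?u' \<in> carrier (free_module R (B - {b}))"
    using free_module_decompose(1)[OF u(1,4)] u(1) by (simp add: free_module_carrier)
  have L: "lincomb R N c ?u' \<in> ?S"
    by (rule lincomb_mem_submodule[OF N S _ u']) (use span_superset[of "c ` (B - {b})"] in auto)
  have "\<zero>\<^bsub>N\<^esub> = lincomb R N c (?u' \<oplus>\<^bsub>?F\<^esub> (u b \<odot>\<^bsub>?F\<^esub> free_gen R b))"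
    using free_module_decompose(2)[OF u(1,4)] u(2) by metis
  also have "\<dots> = lincomb R N c ?u' \<oplus>\<^bsub>N\<^esub> lincomb R N c (u b \<odot>\<^bsub>?F\<^esub> free_gen R b)"
    by (rule module_hom_add[OF hom free_module_decompose(1)[OF u(1,4)]])
      (use u(4) ub in \<open>intro module.smult_closed[OF module_free_module] free_gen_closed\<close>)
  also have "lincomb R N c (u b \<odot>\<^bsub>?F\<^esub> free_gen R b) = u b \<odot>\<^bsub>N\<^esub> c b"
    using module_hom_smult[OF hom ub(1), of "free_gen R b"] u(4) lincomb_free_gen[OF N, of c b] cb by simp
  finally have eq: "\<zero>\<^bsub>N\<^esub> = lincomb R N c ?u' \<oplus>\<^bsub>N\<^esub> u b \<odot>\<^bsub>N\<^esub> c b" .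
  have Lc: "lincomb R N c ?u' \<in> carrier N" using L N.submoduleD(1)[OF S] by blast
  then have "u b \<odot>\<^bsub>N\<^esub> c b \<oplus>\<^bsub>N\<^esub> lincomb R N c ?u' = \<zero>\<^bsub>N\<^esub>"
    unfolding eq using cb ub by (intro N.M.a_comm) auto
  from N.M.minus_equality[OF this Lc]
  have "u b \<odot>\<^bsub>N\<^esub> c b = \<ominus>\<^bsub>N\<^esub> lincomb R N c ?u'" using cb ub by simp
  then have "inv (u b) \<odot>\<^bsub>N\<^esub> (u b \<odot>\<^bsub>N\<^esub> c b) \<in> ?S"
    using N.submoduleD(3,6)[OF S] L ub by simp
  then have "c b \<in> ?S" using ub cb by (simp add: N.smult_assoc1[symmetric])
  then have "c ` B \<subseteq> ?S" using span_superset[of "c ` (B - {b})"] by blast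
  then show "module_span R N (c ` B) \<subseteq> ?S" by (rule span_minimal[OF S])
qed

text \<open>Take the least possible number of generators inside \<open>G\<close>: a relation with a
  unit coefficient would allow one of them to be dropped. Dropping never leaves \<open>G\<close>, so
  a property such as homogeneity can be imposed from the start. An infinite index type has room for
  any finite number of generators.\<close>

lemma (in cring) minimal_presentation:
  fixes A :: "'n set"
  assumes N: "module R N" and A: "finite A" "A \<subseteq> carrier N" "A \<subseteq> G"
    and inf: "infinite (UNIV :: 'x set)"
    and m: "\<zero> \<in> m" "\<And>r. r \<in> carrier R \<Longrightarrow> r \<notin> m \<Longrightarrow> r \<in> Units R"
  shows "\<exists>(B :: 'x set) c. finite B \<and> c \<in> B \<rightarrow> G \<inter> carrier N \<and>
    lincomb R N c ` carrier (free_module R B) = module_span R N A \<and>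
    (\<forall>u \<in> carrier (free_module R B). lincomb R N c u = \<zero>\<^bsub>N\<^esub> \<longrightarrow> (\<forall>x. u x \<in> m))"
proof -
  let ?P = "\<lambda>n. \<exists>(B :: 'x set) c. finite B \<and> card B = n \<and> c \<in> B \<rightarrow> G \<inter> carrier N \<and>
    module_span R N (c ` B) = module_span R N A"
  obtain B :: "'x set" where B: "finite B" "card B = card A"
    using infinite_arbitrarily_large[OF inf, of "card A"] by auto
  then obtain c where "bij_betw c B A" using A(1) finite_same_card_bij by metis
  then have "c ` B = A" by (simp add: bij_betw_def)
  then have "?P (card A)" using B A by (intro exI[of _ B] exI[of _ c]) auto
  then have "?P (LEAST n. ?P n)" by (rule LeastI)
  then obtain B :: "'x set" and c where B: "finite B" "card B = (LEAST n. ?P n)"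
    "c \<in> B \<rightarrow> G \<inter> carrier N" "module_span R N (c ` B) = module_span R N A" by blast
  have cN: "c \<in> B \<rightarrow> carrier N" using B(3) by auto
  have "u x \<in> m" if u: "u \<in> carrier (free_module R B)" "lincomb R N c u = \<zero>\<^bsub>N\<^esub>" for u x
  proof (rule ccontr)
    assume x: "u x \<notin> m"
    then have xB: "x \<in> B" using u(1) m(1) by (auto simp: free_module_carrier)
    have "u x \<in> Units R" using x m(2) u(1) by auto
    then have "module_span R N (c ` (B - {x})) = module_span R N A"
      using span_remove_generator[OF N cN u _ xB] B(4) by simp
    then have "?P (card (B - {x}))"
      using B(1,3) by (intro exI[of _ "B - {x}"] exI[of _ c]) auto
    then have "(LEAST n. ?P n) \<le> card (B - {x})" by (rule Least_le)
    moreover have "card (B - {x}) < card B" using B(1) xB by (rule card_Diff1_less)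
    ultimately show False using B(2) by simp
  qed
  then show ?thesis
    using B lincomb_image_span[OF N cN] by (intro exI[of _ B] exI[of _ c]) auto
qed

section \<open>Rings whose non-units form the direct sum of two nonzero ideals\<close>

locale split_maximal_ideal = cring R + noetherian_ring R for R (structure) +
  fixes I J :: "'a set"
  assumes ideal_I: "ideal I R" and ideal_J: "ideal J R" and disjoint: "I \<inter> J = {\<zero>}"
    and units: "r \<in> carrier R \<Longrightarrow> r \<notin> I <+>\<^bsub>R\<^esub> J \<Longrightarrow> r \<in> Units R"
    and proper: "\<one> \<notin> I <+>\<^bsub>R\<^esub> J"
    and I_nonzero: "I \<noteq> {\<zero>}" and J_nonzero: "J \<noteq> {\<zero>}"
begin

interpretation I: ideal I R by (rule ideal_I)
interpretation J: ideal J R by (rule ideal_J)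

text \<open>The ideals enter the locale symmetrically, so what is proved about columns over
  \<open>I\<close> is available for columns over \<open>J\<close>. A hypothesis such as
  \<open>J\<close> killing \<open>Y\<close> is kept out of the locale, as it would break the
  symmetry.\<close>

lemma swap: "split_maximal_ideal R J I"
proof -
  have "J <+>\<^bsub>R\<^esub> I = I <+>\<^bsub>R\<^esub> J"
  proof -
    have "j \<oplus> i = i \<oplus> j" if "i \<in> I" "j \<in> J" for i j
      using that I.a_Hcarr J.a_Hcarr by (intro a_comm) auto
    then show ?thesis unfolding set_add_def' by (intro equalityI subsetI) fastforce+
  qed
  then show ?thesis
    by unfold_locales (use ideal_I ideal_J disjoint units proper I_nonzero J_nonzero in auto)
qed

lemma sum_ideal: "ideal (I <+>\<^bsub>R\<^esub> J) R"
  by (rule add_ideals[OF ideal_I ideal_J])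

lemma sumE:
  assumes "r \<in> I <+>\<^bsub>R\<^esub> J"
  obtains i j where "i \<in> I" "j \<in> J" "r = i \<oplus> j"
  using assms by (auto simp: set_add_def')

lemma zero_in_sum: "\<zero> \<in> I <+>\<^bsub>R\<^esub> J"
  using ideal.axioms(1)[OF sum_ideal] additive_subgroup.zero_closed by blast

lemma mult_IJ: "i \<in> I \<Longrightarrow> j \<in> J \<Longrightarrow> i \<otimes> j = \<zero>"
  using disjoint I.I_r_closed[of i j] J.I_l_closed[of j i] I.a_Hcarr J.a_Hcarr by blast

lemma free_hom_coord_ideal:
  assumes "ideal L R" "finite A" "\<phi> \<in> module_hom R (free_module R A) (free_module R B)"
    "u \<in> carrier (free_module R A)" "\<And>a. a \<in> A \<Longrightarrow> u a \<otimes> \<phi> (free_gen R a) x \<in> L"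
  shows "\<phi> u x \<in> L"
proof -
  interpret L: ideal L R by fact
  have "(\<Oplus>a\<in>A. u a \<otimes> \<phi> (free_gen R a) x) \<in> L"
    using assms(2,5)
  proof (induct A)
    case (insert a A)
    then show ?case by (subst finsum_insert) (auto simp: L.a_Hcarr)
  qed simp
  then show ?thesis using free_hom_coord[OF assms(2-4)] by simp
qed

definition homogeneous :: "('x \<Rightarrow> 'a) \<Rightarrow> bool"
  where "homogeneous u \<longleftrightarrow> (\<forall>x. u x \<in> I) \<or> (\<forall>x. u x \<in> J)"

definition splits :: "('x \<Rightarrow> 'a) set \<Rightarrow> bool"
  where "splits K \<longleftrightarrow> (\<forall>u \<in> K. \<exists>v \<in> K. \<exists>w \<in> K. u = (\<lambda>x. v x \<oplus> w x) \<and> (\<forall>x. v x \<in> I) \<and> (\<forall>x. w x \<in> J))"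

lemma split_vector:
  assumes "finite B" "u \<in> carrier (free_module R B)" "\<And>x. u x \<in> I <+>\<^bsub>R\<^esub> J"
  obtains v w where "v \<in> carrier (free_module R B)" "w \<in> carrier (free_module R B)"
    "u = (\<lambda>x. v x \<oplus> w x)" "\<And>x. v x \<in> I" "\<And>x. w x \<in> J"
proof -
  \<comment> \<open>Outside \<open>B\<close> the pair is prescribed to be zero, so that both parts
    are again vectors of the free module on \<open>B\<close>.\<close>
  have "\<exists>p. fst p \<in> I \<and> snd p \<in> J \<and> u x = fst p \<oplus> snd p \<and> (x \<notin> B \<longrightarrow> p = (\<zero>, \<zero>))" for x
  proof (cases "x \<in> B")
    case True
    then show ?thesis using sumE[OF assms(3)[of x]] by (metis fst_conv snd_conv)
  next
    case False
    then show ?thesis using assms(2) by (intro exI[of _ "(\<zero>, \<zero>)"]) (auto simp: free_module_carrier)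
  qed
  then obtain p where p: "\<And>x. fst (p x) \<in> I \<and> snd (p x) \<in> J \<and> u x = fst (p x) \<oplus> snd (p x) \<and>
    (x \<notin> B \<longrightarrow> p x = (\<zero>, \<zero>))" by metis
  show thesis
    by (rule that[of "\<lambda>x. fst (p x)" "\<lambda>x. snd (p x)"])
      (use p I.a_Hcarr J.a_Hcarr in \<open>auto simp: free_module_carrier_finite[OF assms(1)]\<close>)
qed

text \<open>A linear map sends vectors over \<open>I\<close> to vectors over \<open>I\<close>, and likewise for \<open>J\<close>. So the two
  parts of a vector in the kernel have images that add up to \<open>0\<close> and hence vanish.\<close>

lemma kernel_splits:
  assumes fin: "finite A" and f: "\<phi> \<in> module_hom R (free_module R A) (free_module R B)"
    and ker: "\<And>u x. u \<in> carrier (free_module R A) \<Longrightarrow> \<phi> u = \<zero>\<^bsub>free_module R B\<^esub> \<Longrightarrow> u x \<in> I <+>\<^bsub>R\<^esub> J"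
  shows "splits {u \<in> carrier (free_module R A). \<phi> u = \<zero>\<^bsub>free_module R B\<^esub>}"
  unfolding splits_def
proof
  fix u assume "u \<in> {u \<in> carrier (free_module R A). \<phi> u = \<zero>\<^bsub>free_module R B\<^esub>}"
  then have u: "u \<in> carrier (free_module R A)" "\<phi> u = \<zero>\<^bsub>free_module R B\<^esub>" by auto
  obtain v w where vw: "v \<in> carrier (free_module R A)" "w \<in> carrier (free_module R A)"
    "u = (\<lambda>x. v x \<oplus> w x)" "\<And>x. v x \<in> I" "\<And>x. w x \<in> J"
    using split_vector[OF fin u(1) ker[OF u]] by blast
  have v: "\<phi> v x \<in> I" for x
    by (rule free_hom_coord_ideal[OF ideal_I fin f vw(1)])
      (use vw(4) free_gen_hom_closed[OF f] I.I_r_closed in auto)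
  have w: "\<phi> w x \<in> J" for x
    by (rule free_hom_coord_ideal[OF ideal_J fin f vw(2)])
      (use vw(5) free_gen_hom_closed[OF f] J.I_r_closed in auto)
  have "\<phi> u = (\<lambda>x. \<phi> v x \<oplus> \<phi> w x)"
    using module_hom_add[OF f vw(1,2)] vw(3) by simp
  then have sum: "\<phi> v x \<oplus> \<phi> w x = \<zero>" for x using u(2) by (metis free_module_simps(1))
  have "\<phi> v x = \<zero> \<and> \<phi> w x = \<zero>" for x
  proof -
    have c: "\<phi> v x \<in> carrier R" "\<phi> w x \<in> carrier R" using v w I.a_Hcarr J.a_Hcarr by auto
    then have "\<phi> v x = \<ominus> \<phi> w x" using sum[of x] by (metis minus_equality)
    then have "\<phi> v x \<in> I \<inter> J" using v[of x] w[of x] J.a_inv_closed by simp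
    then have "\<phi> v x = \<zero>" using disjoint by blast
    then show ?thesis using sum[of x] c by simp
  qed
  then have "\<phi> v = \<zero>\<^bsub>free_module R B\<^esub>" "\<phi> w = \<zero>\<^bsub>free_module R B\<^esub>" by (auto simp: fun_eq_iff)
  then show "\<exists>v\<in>{u \<in> carrier (free_module R A). \<phi> u = \<zero>\<^bsub>free_module R B\<^esub>}.
    \<exists>w\<in>{u \<in> carrier (free_module R A). \<phi> u = \<zero>\<^bsub>free_module R B\<^esub>}.
      u = (\<lambda>x. v x \<oplus> w x) \<and> (\<forall>x. v x \<in> I) \<and> (\<forall>x. w x \<in> J)"
    using vw by blast
qed

text \<open>If \<open>K\<close> splits, the parts of finitely many generators generate it as well,
  and a minimal family can be sought among homogeneous vectors. Otherwise \<open>?G\<close> imposes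
  nothing; this case admits the first syzygy of \<open>M\<close>, where no splitting is
  available.\<close>

lemma minimal_cover_exists:
  fixes B :: "'x set"
  assumes inf: "infinite (UNIV :: 'x set)" and fin: "finite B" and K: "submodule K R (free_module R B)"
  shows "\<exists>(B' :: 'x set) d. finite B' \<and> d \<in> module_hom R (free_module R B') (free_module R B) \<and>
    d ` carrier (free_module R B') = K \<and>
    (\<forall>u \<in> carrier (free_module R B'). d u = \<zero>\<^bsub>free_module R B\<^esub> \<longrightarrow> (\<forall>x. u x \<in> I <+>\<^bsub>R\<^esub> J)) \<and>
    (splits K \<longrightarrow> (\<forall>b \<in> B'. homogeneous (d (free_gen R b))))"
proof -
  let ?F = "free_module R B"
  interpret F: module R ?F by (rule module_free_module)
  let ?G = "if splits K then {u. homogeneous u} else UNIV"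
  obtain A where A: "A \<subseteq> K" "finite A" "module_span R ?F A = K"
    using submodule_free_module_finitely_generated[OF is_cring noetherian_ring_axioms fin K] by blast
  have "\<exists>A' \<subseteq> K. finite A' \<and> module_span R ?F A' = K \<and> A' \<subseteq> ?G"
  proof (cases "splits K")
    case True
    then obtain p q where pq: "\<And>u. u \<in> K \<Longrightarrow> p u \<in> K \<and> q u \<in> K \<and> u = (\<lambda>x. p u x \<oplus> q u x) \<and>
      (\<forall>x. p u x \<in> I) \<and> (\<forall>x. q u x \<in> J)"
      unfolding splits_def by metis
    let ?A' = "p ` A \<union> q ` A"
    have A': "?A' \<subseteq> K" using pq A(1) by blast
    have S: "submodule (module_span R ?F ?A') R ?F"
      by (rule span_submodule[OF F.module_axioms]) (use A' F.submoduleD(1)[OF K] in blast)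
    \<comment> \<open>Each generator is the sum of its two parts, so nothing is lost by passing from
      \<open>A\<close> to the parts.\<close>
    have "A \<subseteq> module_span R ?F ?A'"
    proof
      fix u assume u: "u \<in> A"
      then have "p u \<oplus>\<^bsub>?F\<^esub> q u \<in> module_span R ?F ?A'"
        using F.submoduleD(4)[OF S] span_superset[of ?A' R ?F] by blast
      moreover have "p u \<oplus>\<^bsub>?F\<^esub> q u = u" using pq[of u] u A(1) by auto
      ultimately show "u \<in> module_span R ?F ?A'" by simp
    qed
    then have "K \<subseteq> module_span R ?F ?A'" using span_minimal[OF S] A(3) by blast
    moreover have "module_span R ?F ?A' \<subseteq> K" by (rule span_minimal[OF K A'])
    moreover have "?A' \<subseteq> ?G" using True pq A(1) by (auto simp: homogeneous_def)
    ultimately show ?thesis using A' A(2) by (intro exI[of _ ?A']) auto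
  qed (use A in auto)
  then obtain A' where A': "A' \<subseteq> K" "finite A'" "module_span R ?F A' = K" "A' \<subseteq> ?G" by blast
  have A'F: "A' \<subseteq> carrier ?F" using A'(1) F.submoduleD(1)[OF K] by blast
  obtain B' :: "'x set" and c where B': "finite B'" "c \<in> B' \<rightarrow> ?G \<inter> carrier ?F"
    "lincomb R ?F c ` carrier (free_module R B') = module_span R ?F A'"
    "\<forall>u \<in> carrier (free_module R B'). lincomb R ?F c u = \<zero>\<^bsub>?F\<^esub> \<longrightarrow> (\<forall>x. u x \<in> I <+>\<^bsub>R\<^esub> J)"
    using minimal_presentation[OF F.module_axioms A'(2) A'F A'(4) inf zero_in_sum units] by blast
  have c: "c b \<in> carrier ?F" "c b \<in> ?G" if "b \<in> B'" for b using B'(2) that by blast+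
  have "homogeneous (lincomb R ?F c (free_gen R b))" if "splits K" "b \<in> B'" for b
    using lincomb_free_gen[OF F.module_axioms, of c b] c[OF that(2)] that(1) by simp
  then show ?thesis
    using B' A'(3) lincomb_hom[OF F.module_axioms, of c B'] by (intro exI[of _ B'] exI[of _ "lincomb R ?F c"]) auto
qed

text \<open>The state \<open>(B, K, d)\<close> at stage \<open>n\<close> consists of a basis in
  degree \<open>n\<close>, the kernel of the map leaving that degree, and that map. Splitting of
  \<open>K\<close> belongs to the invariant from stage 1 on, since at stage 0 the map goes to
  \<open>M\<close> and not to a free module.\<close>

theorem minimal_resolution_exists:
  fixes M :: "('a, 'm) module"
  assumes M: "module R M" "finitely_generated R M" and inf: "infinite (UNIV :: 'x set)"
  shows "\<exists>(B :: nat \<Rightarrow> 'x set) d K \<epsilon>. exact_complex R (\<lambda>i. free_module R (B i)) d K \<and>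
    (\<forall>i. finite (B i)) \<and> \<epsilon> \<in> module_hom R (free_module R (B 0)) M \<and>
    \<epsilon> ` carrier (free_module R (B 0)) = carrier M \<and>
    K 0 = {u \<in> carrier (free_module R (B 0)). \<epsilon> u = \<zero>\<^bsub>M\<^esub>} \<and>
    (\<forall>i. \<forall>u \<in> K i. \<forall>x. u x \<in> I <+>\<^bsub>R\<^esub> J) \<and>
    (\<forall>i. \<forall>b \<in> B (Suc (Suc i)). homogeneous (d (Suc i) (free_gen R b)))"
proof -
  obtain A where A: "finite A" "A \<subseteq> carrier M" "module_span R M A = carrier M"
    using M(2) by (auto simp: finitely_generated_def)
  obtain B0 :: "'x set" and c where B0: "finite B0" "c \<in> B0 \<rightarrow> UNIV \<inter> carrier M"
    "lincomb R M c ` carrier (free_module R B0) = module_span R M A"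
    "\<forall>u \<in> carrier (free_module R B0). lincomb R M c u = \<zero>\<^bsub>M\<^esub> \<longrightarrow> (\<forall>x. u x \<in> I <+>\<^bsub>R\<^esub> J)"
    using minimal_presentation[OF M(1) A(1,2) subset_UNIV inf zero_in_sum units] by blast
  let ?\<epsilon> = "lincomb R M c"
  have \<epsilon>: "?\<epsilon> \<in> module_hom R (free_module R B0) M" by (rule lincomb_hom[OF M(1)]) (use B0(2) in auto)
  let ?K0 = "{u \<in> carrier (free_module R B0). ?\<epsilon> u = \<zero>\<^bsub>M\<^esub>}"
  let ?P = "\<lambda>n :: nat. \<lambda>(B :: 'x set, K, d :: ('x \<Rightarrow> 'a) \<Rightarrow> 'x \<Rightarrow> 'a). finite B \<and> submodule K R (free_module R B) \<and>
    (\<forall>u\<in>K. \<forall>x. u x \<in> I <+>\<^bsub>R\<^esub> J) \<and> (n = 0 \<longrightarrow> B = B0 \<and> K = ?K0) \<and> (n \<noteq> 0 \<longrightarrow> splits K)"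
  let ?Q = "\<lambda>n :: nat. \<lambda>(B, K, d) (B', K', d'). d' \<in> module_hom R (free_module R B') (free_module R B) \<and>
    d' ` carrier (free_module R B') = K \<and>
    K' = {u \<in> carrier (free_module R B'). d' u = \<zero>\<^bsub>free_module R B\<^esub>} \<and>
    (n \<noteq> 0 \<longrightarrow> (\<forall>b\<in>B'. homogeneous (d' (free_gen R b))))"
  have "\<exists>s. \<forall>n. ?P n (s n) \<and> ?Q n (s n) (s (Suc n))"
  proof (rule dependent_nat_choice)
    \<comment> \<open>The map leaving degree 0 is the augmentation, whose codomain has another type;
      the third component of the initial state is therefore a dummy.\<close>
    have "?P 0 (B0, ?K0, \<lambda>_ _. \<zero>)"
      using B0 module_hom_kernel_submodule[OF module_free_module M(1) \<epsilon>] by auto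
    then show "\<exists>s. ?P 0 s" by blast
  next
    fix s n assume s: "?P n s"
    obtain B K d where sd: "s = (B, K, d)" by (cases s)
    then have P: "finite B" "submodule K R (free_module R B)" "n \<noteq> 0 \<Longrightarrow> splits K" using s by auto
    obtain B' :: "'x set" and d' where B': "finite B'"
      "d' \<in> module_hom R (free_module R B') (free_module R B)"
      "d' ` carrier (free_module R B') = K"
      "\<forall>u \<in> carrier (free_module R B'). d' u = \<zero>\<^bsub>free_module R B\<^esub> \<longrightarrow> (\<forall>x. u x \<in> I <+>\<^bsub>R\<^esub> J)"
      "splits K \<longrightarrow> (\<forall>b \<in> B'. homogeneous (d' (free_gen R b)))"
      using minimal_cover_exists[OF inf P(1,2)] by blast
    let ?K' = "{u \<in> carrier (free_module R B'). d' u = \<zero>\<^bsub>free_module R B\<^esub>}"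
    have "submodule ?K' R (free_module R B')"
      by (rule module_hom_kernel_submodule[OF module_free_module module_free_module B'(2)])
    \<comment> \<open>The kernel of a map between free modules splits whether or not
      \<open>K\<close> does; minimality of the cover supplies the entries in the maximal ideal that
      \<open>kernel_splits\<close> asks for.\<close>
    moreover have "splits ?K'" by (rule kernel_splits[OF B'(1,2)]) (use B'(4) in blast)
    ultimately have "?P (Suc n) (B', ?K', d') \<and> ?Q n s (B', ?K', d')"
      unfolding sd using B' P(3) by auto
    then show "\<exists>s'. ?P (Suc n) s' \<and> ?Q n s s'" by blast
  qed
  then obtain s where s0: "\<forall>n. ?P n (s n) \<and> ?Q n (s n) (s (Suc n))" by (rule exE)
  have s: "?P n (s n)" "?Q n (s n) (s (Suc n))" for n
    by (rule conjunct1[OF spec[OF s0]], rule conjunct2[OF spec[OF s0]])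
  define B where "B i = fst (s i)" for i
  define K where "K i = fst (snd (s i))" for i
  \<comment> \<open>\<open>d i\<close> leaves degree \<open>Suc i\<close>, so it is stored in the
    state of stage \<open>Suc i\<close>.\<close>
  define d where "d i = snd (snd (s (Suc i)))" for i
  have s': "s i = (B i, K i, snd (snd (s i)))" "s (Suc i) = (B (Suc i), K (Suc i), d i)" for i
    by (simp_all add: B_def K_def d_def)
  have P: "finite (B i)" "\<And>u x. u \<in> K i \<Longrightarrow> u x \<in> I <+>\<^bsub>R\<^esub> J" "i = 0 \<Longrightarrow> B i = B0 \<and> K i = ?K0" for i
    using s(1)[of i] by (subst (asm) s'(1), auto)+
  have Q: "d i \<in> module_hom R (free_module R (B (Suc i))) (free_module R (B i))"
    "d i ` carrier (free_module R (B (Suc i))) = K i"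
    "K (Suc i) = {u \<in> carrier (free_module R (B (Suc i))). d i u = \<zero>\<^bsub>free_module R (B i)\<^esub>}"
    "i \<noteq> 0 \<Longrightarrow> \<forall>b\<in>B (Suc i). homogeneous (d i (free_gen R b))" for i
    using s(2)[of i] unfolding s'(2)[of i] by (subst (asm) s'(1)[of i], auto)+
  have "exact_complex R (\<lambda>i. free_module R (B i)) d K"
    unfolding exact_complex_def using Q(1-3) module_free_module by blast
  moreover have "\<forall>i. \<forall>b \<in> B (Suc (Suc i)). homogeneous (d (Suc i) (free_gen R b))"
    using Q(4) by blast
  ultimately show ?thesis
    using P \<epsilon> B0(3) A(3)
    by (intro exI[of _ B] exI[of _ d] exI[of _ K] exI[of _ ?\<epsilon>]) auto
qed

end

section \<open>Vanishing homology over a ring with decomposable maximal ideal\<close>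

text \<open>On tuples of vectors the matrix acts separately in each coordinate \<open>c\<close>. The
  tuple of \<open>c\<close>-coordinates, made zero outside \<open>A\<close>, is a vector to which
  \<open>\<phi>\<close> itself applies.\<close>

lemma (in cring) mat_act_coord:
  assumes "finite A" "\<phi> \<in> module_hom R (free_module R A) (free_module R B)"
    "u \<in> A \<rightarrow> carrier (free_module R C)"
  shows "mat_act R (free_module R C) A \<phi> u b c = \<phi> (\<lambda>a. if a \<in> A then u a c else \<zero>) b"
    and "(\<lambda>a. if a \<in> A then u a c else \<zero>) \<in> carrier (free_module R A)"
proof -
  interpret F: module R "free_module R C" by (rule module_free_module)
  have u: "u a c \<in> carrier R" if "a \<in> A" for a
    using assms(3) that free_module_closed[of "u a" R C c] by (auto simp: Pi_iff)
  then show uA: "(\<lambda>a. if a \<in> A then u a c else \<zero>) \<in> carrier (free_module R A)"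
    by (simp add: free_module_carrier_finite[OF assms(1)])
  note fc = free_gen_hom_closed(2)[OF assms(2)]
  have "mat_act R (free_module R C) A \<phi> u b c =
    (\<Oplus>a\<in>A. (\<phi> (free_gen R a) b \<odot>\<^bsub>free_module R C\<^esub> u a) c)"
    unfolding mat_act_def
    by (rule free_module_finsum[OF assms(1)]) (use assms(3) fc in \<open>auto intro!: F.smult_closed simp del: free_module_simps\<close>)
  also have "\<dots> = (\<Oplus>a\<in>A. (if a \<in> A then u a c else \<zero>) \<otimes> \<phi> (free_gen R a) b)"
    by (rule finsum_cong') (use u fc in \<open>auto simp: m_comm\<close>)
  also have "\<dots> = \<phi> (\<lambda>a. if a \<in> A then u a c else \<zero>) b"
    by (rule free_hom_coord[OF assms(1,2) uA, symmetric])
  finally show "mat_act R (free_module R C) A \<phi> u b c = \<phi> (\<lambda>a. if a \<in> A then u a c else \<zero>) b" .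
qed

lemma (in cring) mat_act_single:
  assumes Y: "module R Y" and fin: "finite A"
    and f: "\<phi> \<in> module_hom R (free_module R A) (free_module R B)" and a: "a \<in> A" and y: "y \<in> carrier Y"
  shows "mat_act R Y A \<phi> (\<lambda>x. if x = a then y else \<zero>\<^bsub>Y\<^esub>) b = \<phi> (free_gen R a) b \<odot>\<^bsub>Y\<^esub> y"
proof -
  interpret Y: module R Y by (rule Y)
  note fc = free_gen_hom_closed(2)[OF f]
  have "mat_act R Y A \<phi> (\<lambda>x. if x = a then y else \<zero>\<^bsub>Y\<^esub>) b = (\<Oplus>\<^bsub>Y\<^esub>x\<in>{a}. \<phi> (free_gen R x) b \<odot>\<^bsub>Y\<^esub> y)"
    unfolding mat_act_def
    by (rule Y.M.add.finprod_mono_neutral_cong_right) (use fin fc a y in auto)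
  then show ?thesis using fc[OF a] y by simp
qed

text \<open>Tensoring with a finite free module keeps a complex exact. Here this is seen one
  coordinate at a time: coordinate \<open>c\<close> of the cycle \<open>u\<close> is a cycle of the
  original complex and has a preimage \<open>w c\<close>.\<close>

lemma (in cring) free_module_tensor_exact:
  assumes F: "exact_complex R (\<lambda>i. free_module R (B i)) d K" and fin: "\<And>i. finite (B i)"
    and u: "u \<in> B (Suc n) \<rightarrow> carrier (free_module R C)"
    and cyc: "\<And>b. mat_act R (free_module R C) (B (Suc n)) (d n) u b = \<zero>\<^bsub>free_module R C\<^esub>"
    and C: "finite C"
  shows "\<exists>w \<in> B (Suc (Suc n)) \<rightarrow> carrier (free_module R C).
    \<forall>b \<in> B (Suc n). u b = mat_act R (free_module R C) (B (Suc (Suc n))) (d (Suc n)) w b"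
proof -
  note d_hom = exact_complexD(2)[OF F]
  let ?uc = "\<lambda>c a. if a \<in> B (Suc n) then u a c else \<zero>"
  have "\<exists>w \<in> carrier (free_module R (B (Suc (Suc n)))). d (Suc n) w = ?uc c" for c
  proof -
    have "d n (?uc c) b = \<zero>" for b
      using mat_act_coord(1)[OF fin d_hom u, of b c] cyc[of b] by simp
    then have "?uc c \<in> K (Suc n)"
      using mat_act_coord(2)[OF fin d_hom u, of c] exact_complexD(4)[OF F, of n] by auto
    then show ?thesis using exact_complexD(3)[OF F, of "Suc n"] by (metis (no_types, lifting) imageE)
  qed
  then obtain w where w: "\<And>c. w c \<in> carrier (free_module R (B (Suc (Suc n))))"
    "\<And>c. d (Suc n) (w c) = ?uc c" by metis
  \<comment> \<open>The preimages are transposed into a tuple of vectors; the values outside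
    \<open>C\<close> are set to zero to stay in the free module on \<open>C\<close>.\<close>
  let ?W = "\<lambda>a c. if c \<in> C then w c a else \<zero>"
  have wc: "w c a \<in> carrier R" for a c using free_module_closed[OF w(1)] .
  have W: "?W \<in> B (Suc (Suc n)) \<rightarrow> carrier (free_module R C)"
    using wc by (auto simp: free_module_carrier_finite[OF C])
  have "u b c = mat_act R (free_module R C) (B (Suc (Suc n))) (d (Suc n)) ?W b c" if b: "b \<in> B (Suc n)" for b c
  proof (cases "c \<in> C")
    case True
    have "(\<lambda>a. if a \<in> B (Suc (Suc n)) then ?W a c else \<zero>) = w c"
      using True w(1)[of c] by (auto simp: fun_eq_iff free_module_carrier)
    then show ?thesis
      using mat_act_coord(1)[OF fin d_hom W, of b c] w(2)[of c] b by simp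
  next
    case False
    have "mat_act R (free_module R C) (B (Suc (Suc n))) (d (Suc n)) ?W b \<in> carrier (free_module R C)"
      by (rule mat_act_closed[OF module_free_module d_hom W])
    moreover have "u b \<in> carrier (free_module R C)" using u b by auto
    ultimately show ?thesis using False by (simp add: free_module_carrier)
  qed
  then show ?thesis using W by (intro bexI[of _ ?W]) (auto simp: fun_eq_iff)
qed

lemma (in ideal) finsum_mem:
  assumes "f \<in> A \<rightarrow> I"
  shows "finsum R f A \<in> I"
proof (cases "finite A")
  case True
  then show ?thesis using assms
  proof induct
    case (insert a A)
    then have "f \<in> A \<rightarrow> carrier R" "f a \<in> carrier R" using a_Hcarr by (auto simp: Pi_iff)
    then show ?case using insert by simp
  qed simp
qed (simp add: finsum_infinite)

lemma mat_exactD: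
  assumes "mat_exact R Y A \<phi> B \<psi> C" "u \<in> B \<rightarrow> carrier Y"
    "\<And>c. c \<in> C \<Longrightarrow> mat_act R Y B \<psi> u c = \<zero>\<^bsub>Y\<^esub>"
  shows "\<exists>v \<in> A \<rightarrow> carrier Y. \<forall>b \<in> B. u b = mat_act R Y A \<phi> v b"
  using assms by (simp add: mat_exact_def)

definition entries_in :: "'a set \<Rightarrow> ('x \<Rightarrow> 'a) \<Rightarrow> bool"
  where "entries_in L u \<longleftrightarrow> (\<forall>x. u x \<in> L)"

context split_maximal_ideal
begin

interpretation I: ideal I R by (rule ideal_I)
interpretation J: ideal J R by (rule ideal_J)
interpretation S: ideal "I <+>\<^bsub>R\<^esub> J" R by (rule sum_ideal)

lemma J_nonzeroE: obtains j where "j \<in> J" "j \<noteq> \<zero>"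
  using J_nonzero J.zero_closed by blast

text \<open>The last clause expresses minimality through relations: none has a unit coefficient,
  because the non-units are exactly \<open>I + J\<close>. Nakayama's lemma is then a statement about
  a single relation.\<close>

definition minimally_generates :: "('a, 'n) module \<Rightarrow> 'n set \<Rightarrow> 'x set \<Rightarrow> ('x \<Rightarrow> 'n) \<Rightarrow> bool"
  where "minimally_generates N H C c \<longleftrightarrow> finite C \<and> c \<in> C \<rightarrow> H \<and> c \<in> C \<rightarrow> carrier N \<and>
    lincomb R N c ` carrier (free_module R C) = H \<and>
    (\<forall>u \<in> carrier (free_module R C). lincomb R N c u = \<zero>\<^bsub>N\<^esub> \<longrightarrow> (\<forall>x. u x \<in> I <+>\<^bsub>R\<^esub> J))"

lemma minimally_generatesD:
  assumes "minimally_generates N H C c"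
  shows "finite C" "c \<in> C \<rightarrow> H" "c \<in> C \<rightarrow> carrier N" "lincomb R N c ` carrier (free_module R C) = H"
    "\<And>u x. u \<in> carrier (free_module R C) \<Longrightarrow> lincomb R N c u = \<zero>\<^bsub>N\<^esub> \<Longrightarrow> u x \<in> I <+>\<^bsub>R\<^esub> J"
  using assms by (auto simp: minimally_generates_def)

text \<open>Writing the elements \<open>h a\<close> through the generators turns the equation into a
  relation with coefficient 1 - r at \<open>c0\<close>, where r is in \<open>I + J\<close>.
  Minimality puts 1 - r there too, hence 1, against \<open>proper\<close>.\<close>

lemma nakayama:
  assumes N: "module R N" and gen: "minimally_generates N H C c" and c0: "c0 \<in> C"
    and A: "finite A" "\<And>a. a \<in> A \<Longrightarrow> r a \<in> I <+>\<^bsub>R\<^esub> J" "\<And>a. a \<in> A \<Longrightarrow> h a \<in> H"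
    and eq: "c c0 = (\<Oplus>\<^bsub>N\<^esub>a\<in>A. r a \<odot>\<^bsub>N\<^esub> h a)"
  shows False
proof -
  interpret N: module R N by (rule N)
  let ?F = "free_module R C"
  interpret F: module R ?F by (rule module_free_module)
  note g = minimally_generatesD[OF gen]
  note C = g(1,3) c0 and ker = g(5)
  note hom = lincomb_hom[OF N C(2)]
  have "\<forall>a\<in>A. \<exists>v. v \<in> carrier ?F \<and> h a = lincomb R N c v" using A(3) g(4) by blast
  from bchoice[OF this]
  obtain V where V: "\<And>a. a \<in> A \<Longrightarrow> V a \<in> carrier ?F \<and> h a = lincomb R N c (V a)" by blast
  have rc: "r a \<in> carrier R" if "a \<in> A" for a using A(2)[OF that] S.a_Hcarr by blast
  let ?w = "\<Oplus>\<^bsub>?F\<^esub>a\<in>A. r a \<odot>\<^bsub>?F\<^esub> V a"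
  have rV: "r a \<odot>\<^bsub>?F\<^esub> V a \<in> carrier ?F" if "a \<in> A" for a
    using rc V that by (intro F.smult_closed) auto
  then have w: "?w \<in> carrier ?F" by (intro F.M.finsum_closed) auto
  have "lincomb R N c ?w = (\<Oplus>\<^bsub>N\<^esub>a\<in>A. lincomb R N c (r a \<odot>\<^bsub>?F\<^esub> V a))"
    by (rule module_hom_finsum[OF F.module_axioms N hom A(1)]) (use rV in auto)
  also have "\<dots> = (\<Oplus>\<^bsub>N\<^esub>a\<in>A. r a \<odot>\<^bsub>N\<^esub> h a)"
    by (rule N.M.finsum_cong')
      (use module_hom_smult[OF hom rc] module_hom_closed[OF hom] V rc in \<open>auto simp del: free_module_simps\<close>)
  finally have w_eq: "lincomb R N c ?w = c c0" using eq by simp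
  have c0: "c c0 \<in> carrier N" using C by auto
  have "lincomb R N c (free_gen R c0 \<ominus>\<^bsub>?F\<^esub> ?w) = \<zero>\<^bsub>N\<^esub>"
    using module_hom_minus[OF F.module_axioms N hom _ w, of "free_gen R c0"] C(3) w_eq
      lincomb_free_gen[of N c c0, OF N c0] c0 by (simp add: N.M.minus_eq_zero_iff)
  moreover have "free_gen R c0 \<ominus>\<^bsub>?F\<^esub> ?w \<in> carrier ?F"
    using C(3) w by (intro F.M.minus_closed) auto
  ultimately have "(free_gen R c0 \<ominus>\<^bsub>?F\<^esub> ?w) c0 \<in> I <+>\<^bsub>R\<^esub> J" using ker by blast
  then have 1: "\<one> \<ominus> ?w c0 \<in> I <+>\<^bsub>R\<^esub> J"
    using free_module_minus[OF free_gen_closed[OF C(3)] w] by (simp add: free_gen_def)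
  have "?w c0 = (\<Oplus>a\<in>A. (r a \<odot>\<^bsub>?F\<^esub> V a) c0)"
    by (rule free_module_finsum[OF A(1)]) (use rV in auto)
  also have "\<dots> \<in> I <+>\<^bsub>R\<^esub> J"
  proof -
    have "(r a \<odot>\<^bsub>?F\<^esub> V a) c0 \<in> I <+>\<^bsub>R\<^esub> J" if "a \<in> A" for a
      using S.I_r_closed[OF A(2)[OF that]] V[OF that] free_module_closed[of "V a" R C c0] by simp
    then show ?thesis by (intro S.finsum_mem) auto
  qed
  finally have 2: "?w c0 \<in> I <+>\<^bsub>R\<^esub> J" .
  have "(\<one> \<ominus> ?w c0) \<oplus> ?w c0 = \<one>"
    using S.a_Hcarr[OF 2] by (simp add: a_minus_def a_assoc l_neg)
  then show False using S.a_closed[OF 1 2] proper by simp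
qed

lemma minimal_generators:
  assumes N: "module R N" and H: "submodule H R N" and A: "finite A" "module_span R N A = H" "A \<subseteq> carrier N"
  shows "\<exists>(C :: nat set) c. minimally_generates N H C c \<and> (H \<noteq> {\<zero>\<^bsub>N\<^esub>} \<longrightarrow> C \<noteq> {})"
proof -
  have AH: "A \<subseteq> H" using span_superset[of A R N] A(2) by simp
  obtain C :: "nat set" and c where C: "finite C" "c \<in> C \<rightarrow> H \<inter> carrier N"
    "lincomb R N c ` carrier (free_module R C) = module_span R N A"
    "\<forall>u \<in> carrier (free_module R C). lincomb R N c u = \<zero>\<^bsub>N\<^esub> \<longrightarrow> (\<forall>x. u x \<in> I <+>\<^bsub>R\<^esub> J)"
    using minimal_presentation[OF N A(1,3) AH infinite_UNIV_nat zero_in_sum units] by blast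
  have "C \<noteq> {}" if "H \<noteq> {\<zero>\<^bsub>N\<^esub>}"
  proof
    assume "C = {}"
    then have "carrier (free_module R C) = {\<lambda>_. \<zero>}"
      by (auto simp: free_module_carrier)
    then have "H = {lincomb R N c (\<lambda>_. \<zero>)}" using C(3) A(2) by simp
    then show False using that module.submoduleD(2)[OF N H] by auto
  qed
  moreover have "minimally_generates N H C c"
    using C A(2) unfolding minimally_generates_def by auto
  ultimately show ?thesis by blast
qed

lemma homogeneous_over: "homogeneous u \<longleftrightarrow> entries_in I u \<or> entries_in J u"
  by (simp add: homogeneous_def entries_in_def)

section \<open>Columns over \<open>I\<close> and over \<open>J\<close> in an exact complex of free
  modules\<close>

context
  fixes B :: "nat \<Rightarrow> 'x set" and d K
  assumes F: "exact_complex R (\<lambda>i. free_module R (B i)) d K" and fin: "\<And>i. finite (B i)"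
begin

lemma d_hom: "d i \<in> module_hom R (free_module R (B (Suc i))) (free_module R (B i))"
  by (rule exact_complexD(2)[OF F])

lemma smult_gen_mem_K:
  assumes b: "b \<in> B (Suc i)" and I: "entries_in I (d i (free_gen R b))" and j: "j \<in> J"
  shows "j \<odot>\<^bsub>free_module R (B (Suc i))\<^esub> free_gen R b \<in> K (Suc i)"
proof -
  let ?F = "free_module R (B (Suc i))"
  interpret F: module R ?F by (rule module_free_module)
  have jR: "j \<in> carrier R" using j J.a_Hcarr by blast
  have "d i (j \<odot>\<^bsub>?F\<^esub> free_gen R b) = j \<odot>\<^bsub>free_module R (B i)\<^esub> d i (free_gen R b)"
    by (rule module_hom_smult[OF d_hom jR]) (use b in simp)
  also have "\<dots> = \<zero>\<^bsub>free_module R (B i)\<^esub>"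
  proof
    fix x
    have "d i (free_gen R b) x \<otimes> j = \<zero>" using mult_IJ I j by (simp add: entries_in_def)
    then show "(j \<odot>\<^bsub>free_module R (B i)\<^esub> d i (free_gen R b)) x = \<zero>\<^bsub>free_module R (B i)\<^esub> x"
      using m_comm[OF jR free_gen_hom_closed(2)[OF d_hom b]] by simp
  qed
  finally show ?thesis
    using exact_complexD(4)[OF F, of i] F.smult_closed[OF jR free_gen_closed[OF b]]
    by (simp del: free_module_simps)
qed

lemma image_over:
  assumes L: "ideal L R" and gens: "\<And>b. b \<in> B (Suc i) \<Longrightarrow> entries_in L (d i (free_gen R b))" and u: "u \<in> K i"
  shows "entries_in L u"
proof -
  interpret L: ideal L R by (rule L)
  obtain v where v: "v \<in> carrier (free_module R (B (Suc i)))" "u = d i v"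
    using u exact_complexD(3)[OF F, of i] by blast
  show ?thesis
    unfolding entries_in_def v(2)
  proof
    fix x show "d i v x \<in> L"
      by (rule free_hom_coord_ideal[OF L fin d_hom v(1)])
        (use gens L.I_l_closed free_module_closed[OF v(1)] in \<open>auto simp: entries_in_def\<close>)
  qed
qed

text \<open>If all columns of the next differential are over \<open>I\<close>, so is the whole
  syzygy they generate. A generator whose own column is over \<open>I\<close> would contribute to
  that syzygy its multiple by a nonzero element of \<open>J\<close>.\<close>

lemma no_generator_over_I:
  assumes "\<And>b. b \<in> B (Suc (Suc i)) \<Longrightarrow> entries_in I (d (Suc i) (free_gen R b))" and b: "b \<in> B (Suc i)"
  shows "\<not> entries_in I (d i (free_gen R b))"
proof
  assume I: "entries_in I (d i (free_gen R b))"
  obtain j where j: "j \<in> J" "j \<noteq> \<zero>" by (rule J_nonzeroE)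
  have "entries_in I (j \<odot>\<^bsub>free_module R (B (Suc i))\<^esub> free_gen R b)"
    using image_over[OF ideal_I assms(1) smult_gen_mem_K[OF b I j(1)]] .
  then have "j \<otimes> free_gen R b b \<in> I" unfolding entries_in_def by (metis free_module_simps(3))
  then have "j \<in> I \<inter> J" using j J.a_Hcarr by (simp add: free_gen_def)
  then show False using disjoint j by blast
qed

text \<open>The same conflict with the zero ideal in place of \<open>I\<close>: without generators
  in the next degree the syzygy vanishes.\<close>

lemma next_generators_nonempty:
  assumes b: "b \<in> B (Suc i)" and I: "entries_in I (d i (free_gen R b))"
  shows "B (Suc (Suc i)) \<noteq> {}"
proof
  assume e: "B (Suc (Suc i)) = {}"
  obtain j where j: "j \<in> J" "j \<noteq> \<zero>" by (rule J_nonzeroE)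
  have "entries_in {\<zero>} (j \<odot>\<^bsub>free_module R (B (Suc i))\<^esub> free_gen R b)"
    using image_over[OF zeroideal _ smult_gen_mem_K[OF b I j(1)]] e by blast
  then have "j \<otimes> free_gen R b b = \<zero>" unfolding entries_in_def by (metis free_module_simps(3) singletonD)
  then show False using j J.a_Hcarr by (simp add: free_gen_def)
qed

lemma generator_not_over_J:
  assumes min: "\<forall>i. \<forall>u \<in> K i. \<forall>x. u x \<in> I <+>\<^bsub>R\<^esub> J"
    and Y: "module R Y" "finitely_generated R Y" "carrier Y \<noteq> {\<zero>\<^bsub>Y\<^esub>}"
    and JY: "\<And>j y. j \<in> J \<Longrightarrow> y \<in> carrier Y \<Longrightarrow> j \<odot>\<^bsub>Y\<^esub> y = \<zero>\<^bsub>Y\<^esub>"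
    and ex: "mat_exact R Y (B (Suc (Suc n))) (d (Suc n)) (B (Suc n)) (d n) (B n)"
    and b: "b \<in> B (Suc n)"
  shows "\<not> entries_in J (d n (free_gen R b))"
proof
  assume J: "entries_in J (d n (free_gen R b))"
  interpret Y: module R Y by (rule Y(1))
  obtain A where A: "finite A" "A \<subseteq> carrier Y" "module_span R Y A = carrier Y"
    using Y(2) by (auto simp: finitely_generated_def)
  obtain C :: "nat set" and c where gen: "minimally_generates Y (carrier Y) C c"
    and "carrier Y \<noteq> {\<zero>\<^bsub>Y\<^esub>} \<longrightarrow> C \<noteq> {}"
    using minimal_generators[OF Y(1) Y.carrier_is_submodule A(1,3,2)] by blast
  then obtain c0 where c0: "c0 \<in> C" using Y(3) by blast
  then have y: "c c0 \<in> carrier Y" using minimally_generatesD(2)[OF gen] by auto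
  \<comment> \<open>The element \<open>y e\<close> of the overview, with \<open>y\<close> chosen as
    a minimal generator of \<open>Y\<close>: for such an element being a boundary contradicts
    Nakayama, as the entries of the next differential lie in the maximal ideal.\<close>
  let ?u = "\<lambda>x. if x = b then c c0 else \<zero>\<^bsub>Y\<^esub>"
  have "mat_act R Y (B (Suc n)) (d n) ?u a = \<zero>\<^bsub>Y\<^esub>" for a
    using mat_act_single[OF Y(1) fin d_hom b y] JY y J by (simp add: entries_in_def)
  moreover have "?u \<in> B (Suc n) \<rightarrow> carrier Y" using y by auto
  ultimately have "\<exists>v \<in> B (Suc (Suc n)) \<rightarrow> carrier Y.
      \<forall>b \<in> B (Suc n). ?u b = mat_act R Y (B (Suc (Suc n))) (d (Suc n)) v b"
    by (intro mat_exactD[OF ex])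
  then obtain v where v: "v \<in> B (Suc (Suc n)) \<rightarrow> carrier Y"
    "\<forall>b \<in> B (Suc n). ?u b = mat_act R Y (B (Suc (Suc n))) (d (Suc n)) v b"
    by blast
  have "c c0 = (\<Oplus>\<^bsub>Y\<^esub>a\<in>B (Suc (Suc n)). d (Suc n) (free_gen R a) b \<odot>\<^bsub>Y\<^esub> v a)"
    using bspec[OF v(2) b] by (simp add: mat_act_def)
  moreover have "d (Suc n) (free_gen R a) b \<in> I <+>\<^bsub>R\<^esub> J" if "a \<in> B (Suc (Suc n))" for a
    using min exact_complexD(6)[OF F, of "free_gen R a" "Suc n"] that by simp
  ultimately show False
    by (intro nakayama[OF Y(1) gen c0 fin, of "Suc (Suc n)" "\<lambda>a. d (Suc n) (free_gen R a) b" v]) (use v(1) in auto)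
qed

text \<open>Take \<open>x\<close> in \<open>J\<close> such that \<open>x e\<close> is a minimal
  generator of \<open>J e\<close>, and write \<open>x e\<close> as the image of \<open>r\<close>. By
  Nakayama some coordinate \<open>r b1\<close> is a unit. Comparing the
  \<open>b1\<close>-coordinates of preimages of \<open>x e\<close> and \<open>y e\<close> then
  expresses each \<open>y\<close> in \<open>J\<close> through \<open>x\<close>.\<close>

lemma J_principal:
  assumes b0: "b0 \<in> B (Suc i)" "entries_in I (d i (free_gen R b0))"
    and 1: "\<And>b. b \<in> B (Suc (Suc i)) \<Longrightarrow> entries_in J (d (Suc i) (free_gen R b))"
    and 2: "\<And>b. b \<in> B (Suc (Suc (Suc i))) \<Longrightarrow> entries_in I (d (Suc (Suc i)) (free_gen R b))"
  shows "\<exists>x \<in> J. (\<forall>y \<in> J. \<exists>r \<in> carrier R. y = r \<otimes> x) \<and> (\<forall>r \<in> carrier R. r \<otimes> x = \<zero> \<longrightarrow> r \<in> I)"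
proof -
  let ?F = "free_module R (B (Suc i))" and ?G = "free_module R (B (Suc (Suc i)))"
  let ?D = "d (Suc i)" and ?e = "free_gen R b0"
  interpret F: module R ?F by (rule module_free_module)
  interpret G: module R ?G by (rule module_free_module)
  let ?s = "\<lambda>j. j \<odot>\<^bsub>?F\<^esub> ?e"
  have e: "?e \<in> carrier ?F" using b0 by simp
  have s0: "?s j b0 = j" if "j \<in> carrier R" for j using that by (simp add: free_gen_def)
  have sK: "\<exists>r \<in> carrier ?G. ?D r = ?s j" if "j \<in> J" for j
    using smult_gen_mem_K[OF b0 that] exact_complexD(3)[OF F, of "Suc i"] by (metis (no_types, lifting) imageE)
  \<comment> \<open>Independence of the columns over the quotient by \<open>I\<close>: relations
    between them lie in the next syzygy, whose columns are all over \<open>I\<close>.\<close>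
  have indep: "r b \<in> I" if r: "r \<in> carrier ?G" "?D r = \<zero>\<^bsub>?F\<^esub>" for r b
  proof -
    have "r \<in> K (Suc (Suc i))" using r exact_complexD(4)[OF F, of "Suc i"] by simp
    then show ?thesis using image_over[OF ideal_I 2] by (simp add: entries_in_def)
  qed
  \<comment> \<open>The submodule \<open>J e\<close> serves as a copy of the ideal \<open>J\<close>
    inside a module, which is what minimal generators and \<open>nakayama\<close> speak
    about.\<close>
  have H: "submodule (?s ` J) R ?F"
  proof (rule F.submoduleI)
    show "?s ` J \<subseteq> carrier ?F" using e J.a_Hcarr by (auto intro!: F.smult_closed simp del: free_module_simps)
    show "\<zero>\<^bsub>?F\<^esub> \<in> ?s ` J" using F.smult_l_null[OF e] J.zero_closed by (metis imageI)
  next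
    fix a assume "a \<in> ?s ` J"
    then show "\<ominus>\<^bsub>?F\<^esub> a \<in> ?s ` J"
      using F.smult_l_minus[OF J.a_Hcarr e, symmetric] by (auto simp del: free_module_simps)
  next
    fix a b assume "a \<in> ?s ` J" "b \<in> ?s ` J"
    then obtain j j' where "j \<in> J" "j' \<in> J" "a = ?s j" "b = ?s j'" by blast
    moreover from this have "a \<oplus>\<^bsub>?F\<^esub> b = ?s (j \<oplus> j')" using F.smult_l_distr[OF _ _ e] J.a_Hcarr by metis
    ultimately show "a \<oplus>\<^bsub>?F\<^esub> b \<in> ?s ` J" using J.a_closed by blast
  next
    fix r a assume r: "r \<in> carrier R" and "a \<in> ?s ` J"
    then obtain j where "j \<in> J" "a = ?s j" by blast
    moreover from this have "r \<odot>\<^bsub>?F\<^esub> a = ?s (r \<otimes> j)" using F.smult_assoc1[OF r _ e] J.a_Hcarr by metis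
    ultimately show "r \<odot>\<^bsub>?F\<^esub> a \<in> ?s ` J" using J.I_l_closed[OF _ r] by blast
  qed
  obtain A where A: "A \<subseteq> ?s ` J" "finite A" "module_span R ?F A = ?s ` J"
    using submodule_free_module_finitely_generated[OF is_cring noetherian_ring_axioms fin H] by metis
  have H_nonzero: "?s ` J \<noteq> {\<zero>\<^bsub>?F\<^esub>}"
  proof
    assume z: "?s ` J = {\<zero>\<^bsub>?F\<^esub>}"
    obtain j where j: "j \<in> J" "j \<noteq> \<zero>" by (rule J_nonzeroE)
    then have "?s j = \<zero>\<^bsub>?F\<^esub>" using z by blast
    then show False using s0[of j] j J.a_Hcarr by (metis free_module_simps(1))
  qed
  have AF: "A \<subseteq> carrier ?F" using A(1) F.submoduleD(1)[OF H] by blast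
  obtain C :: "nat set" and c where gen: "minimally_generates ?F (?s ` J) C c"
    and "?s ` J \<noteq> {\<zero>\<^bsub>?F\<^esub>} \<longrightarrow> C \<noteq> {}"
    using minimal_generators[OF F.module_axioms H A(2,3) AF] by blast
  then obtain c0 where c0: "c0 \<in> C" using H_nonzero by blast
  then obtain x where x: "x \<in> J" "c c0 = ?s x" using minimally_generatesD(2)[OF gen] by blast
  have xR: "x \<in> carrier R" using x J.a_Hcarr by blast
  obtain r where r: "r \<in> carrier ?G" "?D r = ?s x" using sK[OF x(1)] by blast
  have rR: "r b \<in> carrier R" for b using r(1) by simp
  \<comment> \<open>If all coordinates of \<open>r\<close> were non-units, the
    \<open>b0\<close>-coordinate of its image would write \<open>x\<close> with coefficients in the
    maximal ideal, and \<open>x e\<close> would lie in that ideal times \<open>J e\<close>.\<close>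
  have "\<exists>b. r b \<notin> I <+>\<^bsub>R\<^esub> J"
  proof (rule ccontr)
    assume "\<nexists>b. r b \<notin> I <+>\<^bsub>R\<^esub> J"
    then have rm: "r b \<in> I <+>\<^bsub>R\<^esub> J" for b by blast
    let ?a = "\<lambda>b. ?D (free_gen R b) b0"
    have aJ: "?a b \<in> J" if "b \<in> B (Suc (Suc i))" for b using 1[OF that] by (simp add: entries_in_def)
    have "x = (\<Oplus>b\<in>B (Suc (Suc i)). r b \<otimes> ?a b)"
      using free_hom_coord[OF fin d_hom r(1), of b0] r(2) s0[OF xR] by simp
    then have "c c0 = (\<Oplus>b\<in>B (Suc (Suc i)). r b \<otimes> ?a b) \<odot>\<^bsub>?F\<^esub> ?e" using x(2) by metis
    also have "\<dots> = (\<Oplus>\<^bsub>?F\<^esub>b\<in>B (Suc (Suc i)). (r b \<otimes> ?a b) \<odot>\<^bsub>?F\<^esub> ?e)"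
      by (rule F.finsum_smult_rdistr[OF fin _ e]) (use rR aJ J.a_Hcarr in auto)
    also have "\<dots> = (\<Oplus>\<^bsub>?F\<^esub>b\<in>B (Suc (Suc i)). r b \<odot>\<^bsub>?F\<^esub> ?s (?a b))"
      by (rule F.M.finsum_cong')
        (use rR aJ J.a_Hcarr e in \<open>auto intro!: F.smult_closed F.smult_assoc1 simp del: free_module_simps\<close>)
    finally show False
      by (rule nakayama[OF F.module_axioms gen c0 fin, rotated -1])
        (use rm aJ in \<open>auto simp del: free_module_simps\<close>)
  qed
  then obtain b1 where "r b1 \<notin> I <+>\<^bsub>R\<^esub> J" by blast
  then have U: "r b1 \<in> Units R" using units rR by blast
  then have inv: "inv (r b1) \<in> carrier R" "inv (r b1) \<otimes> r b1 = \<one>" by auto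
  have "\<exists>t \<in> carrier R. y = t \<otimes> x" if y: "y \<in> J" for y
  proof -
    obtain s where s: "s \<in> carrier ?G" "?D s = ?s y" using sK[OF y] by blast
    have yR: "y \<in> carrier R" using y J.a_Hcarr by blast
    have sR: "s b1 \<in> carrier R" using s(1) by simp
    \<comment> \<open>The images of \<open>s\<close> and \<open>r\<close> are \<open>y e\<close> and
      \<open>x e\<close>, so this cross difference is in the kernel. Its
      \<open>b1\<close>-coordinate lies in \<open>I\<close> by independence and in \<open>J\<close>
      because \<open>x\<close> and \<open>y\<close> do, hence it is zero.\<close>
    let ?v = "(x \<odot>\<^bsub>?G\<^esub> s) \<ominus>\<^bsub>?G\<^esub> (y \<odot>\<^bsub>?G\<^esub> r)"
    have c: "x \<odot>\<^bsub>?G\<^esub> s \<in> carrier ?G" "y \<odot>\<^bsub>?G\<^esub> r \<in> carrier ?G"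
      using xR yR s(1) r(1) by (auto intro!: G.smult_closed simp del: free_module_simps)
    have "?D ?v = x \<odot>\<^bsub>?F\<^esub> ?s y \<ominus>\<^bsub>?F\<^esub> y \<odot>\<^bsub>?F\<^esub> ?s x"
      using module_hom_minus[OF G.module_axioms F.module_axioms d_hom c] module_hom_smult[OF d_hom xR s(1)]
        module_hom_smult[OF d_hom yR r(1)] s(2) r(2) by metis
    also have "\<dots> = (x \<otimes> y) \<odot>\<^bsub>?F\<^esub> ?e \<ominus>\<^bsub>?F\<^esub> (y \<otimes> x) \<odot>\<^bsub>?F\<^esub> ?e"
      using F.smult_assoc1[OF xR yR e] F.smult_assoc1[OF yR xR e] by metis
    also have "\<dots> = \<zero>\<^bsub>?F\<^esub>"
      using m_comm[OF xR yR] F.smult_closed[OF _ e, of "y \<otimes> x"] xR yR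
      by (simp add: F.M.minus_eq_zero_iff del: free_module_simps)
    finally have "?v b1 \<in> I" using c by (intro indep) auto
    then have vI: "x \<otimes> s b1 \<ominus> y \<otimes> r b1 \<in> I" using free_module_minus[OF c] by simp
    have "x \<otimes> s b1 \<in> J" "y \<otimes> r b1 \<in> J" using x(1) y sR rR J.I_r_closed by auto
    then have "x \<otimes> s b1 \<ominus> y \<otimes> r b1 \<in> J" by (simp add: a_minus_def)
    then have "x \<otimes> s b1 = y \<otimes> r b1"
      using vI disjoint xR yR sR rR by (simp add: set_eq_iff) (metis m_closed minus_eq_zero_iff)
    then have "inv (r b1) \<otimes> (x \<otimes> s b1) = inv (r b1) \<otimes> (y \<otimes> r b1)" by simp
    moreover have "inv (r b1) \<otimes> (x \<otimes> s b1) = inv (r b1) \<otimes> s b1 \<otimes> x"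
      using xR sR inv(1) by (simp add: m_ac)
    moreover have "inv (r b1) \<otimes> (y \<otimes> r b1) = inv (r b1) \<otimes> r b1 \<otimes> y"
      using yR rR inv(1) m_comm[OF yR rR[of b1]] by (simp add: m_assoc)
    ultimately have "inv (r b1) \<otimes> s b1 \<otimes> x = inv (r b1) \<otimes> r b1 \<otimes> y" by simp
    then show ?thesis using inv sR yR by (intro bexI[of _ "inv (r b1) \<otimes> s b1"]) auto
  qed
  moreover have "t \<in> I" if t: "t \<in> carrier R" "t \<otimes> x = \<zero>" for t
  proof -
    have "?D (t \<odot>\<^bsub>?G\<^esub> r) = t \<odot>\<^bsub>?F\<^esub> ?s x" using module_hom_smult[OF d_hom t(1) r(1)] r(2) by metis
    also have "\<dots> = (t \<otimes> x) \<odot>\<^bsub>?F\<^esub> ?e" by (rule F.smult_assoc1[OF t(1) xR e, symmetric])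
    also have "\<dots> = \<zero>\<^bsub>?F\<^esub>" using F.smult_l_null[OF e] t(2) by metis
    finally have "(t \<odot>\<^bsub>?G\<^esub> r) b1 \<in> I" by (intro indep G.smult_closed t r)
    then have "inv (r b1) \<otimes> (t \<otimes> r b1) \<in> I" using I.I_l_closed inv(1) by simp
    moreover have "inv (r b1) \<otimes> (t \<otimes> r b1) = (inv (r b1) \<otimes> r b1) \<otimes> t"
      using inv(1) t(1) rR by (simp add: m_ac)
    ultimately show ?thesis using inv t(1) by simp
  qed
  ultimately show ?thesis using x(1) by blast
qed

text \<open>A diagram chase for the connecting map of the presentation of \<open>Y\<close> by
  \<open>?P\<close>. Over R the relations \<open>?L\<close> contain all vectors over
  \<open>J\<close>, because \<open>J\<close> kills \<open>Y\<close>; their part \<open>?H\<close>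
  over \<open>I\<close> is a copy of the relation module over the quotient by \<open>J\<close>. A
  minimal generator of \<open>?H\<close> is shown to lie in the maximal ideal times
  \<open>?H\<close>, so there is none.\<close>

lemma free_over_quotient:
  assumes min: "\<forall>i. \<forall>u \<in> K i. \<forall>x. u x \<in> I <+>\<^bsub>R\<^esub> J"
    and Y: "module R Y" "finitely_generated R Y"
    and JY: "\<And>j y. j \<in> J \<Longrightarrow> y \<in> carrier Y \<Longrightarrow> j \<odot>\<^bsub>Y\<^esub> y = \<zero>\<^bsub>Y\<^esub>"
    and ex: "mat_exact R Y (B (Suc (Suc (Suc n)))) (d (Suc (Suc n))) (B (Suc (Suc n))) (d (Suc n)) (B (Suc n))"
    and b: "b \<in> B (Suc n)" "entries_in J (d n (free_gen R b))"
    and 1: "\<And>a. a \<in> B (Suc (Suc n)) \<Longrightarrow> entries_in I (d (Suc n) (free_gen R a))"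
  shows "\<exists>(C :: nat set) c. minimally_generates Y (carrier Y) C c \<and>
    (\<forall>u \<in> carrier (free_module R C). lincomb R Y c u = \<zero>\<^bsub>Y\<^esub> \<longrightarrow> entries_in J u)"
proof -
  interpret Y: module R Y by (rule Y(1))
  obtain A where A: "finite A" "A \<subseteq> carrier Y" "module_span R Y A = carrier Y"
    using Y(2) by (auto simp: finitely_generated_def)
  obtain C :: "nat set" and c where gen: "minimally_generates Y (carrier Y) C c"
    using minimal_generators[OF Y(1) Y.carrier_is_submodule A(1,3,2)] by blast
  note C = minimally_generatesD[OF gen]
  let ?P = "free_module R C" and ?\<pi> = "lincomb R Y c"
  interpret P: module R ?P by (rule module_free_module)
  have \<pi>: "?\<pi> \<in> module_hom R ?P Y" by (rule lincomb_hom[OF Y(1) C(3)])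
  let ?L = "{l \<in> carrier ?P. ?\<pi> l = \<zero>\<^bsub>Y\<^esub>}"
  have L: "submodule ?L R ?P" by (rule module_hom_kernel_submodule[OF P.module_axioms Y(1) \<pi>])
  have L_J: "w \<in> ?L" if w: "w \<in> carrier ?P" "\<And>x. w x \<in> J" for w
  proof -
    have "?\<pi> w = (\<Oplus>\<^bsub>Y\<^esub>x\<in>{x. w x \<noteq> \<zero>}. \<zero>\<^bsub>Y\<^esub>)"
      unfolding lincomb_def
    proof (rule Y.M.finsum_cong')
      fix x assume "x \<in> {x. w x \<noteq> \<zero>}"
      then have "x \<in> C" using w(1) by (auto simp: free_module_carrier)
      then show "w x \<odot>\<^bsub>Y\<^esub> c x = \<zero>\<^bsub>Y\<^esub>" using JY[OF w(2)] C(3) by auto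
    qed auto
    then show ?thesis using w(1) by simp
  qed
  let ?H = "{l \<in> ?L. \<forall>x. l x \<in> I}"
  have H: "submodule ?H R ?P"
  proof (rule P.submoduleI)
    show "\<zero>\<^bsub>?P\<^esub> \<in> ?H" using P.submoduleD(2)[OF L] by simp
    fix a assume a: "a \<in> ?H"
    then have "\<ominus>\<^bsub>?P\<^esub> a = (\<ominus> \<one>) \<odot>\<^bsub>?P\<^esub> a"
      using P.smult_l_minus[OF one_closed, of a] by (simp del: free_module_simps)
    then have "(\<ominus>\<^bsub>?P\<^esub> a) x = \<ominus> \<one> \<otimes> a x" for x by simp
    then show "\<ominus>\<^bsub>?P\<^esub> a \<in> ?H" using a P.submoduleD(3)[OF L] I.I_l_closed by simp
  next
    fix a b assume "a \<in> ?H" "b \<in> ?H"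
    then show "a \<oplus>\<^bsub>?P\<^esub> b \<in> ?H" using P.submoduleD(4)[OF L, of a b] by auto
  next
    fix r a assume "r \<in> carrier R" "a \<in> ?H"
    then show "r \<odot>\<^bsub>?P\<^esub> a \<in> ?H" using P.submoduleD(6)[OF L, of r a] I.I_l_closed by auto
  qed auto
  obtain A' where A': "A' \<subseteq> ?H" "finite A'" "module_span R ?P A' = ?H"
    using submodule_free_module_finitely_generated[OF is_cring noetherian_ring_axioms C(1) H] by metis
  have A'P: "A' \<subseteq> carrier ?P" using A'(1) by auto
  obtain C' :: "nat set" and c' where gen': "minimally_generates ?P ?H C' c'"
    and ne: "?H \<noteq> {\<zero>\<^bsub>?P\<^esub>} \<longrightarrow> C' \<noteq> {}"
    using minimal_generators[OF P.module_axioms H A'(2,3) A'P] by blast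
  have "C' = {}"
  proof (rule ccontr)
    assume "C' \<noteq> {}"
    then obtain c0 where c0: "c0 \<in> C'" by blast
    let ?l = "c' c0"
    have l: "?l \<in> carrier ?P" "?\<pi> ?l = \<zero>\<^bsub>Y\<^esub>" "\<And>x. ?l x \<in> I"
      using minimally_generatesD(2)[OF gen'] c0 by auto
    \<comment> \<open>The element \<open>l e\<close> of the tensor product of \<open>?P\<close> with
      the complex. It is a cycle because the entries of \<open>?l\<close> lie in \<open>I\<close>
      and those of the column of \<open>b\<close> in \<open>J\<close>.\<close>
    let ?u = "\<lambda>x. if x = b then ?l else \<zero>\<^bsub>?P\<^esub>"
    have u: "?u \<in> B (Suc n) \<rightarrow> carrier ?P" using l(1) P.M.zero_closed by auto
    have "mat_act R ?P (B (Suc n)) (d n) ?u a = \<zero>\<^bsub>?P\<^esub>" for a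
    proof -
      have "mat_act R ?P (B (Suc n)) (d n) ?u a = d n (free_gen R b) a \<odot>\<^bsub>?P\<^esub> ?l"
        by (rule mat_act_single[OF P.module_axioms fin d_hom b(1) l(1)])
      also have "\<dots> = \<zero>\<^bsub>?P\<^esub>"
      proof
        fix x
        have "d n (free_gen R b) a \<in> J" using b(2) by (simp add: entries_in_def)
        then have "?l x \<otimes> d n (free_gen R b) a = \<zero>" "d n (free_gen R b) a \<in> carrier R" "?l x \<in> carrier R"
          using mult_IJ[OF l(3)] J.a_Hcarr l(1) by auto
        then show "(d n (free_gen R b) a \<odot>\<^bsub>?P\<^esub> ?l) x = \<zero>\<^bsub>?P\<^esub> x" by (simp add: m_comm)
      qed
      finally show ?thesis .
    qed
    then obtain w where w: "w \<in> B (Suc (Suc n)) \<rightarrow> carrier ?P"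
      "\<And>a. a \<in> B (Suc n) \<Longrightarrow> ?u a = mat_act R ?P (B (Suc (Suc n))) (d (Suc n)) w a"
      using free_module_tensor_exact[OF F fin u _ C(1)] by blast
    \<comment> \<open>Over \<open>Y\<close> the chain \<open>w\<close> becomes a cycle, since
      \<open>?l\<close> is a relation of \<open>Y\<close>. This is where the vanishing of the
      homology with coefficients in \<open>Y\<close> is applied.\<close>
    have "\<exists>v \<in> B (Suc (Suc (Suc n))) \<rightarrow> carrier Y. \<forall>a \<in> B (Suc (Suc n)).
      ?\<pi> (w a) = mat_act R Y (B (Suc (Suc (Suc n)))) (d (Suc (Suc n))) v a"
    proof (rule mat_exactD[OF ex])
      show "(\<lambda>a. ?\<pi> (w a)) \<in> B (Suc (Suc n)) \<rightarrow> carrier Y" using w(1) module_hom_closed[OF \<pi>] by auto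
      fix a assume a: "a \<in> B (Suc n)"
      have "mat_act R Y (B (Suc (Suc n))) (d (Suc n)) (\<lambda>a. ?\<pi> (w a)) a =
        ?\<pi> (mat_act R ?P (B (Suc (Suc n))) (d (Suc n)) w a)"
        by (rule mat_act_hom[OF P.module_axioms Y(1) \<pi> fin d_hom w(1), symmetric])
      also have "\<dots> = ?\<pi> (?u a)" by (rule arg_cong[OF w(2)[OF a, symmetric]])
      also have "\<dots> = \<zero>\<^bsub>Y\<^esub>"
        using l(2) module_hom_zero[OF P.module_axioms Y(1) \<pi>] by simp
      finally show "mat_act R Y (B (Suc (Suc n))) (d (Suc n)) (\<lambda>a. ?\<pi> (w a)) a = \<zero>\<^bsub>Y\<^esub>" .
    qed
    then obtain v where v: "v \<in> B (Suc (Suc (Suc n))) \<rightarrow> carrier Y"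
      "\<forall>a \<in> B (Suc (Suc n)). ?\<pi> (w a) = mat_act R Y (B (Suc (Suc (Suc n)))) (d (Suc (Suc n))) v a"
      by blast
    have "\<forall>a\<in>B (Suc (Suc (Suc n))). \<exists>z. z \<in> carrier ?P \<and> v a = ?\<pi> z" using v(1) C(4) by blast
    from bchoice[OF this]
    obtain V where V: "\<And>a. a \<in> B (Suc (Suc (Suc n))) \<Longrightarrow> V a \<in> carrier ?P \<and> v a = ?\<pi> (V a)" by blast
    then have VP: "V \<in> B (Suc (Suc (Suc n))) \<rightarrow> carrier ?P" by auto
    let ?DV = "mat_act R ?P (B (Suc (Suc (Suc n)))) (d (Suc (Suc n))) V"
    let ?A = "mat_act R ?P (B (Suc (Suc n))) (d (Suc n))"
    have DV: "?DV \<in> B (Suc (Suc n)) \<rightarrow> carrier ?P" using mat_act_closed[OF P.module_axioms d_hom VP] by auto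
    let ?W = "\<lambda>a. w a \<ominus>\<^bsub>?P\<^esub> ?DV a"
    have WL: "?W a \<in> ?L" if a: "a \<in> B (Suc (Suc n))" for a
    proof -
      have c: "w a \<in> carrier ?P" "?DV a \<in> carrier ?P" using a w(1) DV by auto
      have "?\<pi> (?DV a) = mat_act R Y (B (Suc (Suc (Suc n)))) (d (Suc (Suc n))) (\<lambda>a. ?\<pi> (V a)) a"
        by (rule mat_act_hom[OF P.module_axioms Y(1) \<pi> fin d_hom VP])
      also have "\<dots> = mat_act R Y (B (Suc (Suc (Suc n)))) (d (Suc (Suc n))) v a"
        by (rule mat_act_cong[OF Y(1) d_hom v(1)]) (use V in auto)
      also have "\<dots> = ?\<pi> (w a)" using v(2) a by simp
      finally have "?\<pi> (?W a) = \<zero>\<^bsub>Y\<^esub>"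
        using module_hom_minus[OF P.module_axioms Y(1) \<pi> c] module_hom_closed[OF \<pi> c(1)]
        by (simp add: Y.M.minus_eq_zero_iff)
      then show ?thesis using P.M.minus_closed[OF c] by simp
    qed
    \<comment> \<open>Consecutive differentials compose to zero, so subtracting the boundary
      \<open>?DV\<close> from \<open>w\<close> leaves its image at \<open>b\<close> equal to
      \<open>?l\<close>, while it moves the components of \<open>w\<close> into
      \<open>?L\<close>.\<close>
    have DD: "?A ?DV b = \<zero>\<^bsub>?P\<^esub>"
    proof -
      have "?A ?DV b = mat_act R ?P (B (Suc (Suc (Suc n)))) (\<lambda>x. d (Suc n) (d (Suc (Suc n)) x)) V b"
        by (rule mat_act_comp[OF P.module_axioms fin fin d_hom d_hom VP, symmetric])
      also have "\<dots> = (\<Oplus>\<^bsub>?P\<^esub>a\<in>B (Suc (Suc (Suc n))). \<zero>\<^bsub>?P\<^esub>)"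
        unfolding mat_act_def
      proof (rule P.M.finsum_cong')
        fix a assume a: "a \<in> B (Suc (Suc (Suc n)))"
        then have "d (Suc (Suc n)) (free_gen R a) \<in> K (Suc (Suc n))" by (intro exact_complexD(6)[OF F]) simp
        then have "d (Suc n) (d (Suc (Suc n)) (free_gen R a)) = (\<lambda>_. \<zero>)"
          using exact_complexD(7)[OF F] by simp
        then show "d (Suc n) (d (Suc (Suc n)) (free_gen R a)) b \<odot>\<^bsub>?P\<^esub> V a = \<zero>\<^bsub>?P\<^esub>"
          using P.smult_l_null V[OF a] by metis
      qed (use P.M.zero_closed in auto)
      finally show ?thesis by (simp del: free_module_simps)
    qed
    \<comment> \<open>By minimality of the presentation the relation \<open>?W a\<close> has entries
      in \<open>I + J\<close>. Its part over \<open>J\<close> is a relation because \<open>J\<close>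
      kills \<open>Y\<close>, hence so is its part over \<open>I\<close>.\<close>
    have "\<forall>a\<in>B (Suc (Suc n)). \<exists>p. p \<in> ?H \<and> (\<exists>q. (\<forall>x. q x \<in> J) \<and> ?W a = (\<lambda>x. p x \<oplus> q x))"
    proof
      fix a assume a: "a \<in> B (Suc (Suc n))"
      have Wc: "?W a \<in> carrier ?P" "\<And>x. ?W a x \<in> I <+>\<^bsub>R\<^esub> J" using WL[OF a] C(5) by blast+
      obtain p q where pq: "p \<in> carrier ?P" "q \<in> carrier ?P" "?W a = (\<lambda>x. p x \<oplus> q x)"
        "\<And>x. p x \<in> I" "\<And>x. q x \<in> J"
        using split_vector[OF C(1) Wc] by blast
      have "p = ?W a \<ominus>\<^bsub>?P\<^esub> q"
      proof -
        have "?W a = p \<oplus>\<^bsub>?P\<^esub> q" using pq(3) by simp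
        then show ?thesis
          using pq(1,2) by (simp add: a_minus_def P.M.a_assoc P.M.r_neg del: free_module_simps)
      qed
      then have "p \<in> ?L" using P.submoduleD(5)[OF L WL[OF a] L_J[OF pq(2,5)]] by simp
      then show "\<exists>p. p \<in> ?H \<and> (\<exists>q. (\<forall>x. q x \<in> J) \<and> ?W a = (\<lambda>x. p x \<oplus> q x))" using pq by blast
    qed
    from bchoice[OF this] obtain p where p: "\<And>a. a \<in> B (Suc (Suc n)) \<Longrightarrow>
      p a \<in> ?H \<and> (\<exists>q. (\<forall>x. q x \<in> J) \<and> ?W a = (\<lambda>x. p a x \<oplus> q x))" by blast
    have "?l = ?A w b" using w(2)[OF b(1)] by simp
    also have "\<dots> = ?A w b \<ominus>\<^bsub>?P\<^esub> ?A ?DV b"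
      using DD mat_act_closed[OF P.module_axioms d_hom w(1), of b] by (simp add: a_minus_def del: free_module_simps)
    also have "\<dots> = ?A ?W b" by (rule mat_act_diff[OF P.module_axioms fin d_hom w(1) DV, symmetric])
    \<comment> \<open>These columns have entries in \<open>I\<close>, which annihilate the parts
      over \<open>J\<close> and leave \<open>p a\<close>.\<close>
    also have "\<dots> = (\<Oplus>\<^bsub>?P\<^esub>a\<in>B (Suc (Suc n)). d (Suc n) (free_gen R a) b \<odot>\<^bsub>?P\<^esub> p a)"
      unfolding mat_act_def[of R ?P "B (Suc (Suc n))"]
    proof (rule P.M.finsum_cong')
      have dc: "d (Suc n) (free_gen R a) b \<in> I" if "a \<in> B (Suc (Suc n))" for a
        using 1[OF that] by (simp add: entries_in_def)
      show "(\<lambda>a. d (Suc n) (free_gen R a) b \<odot>\<^bsub>?P\<^esub> p a) \<in> B (Suc (Suc n)) \<rightarrow> carrier ?P"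
        using p dc I.a_Hcarr by (intro Pi_I P.smult_closed) auto
      fix a assume a: "a \<in> B (Suc (Suc n))"
      obtain q where q: "\<And>x. q x \<in> J" "?W a = (\<lambda>x. p a x \<oplus> q x)" using p[OF a] by blast
      have pR: "p a x \<in> carrier R" for x using p[OF a] I.a_Hcarr by blast
      have "d (Suc n) (free_gen R a) b \<otimes> (p a x \<oplus> q x) = d (Suc n) (free_gen R a) b \<otimes> p a x" for x
        using mult_IJ[OF dc[OF a] q(1)] I.a_Hcarr[OF dc[OF a]] J.a_Hcarr[OF q(1)] pR by (simp add: r_distr)
      then show "d (Suc n) (free_gen R a) b \<odot>\<^bsub>?P\<^esub> ?W a = d (Suc n) (free_gen R a) b \<odot>\<^bsub>?P\<^esub> p a"
        unfolding q(2) by simp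
    qed simp
    finally have eq: "c' c0 = (\<Oplus>\<^bsub>?P\<^esub>a\<in>B (Suc (Suc n)). d (Suc n) (free_gen R a) b \<odot>\<^bsub>?P\<^esub> p a)" .
    have entry: "d (Suc n) (free_gen R a) b \<in> I <+>\<^bsub>R\<^esub> J" if "a \<in> B (Suc (Suc n))" for a
      using min exact_complexD(6)[OF F, of "free_gen R a" "Suc n"] that by simp
    show False
      by (rule nakayama[OF P.module_axioms gen' c0 fin entry _ eq]) (use p in blast)+
  qed
  then have H0: "?H = {\<zero>\<^bsub>?P\<^esub>}" using ne by blast
  have "entries_in J u" if u: "u \<in> carrier ?P" "?\<pi> u = \<zero>\<^bsub>Y\<^esub>" for u
  proof -
    obtain p q where pq: "p \<in> carrier ?P" "q \<in> carrier ?P" "u = (\<lambda>x. p x \<oplus> q x)"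
      "\<And>x. p x \<in> I" "\<And>x. q x \<in> J"
      using split_vector[OF C(1) u(1) C(5)[OF u]] by blast
    have "p = u \<ominus>\<^bsub>?P\<^esub> q"
    proof -
      have "u = p \<oplus>\<^bsub>?P\<^esub> q" using pq(3) by simp
      then show ?thesis
        using pq(1,2) by (simp add: a_minus_def P.M.a_assoc P.M.r_neg del: free_module_simps)
    qed
    moreover have "u \<in> ?L" using u by simp
    ultimately have "p \<in> ?L" using P.submoduleD(5)[OF L _ L_J[OF pq(2,5)]] by simp
    then have "p = \<zero>\<^bsub>?P\<^esub>" using pq(4) H0 by blast
    then show ?thesis using pq(3,5) J.a_Hcarr by (simp add: entries_in_def)
  qed
  then show ?thesis using gen by blast
qed

end

text \<open>\<open>not_both\<close> denies the conjunction of the two conclusions that a generator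
  in degree m - 2 would produce. They are phrased inside R, so that the theorem stays free of fiber
  products; there they become the statements that T is a discrete valuation ring and that
  \<open>Y\<close> is free over S.\<close>

theorem resolution_length_one:
  fixes B :: "nat \<Rightarrow> 'x set"
  assumes F: "exact_complex R (\<lambda>i. free_module R (B i)) d K" and fin: "\<And>i. finite (B i)"
    and min: "\<forall>i. \<forall>u \<in> K i. \<forall>x. u x \<in> I <+>\<^bsub>R\<^esub> J"
    and hom: "\<And>i b. b \<in> B (Suc (Suc i)) \<Longrightarrow> homogeneous (d (Suc i) (free_gen R b))"
    and Y: "module R Y" "finitely_generated R Y" "carrier Y \<noteq> {\<zero>\<^bsub>Y\<^esub>}"
    and JY: "\<And>j y. j \<in> J \<Longrightarrow> y \<in> carrier Y \<Longrightarrow> j \<odot>\<^bsub>Y\<^esub> y = \<zero>\<^bsub>Y\<^esub>"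
    and m: "m \<ge> 4" and ex: "mat_exact R Y (B (Suc m)) (d m) (B m) (d (m - 1)) (B (m - 1))"
    and not_both: "\<not> ((\<exists>x \<in> J. (\<forall>y \<in> J. \<exists>r \<in> carrier R. y = r \<otimes> x) \<and> (\<forall>r \<in> carrier R. r \<otimes> x = \<zero> \<longrightarrow> r \<in> I)) \<and>
      (\<exists>(C :: nat set) c. minimally_generates Y (carrier Y) C c \<and>
        (\<forall>u \<in> carrier (free_module R C). lincomb R Y c u = \<zero>\<^bsub>Y\<^esub> \<longrightarrow> entries_in J u)))"
  shows "B 2 = {}"
proof -
  interpret S: split_maximal_ideal R J I by (rule swap)
  \<comment> \<open>The degrees m, m - 1 and m - 2 become \<open>k + 4\<close>, \<open>k + 3\<close>
    and \<open>k + 2\<close>, all within the range of \<open>hom\<close>, which starts in degree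
    2.\<close>
  obtain k where "m = 4 + k" using m le_Suc_ex by blast
  then have k: "m = Suc (Suc (Suc (Suc k)))" by simp
  have ex': "mat_exact R Y (B (Suc (Suc (Suc (Suc (Suc k)))))) (d (Suc (Suc (Suc (Suc k)))))
    (B (Suc (Suc (Suc (Suc k))))) (d (Suc (Suc (Suc k)))) (B (Suc (Suc (Suc k))))"
    using ex by (simp add: k)
  have 4: "entries_in I (d (Suc (Suc (Suc k))) (free_gen R b))" if b: "b \<in> B (Suc (Suc (Suc (Suc k))))" for b
    using generator_not_over_J[where B = B and d = d and K = K and n = "Suc (Suc (Suc k))", OF F fin min Y JY ex' b] hom[OF b] by (simp add: homogeneous_over)
  have 3: "entries_in J (d (Suc (Suc k)) (free_gen R b))" if b: "b \<in> B (Suc (Suc (Suc k)))" for b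
    using no_generator_over_I[where B = B and d = d and K = K and i = "Suc (Suc k)", OF F fin 4 b] hom[OF b] by (simp add: homogeneous_over)
  have 2: "entries_in I (d (Suc k) (free_gen R b))" if b: "b \<in> B (Suc (Suc k))" for b
    using S.no_generator_over_I[where B = B and d = d and K = K and i = "Suc k", OF F fin 3 b] hom[OF b] by (simp add: homogeneous_over)
  have "B (Suc (Suc k)) = {}"
  proof (rule ccontr)
    assume "B (Suc (Suc k)) \<noteq> {}"
    then obtain b0 where b0: "b0 \<in> B (Suc (Suc k))" by blast
    obtain b where b: "b \<in> B (Suc (Suc (Suc k)))" using next_generators_nonempty[where B = B and d = d and K = K, OF F fin b0 2[OF b0]] by blast
    show False
      using not_both J_principal[where B = B and d = d and K = K and i = "Suc k", OF F fin b0 2[OF b0] 3 4]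
        free_over_quotient[where B = B and d = d and K = K and n = "Suc (Suc k)", OF F fin min Y(1,2) JY ex' b 3[OF b] 4] by blast
  qed
  \<comment> \<open>A generator of either kind forces one in the next degree, so emptiness travels
    downwards as far as columns are homogeneous, that is, to degree 2.\<close>
  moreover have "B (Suc (Suc i)) = {}" if "B (Suc (Suc (Suc i))) = {}" for i
  proof (rule ccontr)
    assume "B (Suc (Suc i)) \<noteq> {}"
    then obtain b where b: "b \<in> B (Suc (Suc i))" by blast
    show False
      using next_generators_nonempty[where B = B and d = d and K = K, OF F fin b] S.next_generators_nonempty[where B = B and d = d and K = K, OF F fin b] hom[OF b] that by (auto simp: homogeneous_over)
  qed
  ultimately have "B (Suc (Suc 0)) = {}" by (induct k) auto
  then show ?thesis by (simp add: numeral_2_eq_2)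
qed

end

section \<open>Noetherian local rings\<close>

text \<open>A nonempty chain of ideals in a Noetherian ring contains its union, so Zorn's lemma
  finds its upper bounds inside the family.\<close>

lemma (in noetherian_ring) maximal_ideal_in_family:
  assumes "A \<noteq> {}" "\<And>L. L \<in> A \<Longrightarrow> ideal L R"
  shows "\<exists>M \<in> A. \<forall>L \<in> A. M \<subseteq> L \<longrightarrow> L = M"
proof (rule subset_Zorn_nonempty[OF assms(1)])
  fix C assume C: "C \<noteq> {}" "subset.chain A C"
  have "subset.chain {I. ideal I R} C"
    using C assms(2) unfolding pred_on.chain_def by auto
  then have "\<Union>C \<in> C" by (rule ideal_chain_is_trivial[OF C(1)])
  then show "\<Union>C \<in> A" using C unfolding pred_on.chain_def by blast
qed

lemma (in local_ring) max_ideal_maximal: "maximalideal (max_ideal R) R"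
  unfolding max_ideal_def by (rule theI') (rule unique_maximal)

lemma (in local_ring) max_idealI: "maximalideal L R \<Longrightarrow> max_ideal R = L"
  using max_ideal_maximal unique_maximal by blast

text \<open>Among the ideals that contain the non-unit \<open>r\<close> but not 1, a maximal member
  is a maximal ideal of the ring, hence the only one.\<close>

lemma (in local_ring) nonunit_in_max_ideal:
  assumes "r \<in> carrier R" "r \<notin> max_ideal R"
  shows "r \<in> Units R"
proof (rule ccontr)
  assume nu: "r \<notin> Units R"
  let ?A = "{L. ideal L R \<and> r \<in> L \<and> \<one> \<notin> L}"
  have "\<one> \<notin> PIdl r"
  proof
    assume "\<one> \<in> PIdl r"
    then obtain x where "x \<in> carrier R" "\<one> = x \<otimes> r" by (auto simp: cgenideal_def)
    then show False using nu assms(1) m_comm[of x r] by (force simp: Units_def)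
  qed
  then have "PIdl r \<in> ?A" using cgenideal_ideal[OF assms(1)] cgenideal_self[OF assms(1)] by simp
  then obtain M where M: "M \<in> ?A" "\<forall>L \<in> ?A. M \<subseteq> L \<longrightarrow> L = M"
    using maximal_ideal_in_family[of ?A] by blast
  have "maximalideal M R"
  proof (rule maximalidealI)
    show "ideal M R" "carrier R \<noteq> M" using M(1) by auto
    fix L assume L: "ideal L R" "M \<subseteq> L" "L \<subseteq> carrier R"
    show "L = M \<or> L = carrier R"
    proof (cases "\<one> \<in> L")
      case True
      then show ?thesis using ideal.one_imp_carrier[OF L(1)] by blast
    next
      case False
      then show ?thesis using M L by blast
    qed
  qed
  then show False using max_idealI M(1) assms(2) by blast
qed

lemma (in local_ring) max_ideal_kernel:
  assumes k: "field k" and h: "h \<in> ring_hom R k"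
  assumes surj: "h ` carrier R = carrier k"
  shows "max_ideal R = {r \<in> carrier R. h r = \<zero>\<^bsub>k\<^esub>}"
proof (rule max_idealI, rule maximalidealI)
  interpret k: field k by (rule k)
  interpret h: ring_hom_cring R k h
    by (intro ring_hom_cring.intro ring_hom_cring_axioms.intro is_cring k.is_cring h)
  let ?N = "{r \<in> carrier R. h r = \<zero>\<^bsub>k\<^esub>}"
  show N: "ideal ?N R" by (rule ideal_closedI) auto
  show "carrier R \<noteq> ?N"
    using one_closed by (auto simp: set_eq_iff) (metis h.hom_one k.one_not_zero one_closed)
  fix L assume L: "ideal L R" "?N \<subseteq> L" "L \<subseteq> carrier R"
  interpret L: ideal L R by (rule L(1))
  show "L = ?N \<or> L = carrier R"
  proof (cases "L \<subseteq> ?N")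
    case False
    then obtain x where x: "x \<in> L" "x \<in> carrier R" "h x \<noteq> \<zero>\<^bsub>k\<^esub>" using L(3) by blast
    then have "h x \<in> Units k" using k.field_Units h.hom_closed by blast
    then have "inv\<^bsub>k\<^esub> h x \<in> carrier k" "h x \<otimes>\<^bsub>k\<^esub> inv\<^bsub>k\<^esub> h x = \<one>\<^bsub>k\<^esub>" by auto
    then obtain y where y: "y \<in> carrier R" "h x \<otimes>\<^bsub>k\<^esub> h y = \<one>\<^bsub>k\<^esub>" using surj by (metis imageE)
    \<comment> \<open>\<open>y\<close> lifts the inverse of \<open>h x\<close>; the kernel lies in
      \<open>L\<close>, so 1 is a sum of two elements of \<open>L\<close>.\<close>
    have "h (\<one> \<ominus> x \<otimes> y) = \<zero>\<^bsub>k\<^esub>"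
      using x(2) y by (simp add: a_minus_def k.r_neg)
    then have "\<one> \<ominus> x \<otimes> y \<in> L" using L(2) x(2) y(1) by auto
    moreover have xy: "x \<otimes> y \<in> L" using L.I_r_closed[OF x(1) y(1)] .
    ultimately have "(\<one> \<ominus> x \<otimes> y) \<oplus> x \<otimes> y \<in> L" by (rule L.a_closed)
    moreover have "(\<one> \<ominus> x \<otimes> y) \<oplus> x \<otimes> y = \<one>"
      using x(2) y(1) by (simp add: a_minus_def a_assoc l_neg)
    ultimately show ?thesis using L.one_imp_carrier by simp
  qed (use L(2) in blast)
qed

text \<open>Multiply elements outside \<open>P\<close>, one from \<open>N\<close> and one from each
  \<open>Q\<close>; the product avoids \<open>P\<close> because \<open>P\<close> is prime.\<close>

lemma (in cring) avoiding_element: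
  assumes fin: "finite \<Psi>" and P: "primeideal P R" and N: "ideal N R" "\<not> N \<subseteq> P"
    and \<Psi>: "\<And>Q. Q \<in> \<Psi> \<Longrightarrow> ideal Q R \<and> \<not> Q \<subseteq> P"
  shows "\<exists>w \<in> N. w \<notin> P \<and> (\<forall>Q \<in> \<Psi>. w \<in> Q)"
  using fin \<Psi>
proof induct
  case empty
  then show ?case using N(2) by blast
next
  case (insert Q \<Psi>)
  then obtain w where w: "w \<in> N" "w \<notin> P" "\<forall>Q \<in> \<Psi>. w \<in> Q" by blast
  obtain q where q: "q \<in> Q" "q \<notin> P" using insert(4) by blast
  have c: "w \<in> carrier R" "q \<in> carrier R"
    using w(1) q(1) insert(4)[of Q] N(1) by (auto intro: ideal.Icarr)
  have "w \<otimes> q \<notin> P" using primeideal.I_prime[OF P c] w(2) q(2) by blast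
  moreover have "w \<otimes> q \<in> N" using ideal.I_r_closed[OF N(1) w(1) c(2)] .
  moreover have "w \<otimes> q \<in> Q'" if "Q' \<in> insert Q \<Psi>" for Q'
    using that w(3) q(1) c insert(4)[of Q'] ideal.I_l_closed ideal.I_r_closed by (metis insert_iff)
  ultimately show ?case by blast
qed

section \<open>Zero divisors and the maximal annihilators of elements\<close>

definition (in ring) annihilator :: "'a \<Rightarrow> 'a set"
  where "annihilator x = {r \<in> carrier R. r \<otimes> x = \<zero>}"

lemma (in cring) annihilator_ideal:
  assumes "x \<in> carrier R"
  shows "ideal (annihilator x) R"
  unfolding annihilator_def
  by (rule ideal_closedI) (use assms in \<open>auto simp: l_distr m_assoc\<close>)

text \<open>In a commutative Noetherian ring these are the maximal associated primes. They cover the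
  zero divisors, and one of them contained in another equals it.\<close>

definition (in ring) maximal_annihilator :: "'a set \<Rightarrow> bool"
  where "maximal_annihilator P \<longleftrightarrow> (\<exists>x \<in> carrier R - {\<zero>}. P = annihilator x) \<and>
    (\<forall>x \<in> carrier R - {\<zero>}. P \<subseteq> annihilator x \<longrightarrow> annihilator x = P)"

text \<open>If \<open>b\<close> does not kill \<open>x\<close>, the annihilator of the nonzero
  element \<open>b \<otimes> x\<close> contains \<open>P\<close>, so it equals \<open>P\<close> by
  maximality; and it contains \<open>a\<close>.\<close>

lemma (in cring) maximal_annihilator_prime:
  assumes "maximal_annihilator P"
  shows "primeideal P R"
proof -
  obtain x where x: "x \<in> carrier R" "x \<noteq> \<zero>" "P = annihilator x"
    and max: "\<And>y. y \<in> carrier R \<Longrightarrow> y \<noteq> \<zero> \<Longrightarrow> P \<subseteq> annihilator y \<Longrightarrow> annihilator y = P"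
    using assms unfolding maximal_annihilator_def by blast
  show ?thesis
  proof (rule primeidealI)
    show "ideal P R" using annihilator_ideal x by simp
    show "cring R" by (rule is_cring)
    have "\<one> \<notin> P" using x by (simp add: annihilator_def)
    then show "carrier R \<noteq> P" by blast
    fix a b assume ab: "a \<in> carrier R" "b \<in> carrier R" "a \<otimes> b \<in> P"
    show "a \<in> P \<or> b \<in> P"
    proof (cases "b \<in> P")
      case False
      then have bx: "b \<otimes> x \<in> carrier R" "b \<otimes> x \<noteq> \<zero>" using ab x by (auto simp: annihilator_def)
      have "P \<subseteq> annihilator (b \<otimes> x)"
      proof
        fix r assume "r \<in> P"
        then have "r \<in> carrier R" "r \<otimes> x = \<zero>" using x by (auto simp: annihilator_def)
        moreover from this have "r \<otimes> (b \<otimes> x) = b \<otimes> (r \<otimes> x)" using ab x by (simp add: m_lcomm)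
        ultimately show "r \<in> annihilator (b \<otimes> x)" using ab x by (simp add: annihilator_def)
      qed
      then have "annihilator (b \<otimes> x) = P" using max[OF bx] by blast
      moreover have "a \<in> annihilator (b \<otimes> x)"
        using ab x by (simp add: annihilator_def m_assoc)
      ultimately show ?thesis by blast
    qed simp
  qed
qed

text \<open>A maximal member of the family of annihilators containing \<open>z\<close> is maximal
  among all annihilators of nonzero elements, as any larger one contains \<open>z\<close>
  too.\<close>

lemma zero_divisor_in_maximal_annihilator:
  assumes "cring R" "noetherian_ring R" "z \<in> carrier R" "x \<in> carrier R" "x \<noteq> \<zero>\<^bsub>R\<^esub>" "z \<otimes>\<^bsub>R\<^esub> x = \<zero>\<^bsub>R\<^esub>"
  shows "\<exists>P. ring.maximal_annihilator R P \<and> z \<in> P"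
proof -
  interpret cring R by fact
  interpret noetherian_ring R by fact
  let ?A = "{annihilator x | x. x \<in> carrier R - {\<zero>\<^bsub>R\<^esub>} \<and> z \<in> annihilator x}"
  have "annihilator x \<in> ?A" using assms(3-6) by (auto simp: annihilator_def)
  then obtain P where P: "P \<in> ?A" "\<forall>L \<in> ?A. P \<subseteq> L \<longrightarrow> L = P"
    using maximal_ideal_in_family[of ?A] annihilator_ideal by blast
  then have "maximal_annihilator P" unfolding maximal_annihilator_def by blast
  then show ?thesis using P(1) by blast
qed

text \<open>Choose for each maximal annihilator an element it annihilates. Among the ideals
  generated by finitely many of these elements a maximal one, \<open>L\<close>, contains them all,
  and the finite set \<open>\<Phi>\<close> behind it turns out to exhaust the maximal
  annihilators.\<close>

lemma finite_maximal_annihilators: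
  assumes "cring R" "noetherian_ring R"
  shows "finite {P. ring.maximal_annihilator R P}"
proof -
  interpret cring R by fact
  interpret noetherian_ring R by fact
  let ?M = "{P. maximal_annihilator P}"
  have "\<forall>P\<in>?M. \<exists>x. x \<in> carrier R \<and> x \<noteq> \<zero>\<^bsub>R\<^esub> \<and> P = annihilator x"
    unfolding maximal_annihilator_def by blast
  from bchoice[OF this] obtain x where x: "\<And>P. P \<in> ?M \<Longrightarrow> x P \<in> carrier R \<and> x P \<noteq> \<zero>\<^bsub>R\<^esub> \<and> P = annihilator (x P)"
    by blast
  let ?A = "{Idl\<^bsub>R\<^esub> (x ` \<Phi>) | \<Phi>. finite \<Phi> \<and> \<Phi> \<subseteq> ?M}"
  have idl: "ideal (Idl\<^bsub>R\<^esub> (x ` \<Phi>)) R" "x ` \<Phi> \<subseteq> Idl\<^bsub>R\<^esub> (x ` \<Phi>)" if "\<Phi> \<subseteq> ?M" for \<Phi>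
    using that x by (auto intro!: genideal_ideal genideal_self)
  have "Idl\<^bsub>R\<^esub> (x ` {}) \<in> ?A" by blast
  then obtain L where L: "L \<in> ?A" "\<forall>L' \<in> ?A. L \<subseteq> L' \<longrightarrow> L' = L"
    using maximal_ideal_in_family[of ?A] idl(1) by blast
  then obtain \<Phi> where \<Phi>: "L = Idl\<^bsub>R\<^esub> (x ` \<Phi>)" "finite \<Phi>" "\<Phi> \<subseteq> ?M" by blast
  have "?M \<subseteq> \<Phi>"
  proof
    fix Q assume Q: "Q \<in> ?M"
    then have Q': "insert Q \<Phi> \<subseteq> ?M" using \<Phi>(3) by blast
    have "L \<subseteq> Idl\<^bsub>R\<^esub> (x ` insert Q \<Phi>)"
      unfolding \<Phi>(1) by (rule genideal_minimal[OF idl(1)[OF Q']]) (use idl(2)[OF Q'] in blast)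
    moreover have "Idl\<^bsub>R\<^esub> (x ` insert Q \<Phi>) \<in> ?A" using \<Phi>(2) Q' by blast
    ultimately have "x Q \<in> L" using L(2) idl(2)[OF Q'] by blast
    \<comment> \<open>Otherwise some \<open>w\<close> outside \<open>Q\<close> lies in every member
      of \<open>\<Phi>\<close>. It kills the generators of \<open>L\<close>, hence also
      \<open>x Q\<close>, and so belongs to \<open>Q\<close> after all.\<close>
    have "\<exists>P \<in> \<Phi>. P \<subseteq> Q"
    proof (rule ccontr)
      assume no: "\<not> (\<exists>P \<in> \<Phi>. P \<subseteq> Q)"
      have prime: "primeideal Q R" using maximal_annihilator_prime Q by blast
      have "\<not> carrier R \<subseteq> Q"
        using primeideal.I_notcarr[OF prime] ideal.Icarr[OF primeideal.axioms(1)[OF prime]] by blast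
      moreover have "ideal P R \<and> \<not> P \<subseteq> Q" if "P \<in> \<Phi>" for P
        using that no \<Phi>(3) maximal_annihilator_prime primeideal.axioms(1) by blast
      ultimately obtain w where w: "w \<in> carrier R" "w \<notin> Q" "\<forall>P \<in> \<Phi>. w \<in> P"
        using avoiding_element[OF \<Phi>(2) prime oneideal] by blast
      have "x ` \<Phi> \<subseteq> annihilator w"
      proof
        fix y assume "y \<in> x ` \<Phi>"
        then obtain P where P: "P \<in> \<Phi>" "y = x P" by blast
        then have "w \<in> annihilator y" "y \<in> carrier R" using w(3) x \<Phi>(3) by blast+
        then show "y \<in> annihilator w" using w(1) by (simp add: annihilator_def m_comm)
      qed
      then have "L \<subseteq> annihilator w" unfolding \<Phi>(1) by (rule genideal_minimal[OF annihilator_ideal[OF w(1)]])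
      then have "x Q \<in> annihilator w" using \<open>x Q \<in> L\<close> by blast
      then have "w \<in> annihilator (x Q)" using w(1) x[OF Q, THEN conjunct1] by (simp add: annihilator_def m_comm)
      then show False using w(2) x[OF Q] by blast
    qed
    then obtain P where P: "P \<in> \<Phi>" "P \<subseteq> Q" by blast
    then have "maximal_annihilator P" using \<Phi>(3) by blast
    then have "P = Q" using P(2) x[OF Q] unfolding maximal_annihilator_def by blast
    then show "Q \<in> \<Phi>" using P(1) by simp
  qed
  then show ?thesis using \<Phi>(2) by (rule finite_subset)
qed

text \<open>If an element \<open>z\<close> of \<open>N\<close> lies in as few of the finitely many maximal annihilators as possible, but in
  one of them, \<open>P\<close>, that does not contain \<open>N\<close>, then adding an element of \<open>N\<close> that avoids \<open>P\<close> and lies in all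
  those not containing \<open>z\<close> would lower their number.\<close>

lemma zero_divisors_common_annihilator:
  assumes "cring R" "noetherian_ring R" "ideal N R"
    and zd: "\<And>z. z \<in> N \<Longrightarrow> \<exists>x \<in> carrier R. x \<noteq> \<zero>\<^bsub>R\<^esub> \<and> z \<otimes>\<^bsub>R\<^esub> x = \<zero>\<^bsub>R\<^esub>"
  shows "\<exists>x \<in> carrier R. x \<noteq> \<zero>\<^bsub>R\<^esub> \<and> (\<forall>z \<in> N. z \<otimes>\<^bsub>R\<^esub> x = \<zero>\<^bsub>R\<^esub>)"
proof (rule ccontr)
  assume no: "\<not> ?thesis"
  interpret cring R by fact
  interpret N: ideal N R by fact
  let ?M = "{P. maximal_annihilator P}"
  have fin: "finite ?M" by (rule finite_maximal_annihilators[OF assms(1,2)])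
  have prime: "primeideal P R" if "P \<in> ?M" for P using maximal_annihilator_prime that by blast
  have NP: "\<not> N \<subseteq> P" if "P \<in> ?M" for P
    using that no unfolding maximal_annihilator_def annihilator_def by blast
  let ?c = "\<lambda>z. card {P \<in> ?M. z \<in> P}"
  obtain z where z: "z \<in> N" "\<And>y. y \<in> N \<Longrightarrow> ?c z \<le> ?c y"
    using ex_has_least_nat[of "\<lambda>z. z \<in> N" "\<zero>\<^bsub>R\<^esub>" ?c] N.zero_closed by blast
  obtain x where "x \<in> carrier R" "x \<noteq> \<zero>\<^bsub>R\<^esub>" "z \<otimes>\<^bsub>R\<^esub> x = \<zero>\<^bsub>R\<^esub>" using zd[OF z(1)] by blast
  then obtain P where P: "P \<in> ?M" "z \<in> P"
    using zero_divisor_in_maximal_annihilator[OF assms(1,2) N.Icarr[OF z(1)]] by blast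
  let ?\<Psi> = "{Q \<in> ?M. z \<notin> Q}"
  have "ideal Q R \<and> \<not> Q \<subseteq> P" if Q: "Q \<in> ?\<Psi>" for Q
  proof
    show "ideal Q R" using prime[of Q] Q primeideal.axioms(1) by blast
    show "\<not> Q \<subseteq> P"
    proof
      assume "Q \<subseteq> P"
      then have "P = Q" using Q P(1) unfolding maximal_annihilator_def by blast
      then show False using Q P(2) by blast
    qed
  qed
  then obtain w where w: "w \<in> N" "w \<notin> P" "\<forall>Q \<in> ?\<Psi>. w \<in> Q"
    using avoiding_element[of ?\<Psi>, OF _ prime[OF P(1)] assms(3) NP[OF P(1)]] fin by auto
  have zw: "z \<in> carrier R" "w \<in> carrier R" using z(1) w(1) by auto
  have sub: "w' \<in> Q" if "z' \<in> Q" "z' \<oplus>\<^bsub>R\<^esub> w' \<in> Q" "Q \<in> ?M" "z' \<in> carrier R" "w' \<in> carrier R" for z' w' Q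
  proof -
    interpret Q: ideal Q R using prime[OF that(3)] primeideal.axioms(1) by blast
    have "\<ominus>\<^bsub>R\<^esub> z' \<oplus>\<^bsub>R\<^esub> (z' \<oplus>\<^bsub>R\<^esub> w') \<in> Q" using that(1,2) by simp
    then show ?thesis using that(4,5) by (simp add: a_assoc[symmetric] l_neg)
  qed
  have "{Q \<in> ?M. z \<oplus>\<^bsub>R\<^esub> w \<in> Q} \<subset> {Q \<in> ?M. z \<in> Q}"
  proof
    show "{Q \<in> ?M. z \<oplus>\<^bsub>R\<^esub> w \<in> Q} \<subseteq> {Q \<in> ?M. z \<in> Q}"
    proof
      fix Q assume Q: "Q \<in> {Q \<in> ?M. z \<oplus>\<^bsub>R\<^esub> w \<in> Q}"
      show "Q \<in> {Q \<in> ?M. z \<in> Q}"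
        using Q w(3) sub[of w Q z] zw a_comm[OF zw] by force
    qed
    show "{Q \<in> ?M. z \<oplus>\<^bsub>R\<^esub> w \<in> Q} \<noteq> {Q \<in> ?M. z \<in> Q}"
      using P w(2) sub[of z P w] zw by blast
  qed
  then have "?c (z \<oplus>\<^bsub>R\<^esub> w) < ?c z" by (rule psubset_card_mono[rotated]) (use fin in auto)
  moreover have "?c z \<le> ?c (z \<oplus>\<^bsub>R\<^esub> w)" using z(2)[of "z \<oplus>\<^bsub>R\<^esub> w"] z(1) w(1) by simp
  ultimately show False by simp
qed

text \<open>Depth zero keeps \<open>[z]\<close> from being regular for each \<open>z\<close> in the
  maximal ideal. Since \<open>z\<close> generates a proper ideal, it must be a zero divisor, and the
  separate witnesses merge into one by \<open>zero_divisors_common_annihilator\<close>.\<close>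

lemma (in local_ring) depth_zero_socle:
  assumes "depth R = 0"
  shows "\<exists>s \<in> carrier R. s \<noteq> \<zero> \<and> (\<forall>z \<in> max_ideal R. z \<otimes> s = \<zero>)"
proof (rule zero_divisors_common_annihilator[OF is_cring noetherian_ring_axioms])
  interpret N: maximalideal "max_ideal R" R by (rule max_ideal_maximal)
  show N: "ideal (max_ideal R) R" by (rule N.ideal_axioms)
  fix z assume z: "z \<in> max_ideal R"
  show "\<exists>x \<in> carrier R. x \<noteq> \<zero> \<and> z \<otimes> x = \<zero>"
  proof (rule ccontr)
    assume no: "\<not> ?thesis"
    \<comment> \<open>Position 0 of a regular sequence is tested modulo the ideal generated by no
      elements, which has to be identified with zero.\<close>
    have "Idl {} \<subseteq> {\<zero>}" by (rule genideal_minimal[OF zeroideal]) simp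
    moreover have "ideal (Idl {}) R" by (rule genideal_ideal) simp
    ultimately have Idl0: "Idl {} = {\<zero>}"
      using additive_subgroup.zero_closed[OF ideal.axioms(1)] by blast
    have "Idl {z} \<subseteq> max_ideal R" by (rule genideal_minimal[OF N]) (use z in simp)
    then have "Idl {z} \<noteq> carrier R" using N.I_notcarr N.Icarr by blast
    then have "regular_sequence R [z]"
      using no z by (auto simp: regular_sequence_def Idl0)
    then have "enat (length [z]) \<le> depth R"
      unfolding depth_def using z by (intro SUP_upper) auto
    then show False using assms by (simp add: zero_enat_def)
  qed
qed

text \<open>Everything rests on \<open>form\<close>: each nonzero element is a unit times a power of
  \<open>x\<close>. Regularity of \<open>x\<close> keeps its powers nonzero, which gives a domain,
  and ideals are generated by powers of \<open>x\<close>.\<close>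

lemma (in local_ring) discrete_valuation_ringI:
  assumes x: "x \<in> max_ideal R" and gen: "\<And>y. y \<in> max_ideal R \<Longrightarrow> \<exists>r \<in> carrier R. y = r \<otimes> x"
    and reg: "\<And>r. r \<in> carrier R \<Longrightarrow> r \<otimes> x = \<zero> \<Longrightarrow> r = \<zero>"
  shows "discrete_valuation_ring R"
proof -
  interpret N: maximalideal "max_ideal R" R by (rule max_ideal_maximal)
  have xR: "x \<in> carrier R" using x by simp
  have one_N: "\<one> \<notin> max_ideal R" using N.one_imp_carrier N.I_notcarr by blast
  have nz: "\<one> \<noteq> \<zero>" using one_N N.zero_closed by metis
  let ?form = "\<lambda>b. \<exists>u n. u \<in> Units R \<and> b = u \<otimes> x [^] (n :: nat)"
  have form: "?form b" if b: "b \<in> carrier R" "b \<noteq> \<zero>" for b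
  proof (rule ccontr)
    assume nf: "\<not> ?form b"
    let ?A = "{PIdl c | c. c \<in> carrier R \<and> c \<noteq> \<zero> \<and> \<not> ?form c}"
    have "PIdl b \<in> ?A" using b nf by blast
    then obtain L where L: "L \<in> ?A" "\<forall>L' \<in> ?A. L \<subseteq> L' \<longrightarrow> L' = L"
      using maximal_ideal_in_family[of ?A] cgenideal_ideal by blast
    then obtain c where c: "L = PIdl c" "c \<in> carrier R" "c \<noteq> \<zero>" "\<not> ?form c" by blast
    have "c \<notin> Units R"
    proof
      assume "c \<in> Units R"
      then have "c \<in> Units R \<and> c = c \<otimes> x [^] (0 :: nat)" using c(2) by simp
      then show False using c(4) by blast
    qed
    then obtain r where r: "r \<in> carrier R" "c = r \<otimes> x" using gen nonunit_in_max_ideal c(2) by blast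
    have "\<not> ?form r"
    proof
      assume "?form r"
      then obtain u and n :: nat where u: "u \<in> Units R" "r = u \<otimes> x [^] n" by blast
      then have "c = u \<otimes> x [^] Suc n" using r(2) xR by (simp add: m_assoc Units_closed)
      then show False using c(4) u(1) by blast
    qed
    moreover have "r \<noteq> \<zero>" using r c(3) xR by auto
    ultimately have "PIdl r \<in> ?A" using r(1) by blast
    moreover have "PIdl c \<subseteq> PIdl r"
      by (rule cgenideal_minimal[OF cgenideal_ideal[OF r(1)]])
        (use r xR m_comm[of r x] in \<open>auto simp: cgenideal_def\<close>)
    \<comment> \<open>The counterexample \<open>c\<close> has a maximal principal ideal, so its
      quotient \<open>r\<close> by \<open>x\<close>, again a counterexample, generates the same
      ideal. Then \<open>r\<close> is \<open>s \<otimes> x \<otimes> r\<close>, and as 1 - s x is a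
      unit, \<open>r\<close> is zero.\<close>
    ultimately have "r \<in> PIdl c" using L(2) c(1) cgenideal_self[OF r(1)] by blast
    then obtain s where s: "s \<in> carrier R" "r = s \<otimes> c" by (auto simp: cgenideal_def)
    have sx: "s \<otimes> x \<in> max_ideal R" using x s(1) by (rule N.I_l_closed)
    have "(\<one> \<ominus> s \<otimes> x) \<otimes> r = r \<ominus> s \<otimes> x \<otimes> r"
      using s(1) xR r(1) by (simp add: a_minus_def l_distr l_minus)
    also have "s \<otimes> x \<otimes> r = r" using s r xR m_comm[of r x] by (simp add: m_assoc)
    finally have z: "(\<one> \<ominus> s \<otimes> x) \<otimes> r = \<zero>" using r(1) by simp
    have "\<one> \<ominus> s \<otimes> x \<notin> max_ideal R"
    proof
      assume "\<one> \<ominus> s \<otimes> x \<in> max_ideal R"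
      then have "(\<one> \<ominus> s \<otimes> x) \<oplus> s \<otimes> x \<in> max_ideal R" using sx by simp
      then show False using one_N s(1) xR by (simp add: a_minus_def a_assoc l_neg)
    qed
    then have U: "\<one> \<ominus> s \<otimes> x \<in> Units R" using nonunit_in_max_ideal s(1) xR by simp
    then have "inv (\<one> \<ominus> s \<otimes> x) \<otimes> ((\<one> \<ominus> s \<otimes> x) \<otimes> r) = r"
      using r(1) s(1) xR by (simp add: m_assoc[symmetric])
    then show False using z U \<open>r \<noteq> \<zero>\<close> by simp
  qed
  have pow: "x [^] (n :: nat) \<noteq> \<zero>" for n
    by (induct n) (use nz reg xR in auto)
  have dom: "domain R"
  proof (rule domain.intro[OF is_cring], unfold_locales)
    show "\<one> \<noteq> \<zero>" by (rule nz)
    fix a b assume ab: "a \<otimes> b = \<zero>" "a \<in> carrier R" "b \<in> carrier R"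
    show "a = \<zero> \<or> b = \<zero>"
    proof (rule ccontr)
      assume "\<not> ?thesis"
      then obtain u v and n m :: nat where uv: "u \<in> Units R" "v \<in> Units R" "a = u \<otimes> x [^] n" "b = v \<otimes> x [^] m"
        using form ab(2,3) by metis
      have "inv v \<otimes> (inv u \<otimes> (a \<otimes> b)) = (inv u \<otimes> u) \<otimes> (inv v \<otimes> v) \<otimes> (x [^] n \<otimes> x [^] m)"
        unfolding uv(3,4) using uv(1,2) xR by (simp add: m_ac Units_closed del: Units_l_inv Units_r_inv)
      also have "\<dots> = x [^] (n + m)" using uv(1,2) xR by (simp add: nat_pow_mult)
      finally show False using pow[of "n + m"] ab(1) uv(1,2) by simp
    qed
  qed
  \<comment> \<open>The least power of \<open>x\<close> in \<open>L\<close> generates it, because a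
    unit multiple of a power lies in \<open>L\<close> together with that power.\<close>
  have principal: "\<exists>a \<in> carrier R. L = PIdl a" if L: "ideal L R" for L
  proof (cases "L = {\<zero>}")
    case True
    then show ?thesis by (intro bexI[of _ \<zero>]) (auto simp: cgenideal_def intro!: exI[of _ \<zero>])
  next
    case False
    interpret L: ideal L R by (rule L)
    have power_mem: "x [^] n \<in> L" if "u \<in> Units R" "u \<otimes> x [^] n \<in> L" for u and n :: nat
    proof -
      have "inv u \<otimes> (u \<otimes> x [^] n) \<in> L" using that by (simp add: L.I_l_closed)
      then show ?thesis using that(1) xR by (simp add: m_assoc[symmetric] Units_closed)
    qed
    obtain a where a: "a \<in> L" "a \<noteq> \<zero>" using False L.zero_closed by blast
    then obtain n0 :: nat where "x [^] n0 \<in> L" using form[of a] power_mem by (metis L.Icarr)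
    then have n: "x [^] (LEAST n :: nat. x [^] n \<in> L) \<in> L" by (rule LeastI)
    let ?n = "LEAST n :: nat. x [^] n \<in> L"
    have "L = PIdl (x [^] ?n)"
    proof
      show "PIdl (x [^] ?n) \<subseteq> L" by (rule cgenideal_minimal[OF L n])
      show "L \<subseteq> PIdl (x [^] ?n)"
      proof
        fix y assume y: "y \<in> L"
        interpret P: ideal "PIdl (x [^] ?n)" R by (rule cgenideal_ideal) (use xR in simp)
        show "y \<in> PIdl (x [^] ?n)"
        proof (cases "y = \<zero>")
          case False
          then obtain u and k :: nat where u: "u \<in> Units R" "y = u \<otimes> x [^] k" using form[of y] y by auto
          then have "?n \<le> k" using power_mem y by (intro Least_le) blast
          then have "y = (u \<otimes> x [^] (k - ?n)) \<otimes> x [^] ?n"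
            using u xR by (simp add: m_assoc Units_closed nat_pow_mult)
          moreover have "u \<otimes> x [^] (k - ?n) \<in> carrier R" using u(1) xR by (simp add: Units_closed)
          ultimately show ?thesis unfolding cgenideal_def by blast
        qed simp
      qed
    qed
    then show ?thesis using xR by blast
  qed
  have "\<not> field R"
  proof
    assume "field R"
    moreover have "x \<noteq> \<zero>" using reg[of \<one>] nz xR by auto
    ultimately have "x \<in> Units R" using field.field_Units[of R] xR by blast
    then have "inv x \<otimes> x \<in> max_ideal R" using x by (intro N.I_l_closed) auto
    then show False using \<open>x \<in> Units R\<close> one_N by simp
  qed
  then show ?thesis
    using dom principal
    by (intro discrete_valuation_ring.intro discrete_valuation_ring_axioms.intro local_ring_axioms
        principal_domain.intro principal_domain_axioms.intro)
qed

section \<open>Fiber products\<close>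

lemma fiber_product_simps [simp]:
  "carrier (fiber_product S T p q) = {(s, t). s \<in> carrier S \<and> t \<in> carrier T \<and> p s = q t}"
  "x \<otimes>\<^bsub>fiber_product S T p q\<^esub> y = (fst x \<otimes>\<^bsub>S\<^esub> fst y, snd x \<otimes>\<^bsub>T\<^esub> snd y)"
  "x \<oplus>\<^bsub>fiber_product S T p q\<^esub> y = (fst x \<oplus>\<^bsub>S\<^esub> fst y, snd x \<oplus>\<^bsub>T\<^esub> snd y)"
  "\<one>\<^bsub>fiber_product S T p q\<^esub> = (\<one>\<^bsub>S\<^esub>, \<one>\<^bsub>T\<^esub>)"
  "\<zero>\<^bsub>fiber_product S T p q\<^esub> = (\<zero>\<^bsub>S\<^esub>, \<zero>\<^bsub>T\<^esub>)"
  by (auto simp: fiber_product_def RDirProd_def DirProd_def monoid.defs split: prod.splits)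

locale local_fiber_product = S: local_ring S + T: local_ring T + k: field k
  for S :: "'s ring" and T :: "'t ring" and k :: "'k ring" +
  fixes \<pi>\<^sub>S :: "'s \<Rightarrow> 'k" and \<pi>\<^sub>T :: "'t \<Rightarrow> 'k"
  assumes hom_S: "\<pi>\<^sub>S \<in> ring_hom S k" and surj_S: "\<pi>\<^sub>S ` carrier S = carrier k"
    and hom_T: "\<pi>\<^sub>T \<in> ring_hom T k" and surj_T: "\<pi>\<^sub>T ` carrier T = carrier k"
    and not_iso_S: "\<pi>\<^sub>S \<notin> ring_iso S k" and not_iso_T: "\<pi>\<^sub>T \<notin> ring_iso T k"
begin

abbreviation "R \<equiv> fiber_product S T \<pi>\<^sub>S \<pi>\<^sub>T"

interpretation p: ring_hom_cring S k \<pi>\<^sub>S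
  by (intro ring_hom_cring.intro ring_hom_cring_axioms.intro S.is_cring k.is_cring hom_S)

interpretation q: ring_hom_cring T k \<pi>\<^sub>T
  by (intro ring_hom_cring.intro ring_hom_cring_axioms.intro T.is_cring k.is_cring hom_T)

lemma max_S: "max_ideal S = {s \<in> carrier S. \<pi>\<^sub>S s = \<zero>\<^bsub>k\<^esub>}"
  by (rule S.max_ideal_kernel[OF k.field_axioms hom_S surj_S])

lemma max_T: "max_ideal T = {t \<in> carrier T. \<pi>\<^sub>T t = \<zero>\<^bsub>k\<^esub>}"
  by (rule T.max_ideal_kernel[OF k.field_axioms hom_T surj_T])

lemma lift_S: "s \<in> carrier S \<Longrightarrow> \<exists>t. (s, t) \<in> carrier R"
proof -
  assume s: "s \<in> carrier S"
  then have "\<pi>\<^sub>S s \<in> \<pi>\<^sub>T ` carrier T" using surj_T p.hom_closed by simp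
  then show ?thesis using s by auto
qed

lemma lift_T: "t \<in> carrier T \<Longrightarrow> \<exists>s. (s, t) \<in> carrier R"
proof -
  assume t: "t \<in> carrier T"
  then have "\<pi>\<^sub>T t \<in> \<pi>\<^sub>S ` carrier S" using surj_S q.hom_closed by simp
  then obtain s where "s \<in> carrier S" "\<pi>\<^sub>T t = \<pi>\<^sub>S s" by blast
  then show ?thesis using t by (intro exI[of _ s]) simp
qed

lemma cring_R: "cring R"
proof (rule cringI)
  show "abelian_group R"
  proof (rule abelian_groupI)
    fix x assume "x \<in> carrier R"
    then show "\<exists>y\<in>carrier R. y \<oplus>\<^bsub>R\<^esub> x = \<zero>\<^bsub>R\<^esub>"
      by (intro bexI[of _ "(\<ominus>\<^bsub>S\<^esub> fst x, \<ominus>\<^bsub>T\<^esub> snd x)"]) (auto simp: S.l_neg T.l_neg)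
  qed (auto simp: S.a_ac T.a_ac)
  show "comm_monoid R"
    by (rule comm_monoidI) (auto simp: S.m_ac T.m_ac)
qed (auto simp: S.l_distr T.l_distr)

interpretation R: cring R by (rule cring_R)

definition "I = max_ideal S \<times> {\<zero>\<^bsub>T\<^esub>}"
definition "J = {\<zero>\<^bsub>S\<^esub>} \<times> max_ideal T"

lemma sum_IJ: "I <+>\<^bsub>R\<^esub> J = max_ideal S \<times> max_ideal T"
proof
  show "I <+>\<^bsub>R\<^esub> J \<subseteq> max_ideal S \<times> max_ideal T"
    by (auto simp: set_add_def' I_def J_def max_S max_T)
  show "max_ideal S \<times> max_ideal T \<subseteq> I <+>\<^bsub>R\<^esub> J"
  proof
    fix x assume x: "x \<in> max_ideal S \<times> max_ideal T"
    then have "(fst x, \<zero>\<^bsub>T\<^esub>) \<in> I" "(\<zero>\<^bsub>S\<^esub>, snd x) \<in> J" "x = (fst x, \<zero>\<^bsub>T\<^esub>) \<oplus>\<^bsub>R\<^esub> (\<zero>\<^bsub>S\<^esub>, snd x)"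
      by (auto simp: I_def J_def max_S max_T)
    then show "x \<in> I <+>\<^bsub>R\<^esub> J" unfolding set_add_def' by blast
  qed
qed

text \<open>The condition S \<noteq> k enters here: with a zero kernel the surjection onto
  \<open>k\<close> would be an isomorphism.\<close>

lemma max_S_nonzero: "\<exists>s \<in> max_ideal S. s \<noteq> \<zero>\<^bsub>S\<^esub>"
proof (rule ccontr)
  assume no: "\<not> ?thesis"
  have "inj_on \<pi>\<^sub>S (carrier S)"
  proof (rule inj_onI)
    fix x y assume xy: "x \<in> carrier S" "y \<in> carrier S" "\<pi>\<^sub>S x = \<pi>\<^sub>S y"
    then have "\<pi>\<^sub>S (x \<ominus>\<^bsub>S\<^esub> y) = \<zero>\<^bsub>k\<^esub>" by (simp add: a_minus_def k.r_neg)
    then have "x \<ominus>\<^bsub>S\<^esub> y = \<zero>\<^bsub>S\<^esub>" using no xy by (auto simp: max_S)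
    then show "x = y" using xy by simp
  qed
  then show False using not_iso_S hom_S surj_S by (simp add: ring_iso_def bij_betw_def)
qed

lemma max_T_nonzero: "\<exists>t \<in> max_ideal T. t \<noteq> \<zero>\<^bsub>T\<^esub>"
proof (rule ccontr)
  assume no: "\<not> ?thesis"
  have "inj_on \<pi>\<^sub>T (carrier T)"
  proof (rule inj_onI)
    fix x y assume xy: "x \<in> carrier T" "y \<in> carrier T" "\<pi>\<^sub>T x = \<pi>\<^sub>T y"
    then have "\<pi>\<^sub>T (x \<ominus>\<^bsub>T\<^esub> y) = \<zero>\<^bsub>k\<^esub>" by (simp add: a_minus_def k.r_neg)
    then have "x \<ominus>\<^bsub>T\<^esub> y = \<zero>\<^bsub>T\<^esub>" using no xy by (auto simp: max_T)
    then show "x = y" using xy by simp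
  qed
  then show False using not_iso_T hom_T surj_T by (simp add: ring_iso_def bij_betw_def)
qed

text \<open>The componentwise inverse stays in the fiber product, since both of its components map
  to the inverse of the same element of \<open>k\<close>.\<close>

lemma units_R:
  assumes r: "r \<in> carrier R" "r \<notin> I <+>\<^bsub>R\<^esub> J"
  shows "r \<in> Units R"
proof -
  obtain s t where st: "r = (s, t)" "s \<in> carrier S" "t \<in> carrier T" "\<pi>\<^sub>S s = \<pi>\<^sub>T t" using r(1) by auto
  then have "s \<notin> max_ideal S" "t \<notin> max_ideal T" using r(2) unfolding sum_IJ by (auto simp: max_S max_T)
  then have U: "s \<in> Units S" "t \<in> Units T"
    using S.nonunit_in_max_ideal T.nonunit_in_max_ideal st by blast+
  have c: "\<pi>\<^sub>S (inv\<^bsub>S\<^esub> s) \<in> carrier k" "\<pi>\<^sub>T (inv\<^bsub>T\<^esub> t) \<in> carrier k" using U by auto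
  have "\<pi>\<^sub>S (inv\<^bsub>S\<^esub> s) \<otimes>\<^bsub>k\<^esub> \<pi>\<^sub>S s = \<one>\<^bsub>k\<^esub>"
    using U(1) st(2) p.hom_mult[of "inv\<^bsub>S\<^esub> s" s] by simp
  moreover have "\<pi>\<^sub>S s \<otimes>\<^bsub>k\<^esub> \<pi>\<^sub>T (inv\<^bsub>T\<^esub> t) = \<one>\<^bsub>k\<^esub>"
    using U(2) st(3,4) q.hom_mult[of t "inv\<^bsub>T\<^esub> t"] by simp
  ultimately have "\<pi>\<^sub>S (inv\<^bsub>S\<^esub> s) = \<pi>\<^sub>T (inv\<^bsub>T\<^esub> t)"
    using c st(2) k.inv_unique[of _ "\<pi>\<^sub>S s"] by (metis p.hom_closed)
  then have "(inv\<^bsub>S\<^esub> s, inv\<^bsub>T\<^esub> t) \<in> carrier R" using U by simp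
  moreover have "(inv\<^bsub>S\<^esub> s, inv\<^bsub>T\<^esub> t) \<otimes>\<^bsub>R\<^esub> r = \<one>\<^bsub>R\<^esub>" "r \<otimes>\<^bsub>R\<^esub> (inv\<^bsub>S\<^esub> s, inv\<^bsub>T\<^esub> t) = \<one>\<^bsub>R\<^esub>"
    using st(1) U by simp_all
  ultimately show ?thesis unfolding Units_def using r(1) by blast
qed

text \<open>An ideal \<open>L\<close> is an extension of its image in S by its elements with first
  component zero, which form an ideal of T. Both are ideals because the projections are onto, and
  lifted generators of the one together with generators of the other generate
  \<open>L\<close>.\<close>

lemma noetherian_R: "noetherian_ring R"
proof (rule R.noetherian_ringI)
  fix L assume L: "ideal L R"
  interpret L: ideal L R by (rule L)
  have fst_ideal: "ideal (fst ` H) S" if H: "ideal H R" for H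
  proof (rule S.ideal_closedI)
    interpret H: ideal H R by (rule H)
    show "fst ` H \<subseteq> carrier S" using H.a_subset by auto
    show "\<zero>\<^bsub>S\<^esub> \<in> fst ` H" using H.zero_closed by force
    show "x \<oplus>\<^bsub>S\<^esub> y \<in> fst ` H" if xy: "x \<in> fst ` H" "y \<in> fst ` H" for x y
    proof -
      obtain a b where "a \<in> H" "b \<in> H" "x = fst a" "y = fst b" using xy by blast
      then show ?thesis using H.a_closed[of a b] by (intro image_eqI[of _ _ "a \<oplus>\<^bsub>R\<^esub> b"]) auto
    qed
    show "s \<otimes>\<^bsub>S\<^esub> x \<in> fst ` H" if sx: "s \<in> carrier S" "x \<in> fst ` H" for s x
    proof -
      obtain a where a: "a \<in> H" "x = fst a" using sx by blast
      obtain t where "(s, t) \<in> carrier R" using lift_S sx(1) by blast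
      then have "(s, t) \<otimes>\<^bsub>R\<^esub> a \<in> H" using H.I_l_closed[OF a(1)] by blast
      then show ?thesis using a(2) by (intro image_eqI[of _ _ "(s, t) \<otimes>\<^bsub>R\<^esub> a"]) auto
    qed
  qed
  have snd_ideal: "ideal {t. (\<zero>\<^bsub>S\<^esub>, t) \<in> H} T" if H: "ideal H R" for H
  proof (rule T.ideal_closedI)
    interpret H: ideal H R by (rule H)
    show "{t. (\<zero>\<^bsub>S\<^esub>, t) \<in> H} \<subseteq> carrier T" using H.a_subset by auto
    show "\<zero>\<^bsub>T\<^esub> \<in> {t. (\<zero>\<^bsub>S\<^esub>, t) \<in> H}" using H.zero_closed by simp
    show "x \<oplus>\<^bsub>T\<^esub> y \<in> {t. (\<zero>\<^bsub>S\<^esub>, t) \<in> H}" if "x \<in> {t. (\<zero>\<^bsub>S\<^esub>, t) \<in> H}" "y \<in> {t. (\<zero>\<^bsub>S\<^esub>, t) \<in> H}" for x y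
      using that H.a_closed[of "(\<zero>\<^bsub>S\<^esub>, x)" "(\<zero>\<^bsub>S\<^esub>, y)"] by simp
    show "t \<otimes>\<^bsub>T\<^esub> x \<in> {t. (\<zero>\<^bsub>S\<^esub>, t) \<in> H}" if tx: "t \<in> carrier T" "x \<in> {t. (\<zero>\<^bsub>S\<^esub>, t) \<in> H}" for t x
    proof -
      obtain s where s: "(s, t) \<in> carrier R" using lift_T tx(1) by blast
      then have "(s, t) \<otimes>\<^bsub>R\<^esub> (\<zero>\<^bsub>S\<^esub>, x) \<in> H" using H.I_l_closed tx(2) by blast
      then show ?thesis using s by simp
    qed
  qed
  obtain A1 where A1: "A1 \<subseteq> carrier S" "finite A1" "fst ` L = Idl\<^bsub>S\<^esub> A1"
    using S.finetely_gen[OF fst_ideal[OF L]] by metis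
  obtain A2 where A2: "A2 \<subseteq> carrier T" "finite A2" "{t. (\<zero>\<^bsub>S\<^esub>, t) \<in> L} = Idl\<^bsub>T\<^esub> A2"
    using T.finetely_gen[OF snd_ideal[OF L]] by metis
  have "A1 \<subseteq> fst ` L" using A1 S.genideal_self by metis
  then obtain A3 where A3: "A3 \<subseteq> L" "finite A3" "fst ` A3 = A1"
    using A1(2) by (metis finite_subset_image)
  let ?A = "A3 \<union> Pair \<zero>\<^bsub>S\<^esub> ` A2"
  have A2L: "Pair \<zero>\<^bsub>S\<^esub> ` A2 \<subseteq> L" using A2 T.genideal_self[OF A2(1)] by auto
  then have AL: "?A \<subseteq> L" using A3(1) by blast
  then have AR: "?A \<subseteq> carrier R" using L.a_subset by blast
  let ?G = "Idl\<^bsub>R\<^esub> ?A"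
  have G: "ideal ?G R" "?A \<subseteq> ?G" using R.genideal_ideal[OF AR] R.genideal_self[OF AR] by blast+
  interpret G: ideal ?G R by (rule G(1))
  have "?G \<subseteq> L" by (rule R.genideal_minimal[OF L AL])
  moreover have "L \<subseteq> ?G"
  proof
    fix x assume x: "x \<in> L"
    have "Idl\<^bsub>S\<^esub> A1 \<subseteq> fst ` ?G"
      by (rule S.genideal_minimal[OF fst_ideal[OF G(1)]]) (use G(2) A3(3) in blast)
    then have "fst x \<in> fst ` ?G" using imageI[OF x, of fst] unfolding A1(3) by (rule subsetD)
    then obtain y where y: "fst x = fst y" "y \<in> ?G" by (rule imageE)
    have yL: "y \<in> L" using y(2) \<open>?G \<subseteq> L\<close> by blast
    have d: "x \<ominus>\<^bsub>R\<^esub> y \<in> L" using x yL by (simp add: a_minus_def del: fiber_product_simps)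
    have xy: "(x \<ominus>\<^bsub>R\<^esub> y) \<oplus>\<^bsub>R\<^esub> y = x"
      using L.a_Hcarr[OF x] L.a_Hcarr[OF yL] by (simp add: a_minus_def R.a_assoc R.l_neg del: fiber_product_simps)
    have c: "fst (x \<ominus>\<^bsub>R\<^esub> y) \<in> carrier S" "fst y \<in> carrier S"
      using L.a_Hcarr[OF d] L.a_Hcarr[OF yL] by auto
    have "fst (x \<ominus>\<^bsub>R\<^esub> y) \<oplus>\<^bsub>S\<^esub> fst y = fst y" using arg_cong[OF xy, of fst] y(1) by simp
    then have "fst (x \<ominus>\<^bsub>R\<^esub> y) = \<zero>\<^bsub>S\<^esub>" using c by (metis S.add.r_cancel_one')
    then have e: "x \<ominus>\<^bsub>R\<^esub> y = (\<zero>\<^bsub>S\<^esub>, snd (x \<ominus>\<^bsub>R\<^esub> y))" by (metis prod.collapse)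
    have "Idl\<^bsub>T\<^esub> A2 \<subseteq> {t. (\<zero>\<^bsub>S\<^esub>, t) \<in> ?G}"
      by (rule T.genideal_minimal[OF snd_ideal[OF G(1)]]) (use G(2) in blast)
    moreover have "snd (x \<ominus>\<^bsub>R\<^esub> y) \<in> Idl\<^bsub>T\<^esub> A2"
      using d e unfolding A2(3)[symmetric] by (metis mem_Collect_eq)
    ultimately have "snd (x \<ominus>\<^bsub>R\<^esub> y) \<in> {t. (\<zero>\<^bsub>S\<^esub>, t) \<in> ?G}" by (rule subsetD)
    then have "x \<ominus>\<^bsub>R\<^esub> y \<in> ?G" by (subst e) (rule CollectD)
    then show "x \<in> ?G" using G.a_closed[OF _ y(2)] xy by metis
  qed
  moreover have "finite ?A" using A3(2) A2(2) by blast
  ultimately show "\<exists>A\<subseteq>carrier R. finite A \<and> L = Idl\<^bsub>R\<^esub> A" using AR by blast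
qed

lemma ideal_I: "ideal I R"
  by (rule R.ideal_closedI) (auto simp: I_def max_S)

lemma ideal_J: "ideal J R"
  by (rule R.ideal_closedI) (auto simp: J_def max_T)

lemma split: "split_maximal_ideal R I J"
proof (intro split_maximal_ideal.intro split_maximal_ideal_axioms.intro cring_R noetherian_R ideal_I ideal_J units_R)
  show "I \<inter> J = {\<zero>\<^bsub>R\<^esub>}" by (auto simp: I_def J_def max_S max_T)
  show "\<one>\<^bsub>R\<^esub> \<notin> I <+>\<^bsub>R\<^esub> J" unfolding sum_IJ by (auto simp: max_S)
  show "I \<noteq> {\<zero>\<^bsub>R\<^esub>}" using max_S_nonzero by (auto simp: I_def)
  show "J \<noteq> {\<zero>\<^bsub>R\<^esub>}" using max_T_nonzero by (auto simp: J_def)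
qed

text \<open>The second projection identifies \<open>J\<close> with the maximal ideal of T, and an
  element of \<open>I\<close> has second component zero.\<close>

lemma discrete_valuation_ring_T:
  assumes "\<exists>x \<in> J. (\<forall>y \<in> J. \<exists>r \<in> carrier R. y = r \<otimes>\<^bsub>R\<^esub> x) \<and> (\<forall>r \<in> carrier R. r \<otimes>\<^bsub>R\<^esub> x = \<zero>\<^bsub>R\<^esub> \<longrightarrow> r \<in> I)"
  shows "discrete_valuation_ring T"
proof -
  obtain x where x: "x \<in> max_ideal T"
    "\<forall>y \<in> J. \<exists>r \<in> carrier R. y = r \<otimes>\<^bsub>R\<^esub> (\<zero>\<^bsub>S\<^esub>, x)"
    "\<forall>r \<in> carrier R. r \<otimes>\<^bsub>R\<^esub> (\<zero>\<^bsub>S\<^esub>, x) = \<zero>\<^bsub>R\<^esub> \<longrightarrow> r \<in> I"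
    using assms by (auto simp: J_def)
  show ?thesis
  proof (rule T.discrete_valuation_ringI[OF x(1)])
    fix y assume "y \<in> max_ideal T"
    then have "(\<zero>\<^bsub>S\<^esub>, y) \<in> J" by (simp add: J_def)
    then obtain r where "r \<in> carrier R" "(\<zero>\<^bsub>S\<^esub>, y) = r \<otimes>\<^bsub>R\<^esub> (\<zero>\<^bsub>S\<^esub>, x)" using x(2) by blast
    then show "\<exists>r \<in> carrier T. y = r \<otimes>\<^bsub>T\<^esub> x" by (intro bexI[of _ "snd r"]) auto
  next
    fix t assume t: "t \<in> carrier T" "t \<otimes>\<^bsub>T\<^esub> x = \<zero>\<^bsub>T\<^esub>"
    obtain s where s: "(s, t) \<in> carrier R" using lift_T t(1) by blast
    then have "(s, t) \<otimes>\<^bsub>R\<^esub> (\<zero>\<^bsub>S\<^esub>, x) = \<zero>\<^bsub>R\<^esub>" using t(2) by simp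
    then have "(s, t) \<in> I" using x(3) s by blast
    then show "t = \<zero>\<^bsub>T\<^esub>" by (simp add: I_def)
  qed
qed

lemma socle:
  assumes "depth S = 0 \<or> depth T = 0"
  shows "\<exists>s \<in> carrier R. s \<noteq> \<zero>\<^bsub>R\<^esub> \<and> (\<forall>z \<in> I <+>\<^bsub>R\<^esub> J. s \<otimes>\<^bsub>R\<^esub> z = \<zero>\<^bsub>R\<^esub>)"
  using assms
proof
  assume "depth S = 0"
  then obtain s where s: "s \<in> carrier S" "s \<noteq> \<zero>\<^bsub>S\<^esub>" "\<forall>z \<in> max_ideal S. z \<otimes>\<^bsub>S\<^esub> s = \<zero>\<^bsub>S\<^esub>"
    using S.depth_zero_socle by blast
  \<comment> \<open>This is what puts \<open>(s, \<zero>)\<close> into the fiber product. It holds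
    since a unit cannot annihilate the nonzero maximal ideal.\<close>
  have "s \<in> max_ideal S"
  proof (rule ccontr)
    assume "s \<notin> max_ideal S"
    then have U: "s \<in> Units S" using S.nonunit_in_max_ideal s(1) by blast
    obtain z where z: "z \<in> max_ideal S" "z \<noteq> \<zero>\<^bsub>S\<^esub>" using max_S_nonzero by blast
    then have "z \<otimes>\<^bsub>S\<^esub> s \<otimes>\<^bsub>S\<^esub> inv\<^bsub>S\<^esub> s = z" using U s(1) by (simp add: max_S S.m_assoc)
    then show False using s(3) z U by simp
  qed
  then show ?thesis
    using s unfolding sum_IJ
    by (intro bexI[of _ "(s, \<zero>\<^bsub>T\<^esub>)"]) (auto simp: max_S max_T S.m_comm)
next
  assume "depth T = 0"
  then obtain t where t: "t \<in> carrier T" "t \<noteq> \<zero>\<^bsub>T\<^esub>" "\<forall>z \<in> max_ideal T. z \<otimes>\<^bsub>T\<^esub> t = \<zero>\<^bsub>T\<^esub>"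
    using T.depth_zero_socle by blast
  have "t \<in> max_ideal T"
  proof (rule ccontr)
    assume "t \<notin> max_ideal T"
    then have U: "t \<in> Units T" using T.nonunit_in_max_ideal t(1) by blast
    obtain z where z: "z \<in> max_ideal T" "z \<noteq> \<zero>\<^bsub>T\<^esub>" using max_T_nonzero by blast
    then have "z \<otimes>\<^bsub>T\<^esub> t \<otimes>\<^bsub>T\<^esub> inv\<^bsub>T\<^esub> t = z" using U t(1) by (simp add: max_T T.m_assoc)
    then show False using t(3) z U by simp
  qed
  then show ?thesis
    using t unfolding sum_IJ
    by (intro bexI[of _ "(\<zero>\<^bsub>S\<^esub>, t)"]) (auto simp: max_S max_T T.m_comm)
qed

end

section \<open>Free modules and projective dimension\<close>

text \<open>The basis in \<open>free\<close> is a subset of \<open>M\<close>. The family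
  \<open>c\<close> is injective because it has no relations and 1 \<noteq> 0, so its image can
  replace the index set \<open>C\<close>.\<close>

lemma (in cring) freeI:
  assumes M: "module R M" and nz: "\<one> \<noteq> \<zero>" and c: "c \<in> C \<rightarrow> carrier M"
    and surj: "lincomb R M c ` carrier (free_module R C) = carrier M"
    and inj: "\<And>u. u \<in> carrier (free_module R C) \<Longrightarrow> lincomb R M c u = \<zero>\<^bsub>M\<^esub> \<Longrightarrow> u = (\<lambda>_. \<zero>)"
  shows "free R M"
proof -
  interpret M: module R M by (rule M)
  let ?F = "free_module R C" and ?G = "free_module R (c ` C)"
  interpret F: module R ?F by (rule module_free_module)
  interpret G: module R ?G by (rule module_free_module)
  have hom: "lincomb R M c \<in> module_hom R ?F M" by (rule lincomb_hom[OF M c])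
  have eqI: "u = v" if "u \<in> carrier ?F" "v \<in> carrier ?F" "lincomb R M c u = lincomb R M c v" for u v
  proof -
    have "lincomb R M c (u \<ominus>\<^bsub>?F\<^esub> v) = \<zero>\<^bsub>M\<^esub>"
      using module_hom_minus[OF F.module_axioms M hom that(1,2)] that(3) module_hom_closed[OF hom that(2)]
      by (simp add: M.M.minus_eq_zero_iff)
    then have "u \<ominus>\<^bsub>?F\<^esub> v = \<zero>\<^bsub>?F\<^esub>" using inj F.M.minus_closed[OF that(1,2)] by simp
    then show ?thesis using F.M.minus_eq_zero_iff[OF that(1,2)] by blast
  qed
  have c_inj: "inj_on c C"
  proof (rule inj_onI)
    fix x y assume xy: "x \<in> C" "y \<in> C" "c x = c y"
    then have "lincomb R M c (free_gen R x) = lincomb R M c (free_gen R y)"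
      using lincomb_free_gen[of M c x, OF M] lincomb_free_gen[of M c y, OF M] c by (simp add: Pi_iff)
    then have "free_gen R x = free_gen R y" using eqI xy by simp
    then have "free_gen R x x = free_gen R y x" by simp
    then show "x = y" using nz by (simp add: free_gen_def split: if_splits)
  qed
  let ?h = "lincomb R M (\<lambda>y. y)"
  have id: "(\<lambda>y. y) \<in> c ` C \<rightarrow> carrier M" using c by auto
  have h: "?h \<in> module_hom R ?G M" by (rule lincomb_hom[OF M id])
  have "?h ` carrier ?G = carrier M"
    using lincomb_image_span[OF M id] lincomb_image_span[OF M c] surj by simp
  moreover have "inj_on ?h (carrier ?G)"
  proof (rule inj_onI)
    fix u v assume uv: "u \<in> carrier ?G" "v \<in> carrier ?G" "?h u = ?h v"
    let ?r = "\<lambda>u x. if x \<in> C then u (c x) else \<zero>"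
    have "?r u = ?r v"
      using eqI lincomb_reindex[OF M c_inj id uv(1)] lincomb_reindex[OF M c_inj id uv(2)] uv(3) by simp
    then have "?r u x = ?r v x" for x by metis
    then have "u y = v y" if "y \<in> c ` C" for y using that by (metis imageE)
    then have "u y = v y" for y
      using uv(1,2) by (cases "y \<in> c ` C") (simp_all add: free_module_carrier)
    then show "u = v" by blast
  qed
  ultimately have "bij_betw ?h (carrier ?G) (carrier M)" by (simp add: bij_betw_def)
  then show ?thesis unfolding free_def using M h by blast
qed

lemma restrict_scalars_simps:
  "carrier (restrict_scalars f Y) = carrier Y" "\<zero>\<^bsub>restrict_scalars f Y\<^esub> = \<zero>\<^bsub>Y\<^esub>"
  "x \<oplus>\<^bsub>restrict_scalars f Y\<^esub> y = x \<oplus>\<^bsub>Y\<^esub> y" "r \<odot>\<^bsub>restrict_scalars f Y\<^esub> x = f r \<odot>\<^bsub>Y\<^esub> x"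
  by (simp_all add: restrict_scalars_def)

lemma module_restrict_scalars:
  assumes "cring R" "f \<in> ring_hom R S" "module S Y"
  shows "module R (restrict_scalars f Y)"
proof -
  interpret Y: module S Y by fact
  interpret R: cring R by fact
  have "abelian_group (restrict_scalars f Y)"
    by (rule abelian_groupI) (use Y.M.l_neg in \<open>auto simp: restrict_scalars_simps Y.M.a_ac\<close>)
  then show ?thesis
    using assms(1,2)
    by (intro moduleI)
      (auto simp: restrict_scalars_simps Y.smult_l_distr Y.smult_r_distr Y.smult_assoc1
        ring_hom_closed ring_hom_add ring_hom_mult ring_hom_one)
qed

lemma finsum_restrict_scalars:
  assumes "module R (restrict_scalars f Y)" "module S Y" "finite A" "g \<in> A \<rightarrow> carrier Y"
  shows "finsum (restrict_scalars f Y) g A = finsum Y g A"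
  using assms(3,4)
proof induct
  interpret Z: module R "restrict_scalars f Y" by fact
  interpret Y: module S Y by fact
  case empty
  then show ?case by (simp add: restrict_scalars_simps)
next
  interpret Z: module R "restrict_scalars f Y" by fact
  interpret Y: module S Y by fact
  case (insert a A)
  then have "g \<in> A \<rightarrow> carrier (restrict_scalars f Y)" "g a \<in> carrier (restrict_scalars f Y)"
    by (auto simp: restrict_scalars_simps)
  with insert show ?case by (simp add: restrict_scalars_simps)
qed

section \<open>Modules over S regarded as modules over the fiber product\<close>

context local_fiber_product
begin

interpretation R: cring R by (rule cring_R)
interpretation I: split_maximal_ideal R I J by (rule split)

lemma fst_hom: "fst \<in> ring_hom R S"
  by (rule ring_hom_memI) auto

abbreviation over_R :: "('s, 'y) module \<Rightarrow> ('s \<times> 't, 'y) module"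
  where "over_R Y \<equiv> restrict_scalars fst Y"

lemma module_over_R: "module S Y \<Longrightarrow> module R (over_R Y)"
  by (rule module_restrict_scalars[OF cring_R fst_hom])

text \<open>As \<open>fst\<close> is onto, submodules over R are stable under S, and the same
  generators serve.\<close>

lemma finitely_generated_over_R:
  assumes Y: "module S Y" "finitely_generated S Y"
  shows "finitely_generated R (over_R Y)"
proof -
  interpret Y: module S Y by (rule Y(1))
  interpret Z: module R "over_R Y" by (rule module_over_R[OF Y(1)])
  obtain A where A: "finite A" "A \<subseteq> carrier Y" "module_span S Y A = carrier Y"
    using Y(2) by (auto simp: finitely_generated_def)
  have sub: "submodule H S Y" if H: "submodule H R (over_R Y)" for H
  proof (rule Y.submoduleI)
    note HD = Z.submoduleD[OF H, unfolded restrict_scalars_simps]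
    show "H \<subseteq> carrier Y" "\<zero>\<^bsub>Y\<^esub> \<in> H" "\<And>a b. a \<in> H \<Longrightarrow> b \<in> H \<Longrightarrow> a \<oplus>\<^bsub>Y\<^esub> b \<in> H"
      using HD(1,2,4) by auto
    show smult: "s \<odot>\<^bsub>Y\<^esub> x \<in> H" if "s \<in> carrier S" "x \<in> H" for s x
      using lift_S[OF that(1)] HD(6)[OF _ that(2)] by (metis fst_conv)
    show "\<ominus>\<^bsub>Y\<^esub> a \<in> H" if "a \<in> H" for a
      using smult[of "\<ominus>\<^bsub>S\<^esub> \<one>\<^bsub>S\<^esub>" a] that HD(1) by (simp add: Y.smult_l_minus subset_iff)
  qed
  have "carrier Y \<subseteq> module_span R (over_R Y) A"
    unfolding A(3)[symmetric]
    using A(2) by (intro span_minimal sub span_submodule[OF Z.module_axioms] span_superset)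
      (simp_all add: restrict_scalars_simps)
  moreover have "module_span R (over_R Y) A \<subseteq> carrier Y"
    using span_minimal[OF Z.carrier_is_submodule] A(2) by (simp add: restrict_scalars_simps)
  ultimately show ?thesis
    using A(1,2) unfolding finitely_generated_def by (auto simp: restrict_scalars_simps)
qed

lemma J_annihilates_over_R:
  assumes "module S Y" "j \<in> J" "y \<in> carrier (over_R Y)"
  shows "j \<odot>\<^bsub>over_R Y\<^esub> y = \<zero>\<^bsub>over_R Y\<^esub>"
proof -
  interpret Y: module S Y by fact
  show ?thesis using assms(2,3) by (auto simp: restrict_scalars_simps J_def)
qed

text \<open>Coefficients act on \<open>Y\<close> through their first components. A relation over S
  lifts to one over R, which has its entries in \<open>J\<close>, and elements of \<open>J\<close>
  have first component zero.\<close>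

lemma free_of_minimally_generates:
  fixes C :: "'c set"
  assumes Y: "module S Y"
    and gen: "I.minimally_generates (over_R Y) (carrier (over_R Y)) C c"
    and ker: "\<forall>u \<in> carrier (free_module R C).
      lincomb R (over_R Y) c u = \<zero>\<^bsub>over_R Y\<^esub> \<longrightarrow> entries_in J u"
  shows "free S Y"
proof -
  interpret Y: module S Y by (rule Y)
  note g = I.minimally_generatesD[OF gen]
  have c: "c \<in> C \<rightarrow> carrier Y" using g(2) by (simp add: restrict_scalars_simps)
  have eq: "lincomb R (over_R Y) c v = lincomb S Y c (\<lambda>x. fst (v x))"
    and FS: "(\<lambda>x. fst (v x)) \<in> carrier (free_module S C)" if v: "v \<in> carrier (free_module R C)" for v
  proof -
    have vR: "v x \<in> carrier R" for x using free_module_closed[OF v] .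
    then have vS: "fst (v x) \<in> carrier S" for x using vR[of x] by (cases "v x") simp
    have v0: "v x = \<zero>\<^bsub>R\<^esub>" if "x \<notin> C" for x using v that by (simp add: free_module_carrier)
    show "(\<lambda>x. fst (v x)) \<in> carrier (free_module S C)"
      using vS v0 by (simp add: free_module_carrier_finite[OF g(1)])
    have "lincomb R (over_R Y) c v = (\<Oplus>\<^bsub>over_R Y\<^esub>x\<in>C. v x \<odot>\<^bsub>over_R Y\<^esub> c x)"
    proof (rule lincomb_finite)
      show "module R (over_R Y)" by (rule module_over_R[OF Y])
      show "finite C" by (rule g(1))
      show "v x = \<zero>\<^bsub>R\<^esub>" if "x \<notin> C" for x by (rule v0[OF that])
      show "v x \<in> carrier R" for x by (rule vR)
      show "c \<in> C \<rightarrow> carrier (over_R Y)" by (rule g(2))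
    qed
    also have "\<dots> = (\<Oplus>\<^bsub>Y\<^esub>x\<in>C. fst (v x) \<odot>\<^bsub>Y\<^esub> c x)"
      by (subst finsum_restrict_scalars[OF module_over_R[OF Y] Y g(1)])
        (use vS c in \<open>auto simp: restrict_scalars_simps\<close>)
    also have "\<dots> = lincomb S Y c (\<lambda>x. fst (v x))"
      by (rule lincomb_finite[symmetric, OF Y g(1)]) (use v0 vS c in auto)
    finally show "lincomb R (over_R Y) c v = lincomb S Y c (\<lambda>x. fst (v x))" .
  qed
  show ?thesis
  proof (rule S.freeI[OF Y _ c])
    show "\<one>\<^bsub>S\<^esub> \<noteq> \<zero>\<^bsub>S\<^esub>" using max_S_nonzero S.one_zeroD by (auto simp: max_S)
    show "lincomb S Y c ` carrier (free_module S C) = carrier Y"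
    proof
      show "lincomb S Y c ` carrier (free_module S C) \<subseteq> carrier Y"
        using module_hom_closed[OF S.lincomb_hom[OF Y c]] by auto
      show "carrier Y \<subseteq> lincomb S Y c ` carrier (free_module S C)"
        using g(4) eq FS by (auto simp: restrict_scalars_simps image_iff set_eq_iff) metis
    qed
  next
    fix u assume u: "u \<in> carrier (free_module S C)" "lincomb S Y c u = \<zero>\<^bsub>Y\<^esub>"
    \<comment> \<open>The lift is zero outside \<open>C\<close>, which makes it a vector of the free
      module over R.\<close>
    have "\<exists>t. (u x, t) \<in> carrier R \<and> (x \<notin> C \<longrightarrow> t = \<zero>\<^bsub>T\<^esub>)" for x
    proof (cases "x \<in> C")
      case True
      then show ?thesis using lift_S[of "u x"] u(1) by auto
    next
      case False
      then show ?thesis using u(1) R.zero_closed by (intro exI[of _ "\<zero>\<^bsub>T\<^esub>"]) (simp add: free_module_carrier)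
    qed
    then obtain t where t: "\<And>x. (u x, t x) \<in> carrier R \<and> (x \<notin> C \<longrightarrow> t x = \<zero>\<^bsub>T\<^esub>)" by metis
    let ?v = "\<lambda>x. (u x, t x)"
    have v: "?v \<in> carrier (free_module R C)"
      unfolding free_module_carrier_finite[OF g(1)] using t u(1) by (auto simp: free_module_carrier)
    have "lincomb R (over_R Y) c ?v = \<zero>\<^bsub>over_R Y\<^esub>" using eq[OF v] u(2) by (simp add: restrict_scalars_simps)
    then have "entries_in J ?v" using ker v by blast
    then show "u = (\<lambda>_. \<zero>\<^bsub>S\<^esub>)" by (auto simp: entries_in_def J_def)
  qed
qed

end

section \<open>Free resolutions that vanish in degree 2\<close>

context cring
begin

context
  fixes M :: "('a, 'm) module" and B :: "nat \<Rightarrow> ('a + 'm) list set" and d K \<epsilon>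
  assumes M: "module R M"
    and F: "exact_complex R (\<lambda>i. free_module R (B i)) d K"
    and \<epsilon>: "\<epsilon> \<in> module_hom R (free_module R (B 0)) M" "\<epsilon> ` carrier (free_module R (B 0)) = carrier M"
      "K 0 = {u \<in> carrier (free_module R (B 0)). \<epsilon> u = \<zero>\<^bsub>M\<^esub>}"
begin

text \<open>With bases indexed by \<open>('a + 'm) list\<close> the elements have type
  \<open>res_elem\<close>, so this resolution is admissible in \<open>Tor\<close> and in
  \<open>proj_dim\<close>.\<close>

lemma free_resolution_projective: "projective_resolution R M (\<lambda>i. free_module R (B i)) d \<epsilon>"
  unfolding projective_resolution_def
  using projective_free_module exact_complexD(2-4)[OF F] \<epsilon> by (auto simp: a_kernel_def')

lemma K_zero_of_empty:
  assumes "B (Suc i) = {}"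
  shows "K i = {\<lambda>_. \<zero>}"
proof -
  have "carrier (free_module R (B (Suc i))) = {\<lambda>_. \<zero>}"
    using assms by (auto simp: free_module_carrier)
  then have "K i = {d i (\<lambda>_. \<zero>)}" using exact_complexD(3)[OF F, of i] by simp
  also have "d i (\<lambda>_. \<zero>) = (\<lambda>_. \<zero>)"
    using module_hom_zero[OF module_free_module module_free_module exact_complexD(2)[OF F]] by simp
  finally show ?thesis .
qed

text \<open>The assumption speaks about degree 2 alone, so the resolution is cut off by zero modules
  from there on. It stays exact because the kernel of \<open>d 0\<close> is zero.\<close>

lemma proj_dim_le_one:
  assumes B2: "B 2 = {}"
  shows "proj_dim R M \<le> 1"
proof -
  let ?B = "\<lambda>i. if i \<le> 1 then B i else {}"
  let ?P = "\<lambda>i. free_module R (?B i)"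
  let ?d = "\<lambda>i. if i = 0 then d 0 else (\<lambda>_ _. \<zero>)"
  have c0: "carrier (free_module R ({} :: ('a + 'm) list set)) = {\<lambda>_. \<zero>}" by (auto simp: free_module_carrier)
  have K1: "K (Suc 0) = {\<lambda>_. \<zero>}" by (rule K_zero_of_empty) (use B2 in \<open>simp add: numeral_2_eq_2\<close>)
  have "projective_resolution R M ?P ?d \<epsilon>"
    unfolding projective_resolution_def
  proof (intro conjI allI)
    show "projective R (?P i)" for i by (rule projective_free_module)
    show "?d i \<in> module_hom R (?P (Suc i)) (?P i)" for i
      using exact_complexD(2)[OF F, of 0] by (cases i) (auto simp: module_hom_def free_module_carrier)
    show "?d 0 ` carrier (?P (Suc 0)) = a_kernel (?P 0) M \<epsilon>"
      using exact_complexD(3)[OF F, of 0] \<epsilon>(3) by (simp add: a_kernel_def')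
    show "?d (Suc i) ` carrier (?P (Suc (Suc i))) = a_kernel (?P (Suc i)) (?P i) (?d i)" for i
      using exact_complexD(4)[OF F, of 0] K1 c0 by (cases i) (auto simp: a_kernel_def')
  qed (use \<epsilon> in auto)
  moreover have "\<forall>i > 1. carrier (?P i) = {\<zero>\<^bsub>?P i\<^esub>}" using c0 by simp
  ultimately have "proj_dim R M \<le> enat 1"
    unfolding proj_dim_def by (intro Inf_lower) blast
  then show ?thesis by (simp add: one_enat_def)
qed

text \<open>Once degree 1 is empty, \<open>K 0\<close> vanishes as well and
  \<open>\<epsilon>\<close> is an isomorphism from a free module onto \<open>M\<close>.\<close>

lemma free_of_socle:
  assumes B2: "B 2 = {}" and nz: "\<one> \<noteq> \<zero>" and s: "s \<in> carrier R" "s \<noteq> \<zero>"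
    and socle: "\<And>u x. u \<in> K 0 \<Longrightarrow> s \<otimes> u x = \<zero>"
  shows "free R M"
proof -
  have K1: "K (Suc 0) = {\<lambda>_. \<zero>}" by (rule K_zero_of_empty) (use B2 in \<open>simp add: numeral_2_eq_2\<close>)
  have "B (Suc 0) = {}"
  proof (rule ccontr)
    assume "B (Suc 0) \<noteq> {}"
    then obtain b where b: "b \<in> B (Suc 0)" by blast
    let ?F = "free_module R (B (Suc 0))"
    interpret F: module R ?F by (rule module_free_module)
    have e: "free_gen R b \<in> carrier ?F" using b by simp
    have "d 0 (s \<odot>\<^bsub>?F\<^esub> free_gen R b) = s \<odot>\<^bsub>free_module R (B 0)\<^esub> d 0 (free_gen R b)"
      by (rule module_hom_smult[OF exact_complexD(2)[OF F] s(1) e])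
    also have "\<dots> = \<zero>\<^bsub>free_module R (B 0)\<^esub>"
      using socle[OF exact_complexD(6)[OF F e]] by simp
    finally have "s \<odot>\<^bsub>?F\<^esub> free_gen R b \<in> K (Suc 0)"
      using exact_complexD(4)[OF F, of 0] F.smult_closed[OF s(1) e] by (simp del: free_module_simps)
    then have "(s \<odot>\<^bsub>?F\<^esub> free_gen R b) b = \<zero>" using K1 by (metis singletonD)
    then show False using s by (simp add: free_gen_def)
  qed
  then have K0: "K 0 = {\<lambda>_. \<zero>}" by (rule K_zero_of_empty)
  let ?c = "\<lambda>b. \<epsilon> (free_gen R b)"
  have c: "?c \<in> B 0 \<rightarrow> carrier M" using module_hom_closed[OF \<epsilon>(1)] by auto
  have eq: "lincomb R M ?c u = \<epsilon> u" if "u \<in> carrier (free_module R (B 0))" for u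
    by (rule module_hom_free_lincomb[OF M \<epsilon>(1) that, symmetric])
  show ?thesis
  proof (rule freeI[OF M nz c])
    show "lincomb R M ?c ` carrier (free_module R (B 0)) = carrier M" using eq \<epsilon>(2) by simp
    show "u = (\<lambda>_. \<zero>)" if "u \<in> carrier (free_module R (B 0))" "lincomb R M ?c u = \<zero>\<^bsub>M\<^esub>" for u
    proof -
      have "u \<in> K 0" unfolding \<epsilon>(3) using that eq[OF that(1)] by simp
      then show ?thesis using K0 by simp
    qed
  qed
qed

end

end

theorem theorem1p12:
  fixes S :: "'s ring" and T :: "'t ring" and k :: "'k ring"
    and \<pi>\<^sub>S :: "'s \<Rightarrow> 'k" and \<pi>\<^sub>T :: "'t \<Rightarrow> 'k"
    and R :: "('s \<times> 't) ring"
    and M :: "('s \<times> 't, 'm) module"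
    and Y :: "('s, 'y) module"
    and m :: nat
  assumes "local_ring S" and "local_ring T" and "field k"
    and "\<pi>\<^sub>S \<in> ring_hom S k" and "\<pi>\<^sub>S ` carrier S = carrier k"
    and "\<pi>\<^sub>T \<in> ring_hom T k" and "\<pi>\<^sub>T ` carrier T = carrier k"
    and "\<pi>\<^sub>S \<notin> ring_iso S k" and "\<pi>\<^sub>T \<notin> ring_iso T k"
    and "R = fiber_product S T \<pi>\<^sub>S \<pi>\<^sub>T"
    and "module R M" and "finitely_generated R M"
    and "module S Y" and "finitely_generated S Y" and "carrier Y \<noteq> {\<zero>\<^bsub>Y\<^esub>}"
    and "m \<ge> 4"
    and "carrier (Tor R m (restrict_scalars fst Y) M)
           = {\<zero>\<^bsub>Tor R m (restrict_scalars fst Y) M\<^esub>}"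
    and "\<not> discrete_valuation_ring T \<or> \<not> free S Y"
  shows "proj_dim R M \<le> 1 \<and> (depth S = 0 \<or> depth T = 0 \<longrightarrow> free R M)"
proof -
  interpret P: local_fiber_product S T k \<pi>\<^sub>S \<pi>\<^sub>T
    using assms(1-9) by (intro local_fiber_product.intro local_fiber_product_axioms.intro)
  interpret R: split_maximal_ideal R P.I P.J unfolding assms(10) by (rule P.split)
  let ?Y = "P.over_R Y"
  have Y: "module R ?Y" "finitely_generated R ?Y" "carrier ?Y \<noteq> {\<zero>\<^bsub>?Y\<^esub>}"
    "\<And>j y. j \<in> P.J \<Longrightarrow> y \<in> carrier ?Y \<Longrightarrow> j \<odot>\<^bsub>?Y\<^esub> y = \<zero>\<^bsub>?Y\<^esub>"
    unfolding assms(10) using P.module_over_R[OF assms(13)] P.finitely_generated_over_R[OF assms(13,14)] assms(15)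
      P.J_annihilates_over_R[OF assms(13)] by (simp_all only: restrict_scalars_simps not_False_eq_True)
  have inf: "infinite (UNIV :: (('s \<times> 't) + 'm) list set)" by (rule infinite_UNIV_listI)
  obtain B :: "nat \<Rightarrow> (('s \<times> 't) + 'm) list set" and d K \<epsilon> where
    F: "exact_complex R (\<lambda>i. free_module R (B i)) d K" and fin: "\<forall>i. finite (B i)"
    and \<epsilon>: "\<epsilon> \<in> module_hom R (free_module R (B 0)) M" "\<epsilon> ` carrier (free_module R (B 0)) = carrier M"
      "K 0 = {u \<in> carrier (free_module R (B 0)). \<epsilon> u = \<zero>\<^bsub>M\<^esub>}"
    and min: "\<forall>i. \<forall>u \<in> K i. \<forall>x. u x \<in> P.I <+>\<^bsub>R\<^esub> P.J"
    and hom: "\<forall>i. \<forall>b \<in> B (Suc (Suc i)). R.homogeneous (d (Suc i) (free_gen R b))"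
    using R.minimal_resolution_exists[OF assms(11,12) inf] by (elim exE conjE) (rule that)
  obtain P \<delta> e where s: "(SOME (P, d, e). projective_resolution R M P d e) =
      (P :: nat \<Rightarrow> ('s \<times> 't, ('s \<times> 't, 'm) res_elem) module, \<delta>, e)"
    by (rule prod_cases3)
  \<comment> \<open>The minimal resolution itself witnesses that resolutions of this type exist, so
    \<open>SOME\<close> returns one.\<close>
  have "case (SOME (P :: nat \<Rightarrow> ('s \<times> 't, ('s \<times> 't, 'm) res_elem) module, d, e). projective_resolution R M P d e)
    of (P, d, e) \<Rightarrow> projective_resolution R M P d e"
    by (rule someI[of _ "(\<lambda>i. free_module R (B i), d, \<epsilon>)"])
      (simp add: R.free_resolution_projective[OF assms(11) F \<epsilon>])
  then have res: "projective_resolution R M P \<delta> e" unfolding s by simp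
  \<comment> \<open>The transfer of homology is stated in degrees \<open>Suc n\<close> and is
    applied with \<open>n\<close> equal to \<open>m - 1\<close>.\<close>
  have m: "Suc (m - 1) = m" using assms(16) by simp
  have "Tor R m ?Y M = tensor_homology R ?Y P \<delta> m" unfolding Tor_def s by simp
  then have triv: "carrier (tensor_homology R ?Y P \<delta> (Suc (m - 1))) =
      {\<zero>\<^bsub>tensor_homology R ?Y P \<delta> (Suc (m - 1))\<^esub>}"
    using assms(17) m by simp
  have ex: "mat_exact R ?Y (B (Suc m)) (d m) (B m) (d (m - 1)) (B (m - 1))"
    using R.tensor_homology_trivial_imp_mat_exact[OF assms(11) Y(1) res F _ \<epsilon> triv] fin m by simp
  have B2: "B 2 = {}"
  proof (rule R.resolution_length_one[OF F _ min _ Y assms(16) ex])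
    show "finite (B i)" for i using fin by blast
    show "R.homogeneous (d (Suc i) (free_gen R b))" if "b \<in> B (Suc (Suc i))" for i b
      using hom that by blast
    \<comment> \<open>The first conjunct makes T a discrete valuation ring and the second makes
      \<open>Y\<close> free over S; the disjunction in the hypothesis denies exactly that both
      hold.\<close>
    show "\<not> ((\<exists>x \<in> P.J. (\<forall>y \<in> P.J. \<exists>r \<in> carrier R. y = r \<otimes>\<^bsub>R\<^esub> x) \<and> (\<forall>r \<in> carrier R. r \<otimes>\<^bsub>R\<^esub> x = \<zero>\<^bsub>R\<^esub> \<longrightarrow> r \<in> P.I)) \<and>
      (\<exists>(C :: nat set) c. R.minimally_generates ?Y (carrier ?Y) C c \<and>
        (\<forall>u \<in> carrier (free_module R C). lincomb R ?Y c u = \<zero>\<^bsub>?Y\<^esub> \<longrightarrow> entries_in P.J u)))"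
      using assms(18) P.discrete_valuation_ring_T P.free_of_minimally_generates[OF assms(13)] unfolding assms(10) by blast
  qed
  have "free R M" if depth: "depth S = 0 \<or> depth T = 0"
  proof -
    obtain s where s: "s \<in> carrier R" "s \<noteq> \<zero>\<^bsub>R\<^esub>" "\<forall>z \<in> P.I <+>\<^bsub>R\<^esub> P.J. s \<otimes>\<^bsub>R\<^esub> z = \<zero>\<^bsub>R\<^esub>"
      using P.socle[OF depth] unfolding assms(10) by blast
    have nz: "\<one>\<^bsub>R\<^esub> \<noteq> \<zero>\<^bsub>R\<^esub>" using R.proper R.zero_in_sum by metis
    show ?thesis
      by (rule R.free_of_socle[OF assms(11) F \<epsilon> B2 nz s(1,2)]) (use s(3) min in blast)
  qed
  then show ?thesis using R.proj_dim_le_one[OF assms(11) F \<epsilon> B2] by blast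
qed

end
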